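(* Let $f:\mathbb{T}\to\mathbb{R}$ be a time series, $N\ge 1$, and let $\Psi_f$ be its $N$-truncated Liouville torus, equipped with the maximum metric. Then for every integer $n\ge 0$, $$\mathsf{bcd}_{n}^{\mathcal R}(\Psi_{f})=\left\{J_1^{n_1}\cap\cdots\cap J_N^{n_N}:\ J_L^{n_L}\in\mathsf{bcd}_{n_L}^{\mathcal R}(\pi_L\Psi_f)\ \text{and}\ \sum_{L=1}^N n_L=n\right\},$$ where the $n_L\ge 0$ are integers and $$J_L^{n}=\begin{cases}(0,\infty), & n=0,\\ \left(2r_L^f\sin\left(\pi\frac{k}{2k+1}\right),\,2r_L^f\sin\left(\pi\frac{k+1}{2k+3}\right)\right], & n=2k+1,\ k\in\mathbb{Z}_{\ge0},\\ \emptyset, &\text{otherwise.}\end{cases}$$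
   Context: For a metric space $(X,d)$ and $\epsilon\in\mathbb{R}$, the Vietoris–Rips complex $\mathcal R_\epsilon(X)$ is the simplicial complex whose simplices are the nonempty finite subsets $\{x_0,\dots,x_n\}\subset X$ with $\max_{i,j}d(x_i,x_j)<\epsilon$. $\mathsf{bcd}_n^{\mathcal R}(X)$ denotes the $n$-dimensional barcode of the filtration $\{\mathcal R_\epsilon(X)\}_{\epsilon\in\mathbb{R}}$: the multiset of intervals (bars) $(b,d]$ (or $(b,\infty)$) of the persistence module $\{H_n(\mathcal R_\epsilon(X))\}_\epsilon$ (homology over a fixed field); a bar $(b,d]$ represents a class born at $b$ and dying at $d$. For infinite totally bounded $X$ the barcode is that of the q-tame module (its persistence diagram, each off-diagonal point $(b,d)$ recorded as the bar $(b,d]$). Empty intervals are not bars and are discarded. $\mathbb{T}=\mathbb{R}/2\pi\mathbb{Z}$; $\hat f(L)=\frac1{2\pi}\int_0^{2\pi}f(t)e^{-iLt}\,dt$; $r_L^f=2|\hat f(L)|$. The $N$-truncated Liouville torus $\Psi_f$ is the Liouville torus in phase space $\mathbb{R}^{2N}$ of $H(\mathbf q,\mathbf p)=\sum_{L=1}^N\frac L2(p_L^2+q_L^2)$ on which the action of the $L$th oscillator is $I_L=\frac{p_L^2+q_L^2}{2}=\frac{(r_L^f)^2}{2}$; i.e. $\Psi_f=\{(\mathbf q,\mathbf p): q_L^2+p_L^2=(r_L^f)^2,\ L=1,\dots,N\}$. Let $P_L$ be the $(q_L,p_L)$-plane with the Euclidean metric, so $\mathbb{R}^{2N}=P_1\oplus\cdots\oplus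 P_N$, equipped with the maximum metric $d_{\max}(x,y)=\max_L\|\pi_L x-\pi_L y\|_2$, where $\pi_L$ is the projection onto $P_L$. Thus $\pi_L\Psi_f$ is a circle of radius $r_L^f$ with the Euclidean metric. *)

theory Defs
  imports
    "HOL-Analysis.Analysis"
    "HOL-Library.Poly_Mapping"
    "HOL-Library.Multiset"
    "Jordan_Normal_Form.VS_Connect"
begin

section \<open>Simplicial homology over a field\<close>

text \<open>
  A simplicial complex is a set \<open>K\<close> of finite nonempty sets closed under nonempty subsets.
  Homology is that of the ordered chain complex: the \<open>n\<close>-chains are the finite formal linear
  combinations of tuples \<open>(x\<^sub>0, \<dots>, x\<^sub>n)\<close>, repetitions allowed, whose vertices span a simplex.
\<close>

definition chains :: "'a set set \<Rightarrow> nat \<Rightarrow> ('a list \<Rightarrow>\<^sub>0 'k::field) set" where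
  "chains K n = {c. \<forall>xs\<in>Poly_Mapping.keys c. length xs = Suc n \<and> set xs \<in> K}"

definition face :: "nat \<Rightarrow> 'a list \<Rightarrow> 'a list" where
  "face i xs = take i xs @ drop (Suc i) xs"

text \<open>The case \<open>n = 0\<close> makes the homology unreduced.\<close>

definition boundary :: "nat \<Rightarrow> ('a list \<Rightarrow>\<^sub>0 'k::field) \<Rightarrow> ('a list \<Rightarrow>\<^sub>0 'k)" where
  "boundary n c =
     (if n = 0 then 0
      else \<Sum>xs\<in>Poly_Mapping.keys c. \<Sum>i\<le>n.
             Poly_Mapping.single (face i xs) ((-1) ^ i * Poly_Mapping.lookup c xs))"

definition cycles :: "'a set set \<Rightarrow> nat \<Rightarrow> ('a list \<Rightarrow>\<^sub>0 'k::field) set" where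
  "cycles K n = {c \<in> chains K n. boundary n c = 0}"

definition boundaries :: "'a set set \<Rightarrow> nat \<Rightarrow> ('a list \<Rightarrow>\<^sub>0 'k::field) set" where
  "boundaries K n = boundary (Suc n) ` chains K (Suc n)"

text \<open>
  The quotient space of cycles modulo boundaries; its vectors are cosets. The fields
  \<^const>\<open>mult\<close> and \<^const>\<open>one\<close> of the record type play no role in a vector space.
\<close>

definition homology ::
    "'a set set \<Rightarrow> nat \<Rightarrow> ('k::field, ('a list \<Rightarrow>\<^sub>0 'k) set) module" where
  "homology K n =
     \<lparr>carrier = (\<lambda>z. {z + b |b. b \<in> boundaries K n}) ` cycles K n,
      mult = (\<lambda>A B. boundaries K n),
      one = boundaries K n,
      zero = boundaries K n,
      add = (\<lambda>A B. {x + y |x y. x \<in> A \<and> y \<in> B}),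
      smult = (\<lambda>a A. {Poly_Mapping.map ((*) a) x + b |x b. x \<in> A \<and> b \<in> boundaries K n})\<rparr>"

text \<open>
  The map induced by the inclusion of a subcomplex into \<open>K\<close>: the coset of a cycle \<open>z\<close> is sent to
  the coset of \<open>z\<close> modulo the boundaries of \<open>K\<close>.
\<close>

definition inclusion_map ::
    "'a set set \<Rightarrow> nat \<Rightarrow> ('a list \<Rightarrow>\<^sub>0 'k::field) set \<Rightarrow> ('a list \<Rightarrow>\<^sub>0 'k) set" where
  "inclusion_map K n A = {x + b |x b. x \<in> A \<and> b \<in> boundaries K n}"


section \<open>Barcodes of q-tame persistence modules\<close>

text \<open>
  A persistence module is given by vector spaces \<open>V t\<close> and linear maps \<open>\<phi> s t\<close> from \<open>V s\<close> to
  \<open>V t\<close> for \<open>s \<le> t\<close>. It is q-tame if the ranks of all \<open>\<phi> s t\<close> with \<open>s < t\<close> are finite; only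
  then are the following notions meaningful.
\<close>

definition pm_rank ::
    "(real \<Rightarrow> ('k::field, 'v) module) \<Rightarrow> (real \<Rightarrow> real \<Rightarrow> 'v \<Rightarrow> 'v) \<Rightarrow> real \<Rightarrow> real \<Rightarrow> nat" where
  "pm_rank V \<phi> s t = vectorspace.dim class_ring ((V t)\<lparr>carrier := \<phi> s t ` carrier (V s)\<rparr>)"

text \<open>Ranks at infinite parameters, by the convention that \<open>V (-\<infinity>)\<close> and \<open>V \<infinity>\<close> are zero.\<close>

definition pm_rank_ext ::
    "(real \<Rightarrow> ('k::field, 'v) module) \<Rightarrow> (real \<Rightarrow> real \<Rightarrow> 'v \<Rightarrow> 'v) \<Rightarrow> ereal \<Rightarrow> ereal \<Rightarrow> nat" where
  "pm_rank_ext V \<phi> s t =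
     (if s = -\<infinity> \<or> t = \<infinity> then 0 else pm_rank V \<phi> (real_of_ereal s) (real_of_ereal t))"

text \<open>
  The number of points of the persistence diagram in the rectangle \<open>[a,b] \<times> [c,d]\<close>, where
  \<open>-\<infinity> \<le> a < b < c < d \<le> \<infinity>\<close> (the persistence measure of Chazal, de Silva, Glisse and Oudot).
\<close>

definition pm_measure ::
    "(real \<Rightarrow> ('k::field, 'v) module) \<Rightarrow> (real \<Rightarrow> real \<Rightarrow> 'v \<Rightarrow> 'v)
      \<Rightarrow> ereal \<Rightarrow> ereal \<Rightarrow> ereal \<Rightarrow> ereal \<Rightarrow> int" where
  "pm_measure V \<phi> a b c d =
     int (pm_rank_ext V \<phi> b c) - int (pm_rank_ext V \<phi> a c)
       - int (pm_rank_ext V \<phi> b d) + int (pm_rank_ext V \<phi> a d)"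

text \<open>
  The multiplicity of the point \<open>(p,q)\<close>, \<open>p < q\<close>, of the persistence diagram: the minimum of the
  measure over the rectangles whose interior, relative to the extended plane, contains \<open>(p,q)\<close>.
\<close>

definition pm_multiplicity ::
    "(real \<Rightarrow> ('k::field, 'v) module) \<Rightarrow> (real \<Rightarrow> real \<Rightarrow> 'v \<Rightarrow> 'v) \<Rightarrow> ereal \<Rightarrow> ereal \<Rightarrow> nat" where
  "pm_multiplicity V \<phi> p q =
     Inf {nat (pm_measure V \<phi> a b c d) |a b c d.
            (a < p \<or> a = -\<infinity> \<and> p = -\<infinity>) \<and> p < b \<and> b < c \<and> c < q \<and> (q < d \<or> q = \<infinity> \<and> d = \<infinity>)}"

text \<open>
  The bar \<open>(p,q]\<close> of a point of the diagram, as a set of reals; for \<open>q = \<infinity>\<close> it is \<open>(p,\<infinity>)\<close>.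
  For \<open>p < q\<close> it is nonempty and determines \<open>p\<close> and \<open>q\<close>.
\<close>

definition bar :: "ereal \<Rightarrow> ereal \<Rightarrow> real set" where
  "bar p q = {x. p < ereal x \<and> ereal x \<le> q}"

text \<open>A barcode may be infinite, so it is represented by its multiplicity function.\<close>

definition barcode ::
    "(real \<Rightarrow> ('k::field, 'v) module) \<Rightarrow> (real \<Rightarrow> real \<Rightarrow> 'v \<Rightarrow> 'v) \<Rightarrow> real set \<Rightarrow> nat" where
  "barcode V \<phi> I =
     (if \<exists>p q. p < q \<and> I = bar p q
      then pm_multiplicity V \<phi> (Inf (ereal ` I)) (Sup (ereal ` I)) else 0)"


section \<open>Vietoris--Rips barcodes\<close>

definition vietoris_rips :: "('a \<Rightarrow> 'a \<Rightarrow> real) \<Rightarrow> 'a set \<Rightarrow> real \<Rightarrow> 'a set set" where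
  "vietoris_rips d X \<epsilon> =
     {\<sigma>. \<sigma> \<noteq> {} \<and> finite \<sigma> \<and> \<sigma> \<subseteq> X \<and> (\<forall>x\<in>\<sigma>. \<forall>y\<in>\<sigma>. d x y < \<epsilon>)}"

definition bcd ::
    "'k::field itself \<Rightarrow> nat \<Rightarrow> ('a \<Rightarrow> 'a \<Rightarrow> real) \<Rightarrow> 'a set \<Rightarrow> real set \<Rightarrow> nat" where
  "bcd _ n d X =
     barcode
       (\<lambda>\<epsilon>. homology (vietoris_rips d X \<epsilon>) n :: ('k, ('a list \<Rightarrow>\<^sub>0 'k) set) module)
       (\<lambda>s t. inclusion_map (vietoris_rips d X t) n)"


section \<open>Truncated Liouville tori\<close>

text \<open>
  A function on the circle of length \<open>2\<pi>\<close> is represented by a \<open>2\<pi>\<close>-periodic function on the reals.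
\<close>

definition fourier_coeff :: "(real \<Rightarrow> real) \<Rightarrow> nat \<Rightarrow> complex" where
  "fourier_coeff f L =
     integral {0..2*pi} (\<lambda>t. complex_of_real (f t) * exp (- (\<i> * of_nat L * complex_of_real t)))
       / complex_of_real (2*pi)"

definition radius :: "(real \<Rightarrow> real) \<Rightarrow> nat \<Rightarrow> real" where
  "radius f L = 2 * cmod (fourier_coeff f L)"

text \<open>
  Points of the phase space are pairs of coordinate tuples \<open>(q,p)\<close>, which are functions on
  \<open>{1..N}\<close> (\<^const>\<open>undefined\<close> elsewhere).
\<close>

type_synonym phase_point = "(nat \<Rightarrow> real) \<times> (nat \<Rightarrow> real)"

definition phase_space :: "nat \<Rightarrow> phase_point set" where
  "phase_space N = ({1..N} \<rightarrow>\<^sub>E UNIV) \<times> ({1..N} \<rightarrow>\<^sub>E UNIV)"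

text \<open>
  The projection onto the \<open>(q\<^sub>L,p\<^sub>L)\<close>-plane; \<^const>\<open>dist\<close> on pairs of reals is the Euclidean metric.
\<close>

definition plane_proj :: "nat \<Rightarrow> phase_point \<Rightarrow> real \<times> real" where
  "plane_proj L x = (fst x L, snd x L)"

definition max_dist :: "nat \<Rightarrow> phase_point \<Rightarrow> phase_point \<Rightarrow> real" where
  "max_dist N x y = Max ((\<lambda>L. dist (plane_proj L x) (plane_proj L y)) ` {1..N})"

definition liouville_torus :: "(real \<Rightarrow> real) \<Rightarrow> nat \<Rightarrow> phase_point set" where
  "liouville_torus f N =
     {(q, p) \<in> phase_space N. \<forall>L\<in>{1..N}. (q L)\<^sup>2 + (p L)\<^sup>2 = (radius f L)\<^sup>2}"

definition circle_bar :: "(real \<Rightarrow> real) \<Rightarrow> nat \<Rightarrow> nat \<Rightarrow> real set" where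
  "circle_bar f L n =
     (if n = 0 then {0<..}
      else if odd n then
        (let k = real (n div 2) in
          {2 * radius f L * sin (pi * (k / (2*k + 1))) <..
           2 * radius f L * sin (pi * ((k + 1) / (2*k + 3)))})
      else {})"

end

theory Submission
  imports Defs
begin

text \<open>
  Between consecutive critical radii the Vietoris--Rips complex of the circle has the homology of a
  sphere of odd dimension \<open>2l + 1\<close>: enlarging the radius up to the next critical value does not
  change the homology, and at that value one may restrict to \<open>4l + 4\<close> equidistant points,
  which span the boundary of a cross-polytope. Both comparisons add one vertex or, in the order of
  their lengths, one edge at a time. The link is acyclic each time: its points have a sign and a
  position in a half circle, and it can be desuspended until a cone remains. At all smaller radii the
  homology in degree \<open>2l + 1\<close> vanishes, so a cocycle detecting the fundamental class can be chosen
  to vanish on all chains there. Such a family of cocycles, dual to the homology at every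
  radius, serves as a basis of the persistence module adapted to its bars.

  For the maximum metric, the complex of a product is the categorical product of the complexes of
  the factors. Slant products with the cocycles of one factor give a Kuenneth isomorphism, and the
  resulting cocycles on the product form such a family whose bars are the intersections of the bars
  of the factors. The ranks, the persistence measure and the diagram follow by counting.
\<close>

section \<open>Chains\<close>

text \<open>The critical values come from fitting chains into an arc. At angle \<tau> two points of
  opposite sign can be adjacent only if their positions differ by at least \<delta> = 1/2 - \<tau>.
  An alternating chain of 2l + 1 points inside an arc of length \<tau> has 2l gaps, and 2l \<delta>
  < \<tau> means \<tau> > l/(2l + 1). A chain of the other kind must also keep distance \<delta>
  from both ends of the arc, and (2l + 2) \<delta> > \<tau> means \<tau> < (l + 1)/(2l + 3). The
  radius is raised before points are removed because the density that the edge-by-edge argument asks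
  of a finite set grows without bound near the lower critical value, whereas at the upper one a
  fixed grid suffices. Cocycles are used instead of cycles because bars are open on the left: there
  is no first scale from which a representing cycle could be carried along, but a function on all
  chains restricts to every scale, and finding it is a matter of linear extension. Chains of all
  degrees live in one space, so that acyclicity is a single statement; the length of tuples recovers
  the degree.\<close>

definition scl :: "'k::field \<Rightarrow> ('b \<Rightarrow>\<^sub>0 'k) \<Rightarrow> ('b \<Rightarrow>\<^sub>0 'k)" where
  "scl s c = Poly_Mapping.map ((*) s) c"

lemma lookup_scl [simp]: "Poly_Mapping.lookup (scl s c) x = s * Poly_Mapping.lookup c x"
  by (simp add: scl_def Poly_Mapping.map.rep_eq when_def)

lemma scl_simps [simp]:
  "scl 1 c = c" "scl 0 c = 0" "scl s 0 = 0" "scl s (scl t c) = scl (s * t) c"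
  "scl s (Poly_Mapping.single x a) = Poly_Mapping.single x (s * a)"
  by (auto intro!: poly_mapping_eqI simp: lookup_single when_def)

lemma scl_distrib:
  "scl s (c + d) = scl s c + scl s d" "scl s (c - d) = scl s c - scl s d"
  "scl s (- c) = - scl s c" "scl (s + t) c = scl s c + scl t c" "scl (s - t) c = scl s c - scl t c"
  by (auto intro!: poly_mapping_eqI simp: lookup_add lookup_minus algebra_simps)

lemma scl_minus1: "scl (- 1) c = - c"
  by (auto intro!: poly_mapping_eqI)

lemma scl_sum: "scl s (sum f A) = (\<Sum>x\<in>A. scl s (f x))"
  by (auto intro!: poly_mapping_eqI simp: lookup_sum sum_distrib_left)

interpretation chain_space: vector_space "scl :: 'k::field \<Rightarrow> ('b \<Rightarrow>\<^sub>0 'k) \<Rightarrow> _"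
  by unfold_locales (simp_all add: scl_distrib)

text \<open>The scalar action \<open>s\<close> on the target is a parameter so that chain maps
  (\<open>lin\<close>) and functionals (\<open>linf\<close>) share one set of rules.\<close>

definition klinear :: "('k::field \<Rightarrow> 'm \<Rightarrow> 'm) \<Rightarrow> (('b \<Rightarrow>\<^sub>0 'k) \<Rightarrow> 'm::ab_group_add) \<Rightarrow> bool" where
  "klinear s F \<longleftrightarrow> (\<forall>x y. F (x + y) = F x + F y) \<and> (\<forall>a x. F (scl a x) = s a (F x))"

abbreviation lin :: "(('b \<Rightarrow>\<^sub>0 'k::field) \<Rightarrow> ('c \<Rightarrow>\<^sub>0 'k)) \<Rightarrow> bool" where "lin \<equiv> klinear scl"
abbreviation linf :: "(('b \<Rightarrow>\<^sub>0 'k::field) \<Rightarrow> 'k) \<Rightarrow> bool" where "linf \<equiv> klinear (*)"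

lemma klinearD:
  assumes "klinear s F"
  shows "F (x + y) = F x + F y" "F (scl a x) = s a (F x)" "F 0 = 0" "F (- x) = - F x"
    "F (x - y) = F x - F y" "F (sum f A) = (\<Sum>i\<in>A. F (f i))"
proof -
  show add: "F (x + y) = F x + F y" for x y using assms by (simp add: klinear_def)
  show "F (scl a x) = s a (F x)" using assms by (simp add: klinear_def)
  show z: "F 0 = 0" using add[of 0 0] by simp
  show m: "F (- x) = - F x" for x
  proof -
    have "F x + F (- x) = 0" using add[of x "- x"] z by simp
    then show ?thesis by (rule minus_unique[symmetric])
  qed
  show "F (x - y) = F x - F y" using add[of x "- y"] m[of y] by simp
  show "F (sum f A) = (\<Sum>i\<in>A. F (f i))"
    by (induction A rule: infinite_finite_induct) (simp_all add: add z)
qed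

lemma lin_id: "lin (\<lambda>c. c)" and lin_zero: "lin (\<lambda>c. 0)"
  by (simp_all add: klinear_def)

lemma lin_add: "lin F \<Longrightarrow> lin G \<Longrightarrow> lin (\<lambda>c. F c + G c)"
  and lin_diff: "lin F \<Longrightarrow> lin G \<Longrightarrow> lin (\<lambda>c. F c - G c)"
  by (simp_all add: klinear_def scl_distrib)

lemma klinear_compose: "lin F \<Longrightarrow> klinear s G \<Longrightarrow> klinear s (\<lambda>c. G (F c))"
  by (simp add: klinear_def)

lemma lin_single: "linf f \<Longrightarrow> lin (\<lambda>c. Poly_Mapping.single x (f c))"
  by (simp add: klinear_def single_add)

lemma pm_expand: "(c :: 'b \<Rightarrow>\<^sub>0 'k::field) =
    (\<Sum>x\<in>Poly_Mapping.keys c. scl (Poly_Mapping.lookup c x) (Poly_Mapping.single x 1))"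
proof (rule poly_mapping_eqI)
  fix k
  have "(\<Sum>x\<in>Poly_Mapping.keys c. Poly_Mapping.lookup (Poly_Mapping.single x (Poly_Mapping.lookup c x)) k)
      = (\<Sum>x\<in>Poly_Mapping.keys c. if x = k then Poly_Mapping.lookup c x else 0)"
    by (rule sum.cong) (auto simp: lookup_single when_def)
  also have "\<dots> = Poly_Mapping.lookup c k"
    by (simp add: sum.delta in_keys_iff)
  finally show "Poly_Mapping.lookup c k = Poly_Mapping.lookup
      (\<Sum>x\<in>Poly_Mapping.keys c. scl (Poly_Mapping.lookup c x) (Poly_Mapping.single x 1)) k"
    by (simp add: lookup_sum)
qed

lemma klinear_expand:
  assumes "klinear s F"
  shows "F c = (\<Sum>x\<in>Poly_Mapping.keys c. s (Poly_Mapping.lookup c x) (F (Poly_Mapping.single x 1)))"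
  by (subst pm_expand[of c]) (simp only: klinearD[OF assms])

lemma klinear_eq_on:
  assumes "klinear s F" "klinear s G"
    and "\<And>x. x \<in> Poly_Mapping.keys c \<Longrightarrow> F (Poly_Mapping.single x 1) = G (Poly_Mapping.single x 1)"
  shows "F c = G c"
  by (subst klinear_expand[OF assms(1)], subst klinear_expand[OF assms(2)], rule sum.cong)
    (auto simp: assms(3))

definition cspan :: "'b set \<Rightarrow> ('b \<Rightarrow>\<^sub>0 'k::field) set" where
  "cspan T = {c. Poly_Mapping.keys c \<subseteq> T}"

lemma cspan_iff: "c \<in> cspan T \<longleftrightarrow> (\<forall>x. x \<notin> T \<longrightarrow> Poly_Mapping.lookup c x = 0)"
  by (auto simp: cspan_def in_keys_iff)

lemma cspan_closed [intro]:
  "0 \<in> cspan T"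
  "c \<in> cspan T \<Longrightarrow> d \<in> cspan T \<Longrightarrow> c + d \<in> cspan T"
  "c \<in> cspan T \<Longrightarrow> d \<in> cspan T \<Longrightarrow> c - d \<in> cspan T"
  "c \<in> cspan T \<Longrightarrow> - c \<in> cspan T"
  "c \<in> cspan T \<Longrightarrow> scl s c \<in> cspan T"
  "x \<in> T \<Longrightarrow> Poly_Mapping.single x a \<in> cspan T"
  by (auto simp: cspan_iff lookup_add lookup_minus lookup_single when_def)

lemma cspan_sum: "(\<And>x. x \<in> A \<Longrightarrow> f x \<in> cspan T) \<Longrightarrow> sum f A \<in> cspan T"
  by (induction A rule: infinite_finite_induct) auto

lemma cspan_mono: "T \<subseteq> T' \<Longrightarrow> cspan T \<subseteq> cspan T'"
  by (auto simp: cspan_def)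

lemma cspan_weaken: "c \<in> cspan T \<Longrightarrow> (\<And>x. x \<in> T \<Longrightarrow> x \<in> T') \<Longrightarrow> c \<in> cspan T'"
  by (auto simp: cspan_def)

lemma in_cspan_UNIV [simp]: "c \<in> cspan UNIV" by (simp add: cspan_def)

lemma klinear_eqI:
  assumes "klinear s F" "klinear s G" "c \<in> cspan T" "\<And>xs. xs \<in> T \<Longrightarrow> F (Poly_Mapping.single xs 1) = G (Poly_Mapping.single xs 1)"
  shows "F c = G c"
proof (rule klinear_eq_on[OF assms(1,2)])
  fix xs assume "xs \<in> Poly_Mapping.keys c"
  then have "xs \<in> T" using assms(3) by (auto simp: cspan_def)
  then show "F (Poly_Mapping.single xs 1) = G (Poly_Mapping.single xs 1)" by (rule assms(4))
qed

lemma lin_cspan: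
  assumes "lin F" "\<And>x. x \<in> T \<Longrightarrow> F (Poly_Mapping.single x 1) \<in> cspan T'" "c \<in> cspan T"
  shows "F c \<in> cspan T'"
  by (subst klinear_expand[OF assms(1)]) (use assms(2,3) in \<open>auto simp: cspan_def[of T] intro!: cspan_sum\<close>)

lemma klinear_cspan_zero:
  assumes "klinear s F" "\<And>a. s a 0 = 0" "\<And>x. x \<in> T \<Longrightarrow> F (Poly_Mapping.single x 1) = 0" "c \<in> cspan T"
  shows "F c = 0"
  by (subst klinear_expand[OF assms(1)]) (use assms(2-) in \<open>auto simp: cspan_def intro!: sum.neutral\<close>)

definition restr :: "'b set \<Rightarrow> ('b \<Rightarrow>\<^sub>0 'k::field) \<Rightarrow> ('b \<Rightarrow>\<^sub>0 'k)" where
  "restr T c = (\<Sum>x\<in>Poly_Mapping.keys c \<inter> T. Poly_Mapping.single x (Poly_Mapping.lookup c x))"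

lemma lookup_restr [simp]:
  "Poly_Mapping.lookup (restr T c) x = (if x \<in> T then Poly_Mapping.lookup c x else 0)"
proof -
  have "Poly_Mapping.lookup (restr T c) x
      = (\<Sum>y\<in>Poly_Mapping.keys c \<inter> T. if y = x then Poly_Mapping.lookup c x else 0)"
    unfolding restr_def lookup_sum by (rule sum.cong) (auto simp: lookup_single when_def)
  then show ?thesis by (auto simp: in_keys_iff)
qed

lemma lin_restr: "lin (restr T)"
  by (auto simp: klinear_def lookup_add intro!: poly_mapping_eqI)

lemma restr_cspan: "c \<in> cspan T' \<Longrightarrow> restr T c \<in> cspan (T' \<inter> T)"
  by (auto simp: cspan_iff)

lemma restr_id: "c \<in> cspan T \<Longrightarrow> restr T c = c"
  by (auto simp: cspan_iff intro!: poly_mapping_eqI)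

lemma restr_zero:
  assumes "c \<in> cspan T'" "T' \<inter> T = {}"
  shows "restr T c = 0"
  using restr_cspan[OF assms(1), of T] assms(2) by (auto simp: cspan_def)

lemma restr_minus: "c \<in> cspan T' \<Longrightarrow> c - restr T c \<in> cspan (T' - T)"
  by (auto simp: cspan_iff lookup_minus)

lemma cspan_Int: "cspan (S \<inter> T) = cspan S \<inter> cspan T"
  by (auto simp: cspan_def)

lemma cspan_Un_split:
  assumes "c \<in> cspan (S \<union> T)"
  obtains a b where "a \<in> cspan S" "b \<in> cspan T" "c = a + b"
proof
  show "restr S c \<in> cspan S" using restr_cspan[OF assms, of S] by (auto simp: cspan_def)
  show "c - restr S c \<in> cspan T" using restr_minus[OF assms, of S] by (auto simp: cspan_def)
qed simp

definition lext :: "('b \<Rightarrow> ('c \<Rightarrow>\<^sub>0 'k)) \<Rightarrow> ('b \<Rightarrow>\<^sub>0 'k::field) \<Rightarrow> ('c \<Rightarrow>\<^sub>0 'k)" where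
  "lext f c = (\<Sum>x\<in>Poly_Mapping.keys c. scl (Poly_Mapping.lookup c x) (f x))"

lemma lext_superset:
  assumes "finite A" "Poly_Mapping.keys c \<subseteq> A"
  shows "lext f c = (\<Sum>x\<in>A. scl (Poly_Mapping.lookup c x) (f x))"
  unfolding lext_def using assms by (intro sum.mono_neutral_left) (auto simp: in_keys_iff)

lemma lext_single [simp]: "lext f (Poly_Mapping.single x a) = scl a (f x)"
  by (subst lext_superset[of "{x}"]) auto

lemma lin_lext: "lin (lext f)"
proof -
  have "lext f (x + y) = lext f x + lext f y" for x y
  proof -
    let ?A = "Poly_Mapping.keys x \<union> Poly_Mapping.keys y"
    have "Poly_Mapping.keys (x + y) \<subseteq> ?A" by (rule keys_add)
    then show ?thesis
      using lext_superset[of ?A x f] lext_superset[of ?A y f] lext_superset[of ?A "x + y" f]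
      by (simp add: lookup_add scl_distrib sum.distrib)
  qed
  moreover have "lext f (scl a x) = scl a (lext f x)" for a x
  proof -
    have "Poly_Mapping.keys (scl a x) \<subseteq> Poly_Mapping.keys x" by (auto simp: in_keys_iff)
    then show ?thesis
      using lext_superset[of "Poly_Mapping.keys x" "scl a x" f] by (simp add: lext_def scl_sum)
  qed
  ultimately show ?thesis by (simp add: klinear_def)
qed

text \<open>The augmented boundary: the empty tuple spans the chains of degree \<open>-1\<close>.\<close>

definition push_cons :: "'a \<Rightarrow> ('a list \<Rightarrow>\<^sub>0 'k::field) \<Rightarrow> ('a list \<Rightarrow>\<^sub>0 'k)" where
  "push_cons x = lext (\<lambda>xs. Poly_Mapping.single (x # xs) 1)"

text \<open>Peeling off the first vertex yields the usual alternating sum of faces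
  (\<open>bd_list_faces\<close>) in a form in which coning, vertex maps and prisms can be handled by
  induction on the tuple.\<close>

fun bd_list :: "'a list \<Rightarrow> ('a list \<Rightarrow>\<^sub>0 'k::field)" where
  "bd_list [] = 0"
| "bd_list (x # xs) = Poly_Mapping.single xs 1 - push_cons x (bd_list xs)"

definition bd :: "('a list \<Rightarrow>\<^sub>0 'k::field) \<Rightarrow> ('a list \<Rightarrow>\<^sub>0 'k)" where
  "bd = lext bd_list"

lemma lin_cons: "lin (push_cons x)" by (simp add: push_cons_def lin_lext)
lemma lin_bd: "lin bd" by (simp add: bd_def lin_lext)

lemma push_cons_single [simp]:
  "push_cons x (Poly_Mapping.single xs a) = Poly_Mapping.single (x # xs) a"
  by (simp add: push_cons_def)

lemmas cons_lin = klinearD[OF lin_cons]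
lemmas bd_lin = klinearD[OF lin_bd]

lemma bd_single: "bd (Poly_Mapping.single xs a) = scl a (bd_list xs)"
  by (simp add: bd_def)

text \<open>Coning with \<open>x\<close> is a contracting homotopy of the augmented complex. The
  acyclicity of cones, the suspension of cycles and the filling of cycles in a simplex all rest on
  this identity.\<close>

lemma bd_cons: "bd (push_cons x c) = c - push_cons x (bd c)"
  by (rule klinear_eqI[OF klinear_compose[OF lin_cons lin_bd]
        lin_diff[OF lin_id klinear_compose[OF lin_bd lin_cons]] in_cspan_UNIV])
    (simp add: bd_single)

lemma bd_bd [simp]: "bd (bd c) = 0"
proof (rule klinear_eq_on[where s = scl and F = "\<lambda>c. bd (bd c)" and G = "\<lambda>c. 0"])
  have *: "bd (bd_list xs) = (0 :: _ \<Rightarrow>\<^sub>0 'b)" for xs :: "'a list"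
    by (induction xs) (simp_all add: bd_lin bd_cons bd_single cons_lin)
  show "bd (bd (Poly_Mapping.single xs 1)) = (0 :: _ \<Rightarrow>\<^sub>0 'b)" for xs :: "'a list"
    by (simp add: bd_single *)
  show "lin (\<lambda>c. bd (bd c))" by (rule klinear_compose[OF lin_bd lin_bd])
qed (rule lin_zero)

text \<open>All tuple lengths are taken together. The empty tuple is a chain exactly when
  \<open>{} \<in> L\<close>, so the empty simplex decides between the augmented and the ordinary
  complex.\<close>

definition chn :: "'a set set \<Rightarrow> ('a list \<Rightarrow>\<^sub>0 'k::field) set" where
  "chn L = cspan {xs. set xs \<in> L}"

lemma chn_closed [intro]:
  "0 \<in> chn L"
  "c \<in> chn L \<Longrightarrow> d \<in> chn L \<Longrightarrow> c + d \<in> chn L"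
  "c \<in> chn L \<Longrightarrow> d \<in> chn L \<Longrightarrow> c - d \<in> chn L"
  "c \<in> chn L \<Longrightarrow> - c \<in> chn L"
  "c \<in> chn L \<Longrightarrow> scl s c \<in> chn L"
  "set xs \<in> L \<Longrightarrow> Poly_Mapping.single xs a \<in> chn L"
  by (auto simp: chn_def)

lemma chn_mono: "L \<subseteq> L' \<Longrightarrow> chn L \<subseteq> chn L'"
  unfolding chn_def by (rule cspan_mono) auto

lemma chn_Int: "chn (K \<inter> L) = chn K \<inter> chn L"
  unfolding chn_def cspan_Int[symmetric] by (rule arg_cong[of _ _ cspan]) auto

lemma chn_Un_split:
  assumes "c \<in> chn (K \<union> L)"
  obtains a b where "a \<in> chn K" "b \<in> chn L" "c = a + b"
proof -
  have "c \<in> cspan ({xs. set xs \<in> K} \<union> {xs. set xs \<in> L})"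
    using assms unfolding chn_def by (rule back_subst[of "\<lambda>S. c \<in> cspan S"]) auto
  then show ?thesis by (rule cspan_Un_split) (auto simp: chn_def intro: that)
qed

definition subclosed :: "'a set set \<Rightarrow> bool" where
  "subclosed L \<longleftrightarrow> (\<forall>\<sigma>\<in>L. \<forall>\<tau>. \<tau> \<subseteq> \<sigma> \<longrightarrow> \<tau> \<in> L)"

lemma subclosedD: "subclosed L \<Longrightarrow> \<sigma> \<in> L \<Longrightarrow> \<tau> \<subseteq> \<sigma> \<Longrightarrow> \<tau> \<in> L"
  by (auto simp: subclosed_def)

lemma subclosed_Un: "subclosed K \<Longrightarrow> subclosed L \<Longrightarrow> subclosed (K \<union> L)"
  by (auto simp: subclosed_def)

lemma cons_cspan:
  "c \<in> cspan T \<Longrightarrow> (\<And>xs. xs \<in> T \<Longrightarrow> x # xs \<in> T') \<Longrightarrow> push_cons x c \<in> cspan T'"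
  by (rule lin_cspan[OF lin_cons]) (auto)

lemma bd_list_cspan:
  "(bd_list xs :: 'a list \<Rightarrow>\<^sub>0 'k::field) \<in> cspan {ys. set ys \<subseteq> set xs \<and> length xs = Suc (length ys)}"
proof (induction xs)
  case (Cons x xs)
  have "(push_cons x (bd_list xs) :: 'a list \<Rightarrow>\<^sub>0 'k) \<in> cspan {ys. set ys \<subseteq> set (x # xs) \<and> length (x # xs) = Suc (length ys)}"
    using Cons.IH by (rule cons_cspan) auto
  then show ?case by (auto intro!: cspan_closed)
qed auto

lemma bd_cspan:
  assumes "c \<in> cspan T" "\<And>xs ys. xs \<in> T \<Longrightarrow> set ys \<subseteq> set xs \<Longrightarrow> length xs = Suc (length ys) \<Longrightarrow> ys \<in> T'"
  shows "bd c \<in> cspan T'"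
proof (rule lin_cspan[OF lin_bd _ assms(1)])
  fix xs assume "xs \<in> T"
  then show "bd (Poly_Mapping.single xs 1) \<in> cspan T'"
    using bd_list_cspan[of xs] cspan_mono[of "{ys. set ys \<subseteq> set xs \<and> length xs = Suc (length ys)}" T'] assms(2)
    by (auto simp: bd_single)
qed

lemma bd_chn: "c \<in> chn L \<Longrightarrow> subclosed L \<Longrightarrow> bd c \<in> chn L"
  unfolding chn_def by (rule bd_cspan) (auto simp: subclosed_def)

lemma cons_chn: "c \<in> chn L \<Longrightarrow> (\<And>\<sigma>. \<sigma> \<in> L \<Longrightarrow> insert x \<sigma> \<in> L') \<Longrightarrow> push_cons x c \<in> chn L'"
  unfolding chn_def by (rule cons_cspan) auto

text \<open>Here \<open>n\<close> counts vertices, so \<open>lpart n\<close> is the homogeneous part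
  of degree \<open>n - 1\<close>.\<close>

definition lpart :: "nat \<Rightarrow> ('a list \<Rightarrow>\<^sub>0 'k::field) \<Rightarrow> ('a list \<Rightarrow>\<^sub>0 'k)" where
  "lpart n = restr {xs. length xs = n}"

lemma lin_lpart: "lin (lpart n)" by (simp add: lpart_def lin_restr)

lemma lpart_single: "lpart n (Poly_Mapping.single xs a) = (if length xs = n then Poly_Mapping.single xs a else 0)"
  by (auto simp: lpart_def lookup_single when_def intro!: poly_mapping_eqI)

lemma bd_lpart: "bd (lpart (Suc n) c) = lpart n (bd c)"
proof (rule klinear_eq_on[where s = scl and F = "\<lambda>c. bd (lpart (Suc n) c)" and G = "\<lambda>c. lpart n (bd c)"])
  show "lin (\<lambda>c. bd (lpart (Suc n) c))" by (rule klinear_compose[OF lin_lpart lin_bd])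
  show "lin (\<lambda>c. lpart n (bd c))" by (rule klinear_compose[OF lin_bd lin_lpart])
  fix xs :: "'a list"
  have *: "(bd_list xs :: 'a list \<Rightarrow>\<^sub>0 'b) \<in> cspan {ys. length xs = Suc (length ys)}"
    using bd_list_cspan[of xs] cspan_mono[of "{ys. set ys \<subseteq> set xs \<and> length xs = Suc (length ys)}"
        "{ys. length xs = Suc (length ys)}"] by auto
  show "bd (lpart (Suc n) (Poly_Mapping.single xs (1::'b))) = lpart n (bd (Poly_Mapping.single xs 1))"
  proof (cases "length xs = Suc n")
    case True
    then show ?thesis using restr_id[OF *] by (simp add: lpart_single bd_single, simp add: lpart_def eq_commute)
  next
    case False
    then have "restr {ys. length ys = n} (bd_list xs :: 'a list \<Rightarrow>\<^sub>0 'b) = 0"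
      by (intro restr_zero[OF *]) auto
    then show ?thesis using False by (simp add: lpart_single bd_single bd_lin) (simp add: lpart_def)
  qed
qed

lemma lpart_chn: "c \<in> chn L \<Longrightarrow> lpart n c \<in> chn L"
  unfolding chn_def lpart_def by (drule restr_cspan[of _ _ "{xs. length xs = n}"]) (auto simp: cspan_def)


section \<open>Acyclicity and homology spheres\<close>

definition acyc :: "('m::ab_group_add \<Rightarrow> 'm) \<Rightarrow> 'm set \<Rightarrow> bool" where
  "acyc D A \<longleftrightarrow> (\<forall>x\<in>A. D x = 0 \<longrightarrow> (\<exists>y\<in>A. x = D y))"

text \<open>Acyclicity of the quotient \<open>A' / A\<close>: every relative cycle is a relative
  boundary.\<close>

definition racyc :: "('m::ab_group_add \<Rightarrow> 'm) \<Rightarrow> 'm set \<Rightarrow> 'm set \<Rightarrow> bool" where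
  "racyc D A A' \<longleftrightarrow> (\<forall>x\<in>A'. D x \<in> A \<longrightarrow> (\<exists>y\<in>A'. x - D y \<in> A))"

lemma acycD: "acyc D A \<Longrightarrow> x \<in> A \<Longrightarrow> D x = 0 \<Longrightarrow> \<exists>y\<in>A. x = D y"
  by (simp add: acyc_def)

lemma racycD: "racyc D A B \<Longrightarrow> x \<in> B \<Longrightarrow> D x \<in> A \<Longrightarrow> \<exists>y\<in>B. x - D y \<in> A"
  by (simp add: racyc_def)

definition stable :: "('m::ab_group_add \<Rightarrow> 'm) \<Rightarrow> 'm set \<Rightarrow> bool" where
  "stable D A \<longleftrightarrow> 0 \<in> A \<and> (\<forall>x\<in>A. \<forall>y\<in>A. x + y \<in> A \<and> x - y \<in> A) \<and> (\<forall>x\<in>A. D x \<in> A)"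

lemma stableD:
  assumes "stable D A"
  shows "0 \<in> A" "x \<in> A \<Longrightarrow> y \<in> A \<Longrightarrow> x + y \<in> A" "x \<in> A \<Longrightarrow> y \<in> A \<Longrightarrow> x - y \<in> A" "x \<in> A \<Longrightarrow> D x \<in> A"
  using assms by (auto simp: stable_def)

lemma stable_chn: "subclosed L \<Longrightarrow> stable bd (chn L)"
  by (auto simp: stable_def bd_chn)

locale differential =
  fixes D :: "'m::ab_group_add \<Rightarrow> 'm"
  assumes add: "D (x + y) = D x + D y" and sq: "D (D x) = 0"
begin

lemma zero: "D 0 = 0" using add[of 0 0] by simp
lemma diff: "D (x - y) = D x - D y" using add[of "x - y" y] by simp

text \<open>Excision. Modulo \<open>A\<close> only the summand \<open>b\<close> in \<open>S\<close>
  matters; its boundary lies in \<open>A \<inter> S\<close> and is filled there by \<open>e\<close>,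
  after which \<open>b - e\<close> is a cycle of \<open>S\<close> and is filled in
  \<open>S\<close>.\<close>

lemma racyc_union:
  assumes A: "stable D A" and S: "stable D S" and aS: "acyc D S" and aI: "acyc D (A \<inter> S)"
    and U: "\<And>x. x \<in> U \<Longrightarrow> \<exists>a\<in>A. \<exists>b\<in>S. x = a + b" and SU: "S \<subseteq> U"
  shows "racyc D A U"
  unfolding racyc_def
proof (intro ballI impI)
  fix x assume x: "x \<in> U" "D x \<in> A"
  obtain a b where ab: "a \<in> A" "b \<in> S" "x = a + b" using U[OF x(1)] by blast
  have "D b = D x - D a" using ab by (simp add: add)
  then have "D b \<in> A \<inter> S" using ab(1,2) x(2) stableD(3)[OF A, of "D x" "D a"] stableD(4)[OF A] stableD(4)[OF S] by (metis IntI)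
  then obtain e where e: "e \<in> A" "e \<in> S" "D b = D e"
    using aI unfolding acyc_def by (metis IntE sq)
  then have "b - e \<in> S" "D (b - e) = 0" using stableD[OF S] ab by (auto simp: diff)
  then obtain y where y: "y \<in> S" "b - e = D y" using aS unfolding acyc_def by blast
  have "x - D y = a + e" using ab y(2) by (simp add: algebra_simps)
  then have "x - D y \<in> A" using stableD(2)[OF A ab(1) e(1)] by simp
  then show "\<exists>y\<in>U. x - D y \<in> A" using y(1) SU by blast
qed

text \<open>The triple \<open>A \<subseteq> B \<subseteq> C\<close>: a relative cycle is moved first
  into \<open>B\<close> and then, still relative to \<open>A\<close>, into \<open>A\<close>. This
  lets vertices and edges be added one at a time.\<close>

lemma racyc_trans:
  assumes "racyc D A B" "racyc D B C" "A \<subseteq> B" "B \<subseteq> C" "stable D A" "stable D B" "stable D C"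
  shows "racyc D A C"
  unfolding racyc_def
proof (intro ballI impI)
  fix x assume x: "x \<in> C" "D x \<in> A"
  then obtain y where y: "y \<in> C" "x - D y \<in> B" using assms unfolding racyc_def by blast
  have "D (x - D y) \<in> A" using x by (simp add: diff sq)
  then obtain z where z: "z \<in> B" "x - D y - D z \<in> A" using assms(1) y unfolding racyc_def by blast
  then have "x - D (y + z) \<in> A" by (simp add: add algebra_simps)
  moreover have "y + z \<in> C" using y z assms(4) by (auto intro: stableD[OF assms(7)])
  ultimately show "\<exists>y\<in>C. x - D y \<in> A" by blast
qed

lemma racyc_acyc:
  assumes "racyc D A B" "acyc D A" "A \<subseteq> B" "stable D B" "stable D A"
  shows "acyc D B"
  unfolding acyc_def
proof (intro ballI impI)
  fix x assume x: "x \<in> B" "D x = 0"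
  then have "D x \<in> A" using stableD[OF assms(5)] by simp
  then obtain y where y: "y \<in> B" "x - D y \<in> A" using x assms(1) unfolding racyc_def by blast
  have "D (x - D y) = 0" using x by (simp add: diff sq)
  then obtain z where z: "z \<in> A" "x - D y = D z" using assms(2) y unfolding acyc_def by blast
  then have "x = D (y + z)" by (simp add: add algebra_simps)
  moreover have "y + z \<in> B" using y z assms(3) by (auto intro: stableD[OF assms(4)])
  ultimately show "\<exists>y\<in>B. x = D y" by blast
qed

end

interpretation bd: differential "bd :: ('a list \<Rightarrow>\<^sub>0 'k::field) \<Rightarrow> _"
  by unfold_locales (simp_all add: bd_lin)

lemma racyc_Un_chn:
  assumes "subclosed K" "subclosed L" "acyc bd (chn L :: ('a list \<Rightarrow>\<^sub>0 'k::field) set)"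
    "acyc bd (chn (K \<inter> L) :: ('a list \<Rightarrow>\<^sub>0 'k) set)"
  shows "racyc bd (chn K :: ('a list \<Rightarrow>\<^sub>0 'k) set) (chn (K \<union> L))"
proof (rule bd.racyc_union[where S = "chn L"])
  show "\<exists>a\<in>chn K. \<exists>b\<in>chn L. x = a + b" if "x \<in> chn (K \<union> L)" for x :: "'a list \<Rightarrow>\<^sub>0 'k"
    using that by (elim chn_Un_split) blast
qed (use assms chn_mono[of L "K \<union> L"] in \<open>auto simp: stable_chn chn_Int[symmetric]\<close>)

lemma acyc_Un_chn:
  assumes "subclosed K" "subclosed L" "acyc bd (chn K :: ('a list \<Rightarrow>\<^sub>0 'k::field) set)"
    "acyc bd (chn L :: ('a list \<Rightarrow>\<^sub>0 'k) set)" "acyc bd (chn (K \<inter> L) :: ('a list \<Rightarrow>\<^sub>0 'k) set)"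
  shows "acyc bd (chn (K \<union> L) :: ('a list \<Rightarrow>\<^sub>0 'k) set)"
  by (rule bd.racyc_acyc[OF racyc_Un_chn]) (use assms chn_mono[of K "K \<union> L"] in \<open>auto simp: stable_chn subclosed_Un\<close>)

lemma acyc_cone:
  assumes "\<And>\<sigma>. \<sigma> \<in> L \<Longrightarrow> insert x \<sigma> \<in> L"
  shows "acyc bd (chn L :: ('a list \<Rightarrow>\<^sub>0 'k::field) set)"
  unfolding acyc_def
proof (intro ballI impI)
  fix c :: "'a list \<Rightarrow>\<^sub>0 'k" assume "c \<in> chn L" "bd c = 0"
  then show "\<exists>y\<in>chn L. c = bd y"
    using assms by (intro bexI[of _ "push_cons x c"]) (auto simp: bd_cons cons_lin intro: cons_chn)
qed

text \<open>
  Here \<open>n\<close> is the number of vertices of a tuple, so a fundamental cycle is that of a homology sphere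
  of dimension \<open>n - 1\<close>.
\<close>

definition fund_cycle :: "nat \<Rightarrow> 'a set set \<Rightarrow> ('a list \<Rightarrow>\<^sub>0 'k::field) \<Rightarrow> bool" where
  "fund_cycle n L z \<longleftrightarrow> z \<in> chn L \<and> lpart n z = z \<and> bd z = 0 \<and> (\<forall>b\<in>chn L. bd b \<noteq> z) \<and>
     (\<forall>c\<in>chn L. bd c = 0 \<longrightarrow> (\<exists>s. \<exists>b\<in>chn L. c = scl s z + bd b))"

definition hsphere :: "'k::field itself \<Rightarrow> nat \<Rightarrow> 'a set set \<Rightarrow> bool" where
  "hsphere _ n L \<longleftrightarrow> (\<exists>z :: 'a list \<Rightarrow>\<^sub>0 'k. fund_cycle n L z)"

lemma fund_cycleD:
  assumes "fund_cycle n L z"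
  shows "z \<in> chn L" "lpart n z = z" "bd z = 0" "b \<in> chn L \<Longrightarrow> bd b \<noteq> z"
    "c \<in> chn L \<Longrightarrow> bd c = 0 \<Longrightarrow> \<exists>s. \<exists>b\<in>chn L. c = scl s z + bd b"
  using assms by (simp_all add: fund_cycle_def)

lemma hsphereI:
  fixes z :: "'a list \<Rightarrow>\<^sub>0 'k::field"
  assumes "z \<in> chn L" "lpart n z = z" "bd z = 0" "\<And>b. b \<in> chn L \<Longrightarrow> bd b \<noteq> z"
    "\<And>c. c \<in> chn L \<Longrightarrow> bd c = 0 \<Longrightarrow> \<exists>s. \<exists>b\<in>chn L. c = scl s z + bd b"
  shows "hsphere TYPE('k) n L"
  unfolding hsphere_def fund_cycle_def using assms by (intro exI[of _ z]) simp

lemma lpart_cons: "lpart (Suc n) (push_cons x c) = push_cons x (lpart n c)"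
  by (rule klinear_eqI[OF klinear_compose[OF lin_cons lin_lpart] klinear_compose[OF lin_lpart lin_cons] in_cspan_UNIV])
    (simp add: lpart_single cons_lin)

text \<open>Mayer-Vietoris for two cones. The fundamental cycle of the equator is coned off on both
  sides, and the difference of the cones is the new cycle, with one vertex more. Splitting a cycle
  or a bounding chain along \<open>K\<close> and \<open>L\<close> leads back to the equator.\<close>

lemma hsphere_suspension:
  assumes K: "subclosed K" "\<And>\<sigma>. \<sigma> \<in> K \<Longrightarrow> insert x \<sigma> \<in> K"
    and L: "subclosed L" "\<And>\<sigma>. \<sigma> \<in> L \<Longrightarrow> insert y \<sigma> \<in> L"
    and sph: "hsphere TYPE('k::field) n (K \<inter> L)"
  shows "hsphere TYPE('k) (Suc n) (K \<union> L)"
proof -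
  have K3: "acyc bd (chn K :: ('a list \<Rightarrow>\<^sub>0 'k) set)" using K(2) by (rule acyc_cone)
  have L3: "acyc bd (chn L :: ('a list \<Rightarrow>\<^sub>0 'k) set)" using L(2) by (rule acyc_cone)
  have KU: "chn K \<subseteq> (chn (K \<union> L) :: ('a list \<Rightarrow>\<^sub>0 'k) set)"
    and LU: "chn L \<subseteq> (chn (K \<union> L) :: ('a list \<Rightarrow>\<^sub>0 'k) set)" by (simp_all add: chn_mono)
  obtain z :: "'a list \<Rightarrow>\<^sub>0 'k" where fz: "fund_cycle n (K \<inter> L) z"
    using sph unfolding hsphere_def ..
  note z0 = fund_cycleD(1-3)[OF fz] and nb0 = fund_cycleD(4)[OF fz] and gen = fund_cycleD(5)[OF fz]
  have z: "z \<in> chn K" "z \<in> chn L" "lpart n z = z" "bd z = 0" using z0 by (simp_all add: chn_Int)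
  have nb: "bd b \<noteq> z" if "b \<in> chn K" "b \<in> chn L" for b
    using nb0[of b] that by (simp add: chn_Int)
  define zx where "zx = push_cons x z"
  define zy where "zy = push_cons y z"
  have zx: "zx \<in> chn K" "bd zx = z" and zy: "zy \<in> chn L" "bd zy = z"
    using cons_chn[OF z(1) K(2)] cons_chn[OF z(2) L(2)] z(4)
    by (simp_all add: zx_def zy_def bd_cons cons_lin)
  let ?z = "zx - zy"
  have 1: "?z \<in> chn (K \<union> L)" using zx zy KU LU by blast
  have 2: "lpart (Suc n) ?z = ?z"
    by (simp add: klinearD(5)[OF lin_lpart] zx_def zy_def lpart_cons z)
  have 3: "bd ?z = 0" by (simp add: bd_lin zx zy)
  have 4: "bd b \<noteq> ?z" if b: "b \<in> chn (K \<union> L)" for b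
  proof
    assume eq: "bd b = ?z"
    obtain b1 b2 where b12: "b1 \<in> chn K" "b2 \<in> chn L" "b = b1 + b2" using b by (rule chn_Un_split)
    \<comment> \<open>A chain of \<open>K\<close> by definition and of \<open>L\<close> by the
      assumed equation; \<open>- w\<close> would therefore fill \<open>z\<close> inside the
      equator.\<close>
    define w where "w = bd b1 - zx"
    have w2: "w = - bd b2 - zy" using eq b12 by (simp add: w_def bd_lin algebra_simps)
    have "- w \<in> chn L" unfolding w2 using bd_chn[OF b12(2) L(1)] zy by blast
    moreover have "- w \<in> chn K" unfolding w_def using bd_chn[OF b12(1) K(1)] zx by blast
    moreover have "bd (- w) = z" by (simp add: w_def bd_lin zx)
    ultimately show False using nb[of "- w"] by blast
  qed
  have 5: "\<exists>s. \<exists>b\<in>chn (K \<union> L). c = scl s ?z + bd b" if c: "c \<in> chn (K \<union> L)" "bd c = 0" for c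
  proof -
    obtain a b where ab: "a \<in> chn K" "b \<in> chn L" "c = a + b" using c(1) by (rule chn_Un_split)
    have ba: "bd a = - bd b" using c(2) ab by (simp add: bd_lin eq_neg_iff_add_eq_0)
    have "bd a \<in> chn K" using bd_chn ab K by blast
    moreover have "bd a \<in> chn L" unfolding ba using bd_chn[OF ab(2) L(1)] by blast
    ultimately obtain s e where e: "e \<in> chn K" "e \<in> chn L" "bd a = scl s z + bd e"
      using gen[of "bd a"] by (auto simp: chn_Int)
    have "a - scl s zx - e \<in> chn K" using ab e zx by (intro chn_closed)
    moreover have "bd (a - scl s zx - e) = 0" by (simp add: bd_lin e zx)
    ultimately obtain f where f: "f \<in> chn K" "a - scl s zx - e = bd f" using acycD[OF K3] by blast
    have "b + scl s zy + e \<in> chn L" using ab e zy by (intro chn_closed)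
    moreover have "bd b = - bd a" by (simp add: ba)
    then have "bd (b + scl s zy + e) = 0" by (simp add: bd_lin zy e(3))
    ultimately obtain g where g: "g \<in> chn L" "b + scl s zy + e = bd g" using acycD[OF L3] by blast
    have "c = scl s ?z + ((a - scl s zx - e) + (b + scl s zy + e))"
      by (simp add: ab scl_distrib)
    then have "c = scl s ?z + bd (f + g)" by (simp add: f g bd_lin)
    moreover have "f + g \<in> chn (K \<union> L)" using f g KU LU by blast
    ultimately show ?thesis by blast
  qed
  show ?thesis by (rule hsphereI[OF 1 2 3 4 5])
qed

text \<open>Relative acyclicity makes the inclusion an isomorphism in homology. Upwards the
  fundamental cycle can be kept: fillings and cycles of \<open>L\<close> are moved into
  \<open>K\<close>.\<close>

lemma hsphere_up:
  assumes r: "racyc bd (chn K :: ('a list \<Rightarrow>\<^sub>0 'k::field) set) (chn L)" and KL: "K \<subseteq> L"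
    and sph: "hsphere TYPE('k) n K"
  shows "hsphere TYPE('k) n L"
proof -
  have m: "chn K \<subseteq> (chn L :: ('a list \<Rightarrow>\<^sub>0 'k) set)" using KL by (rule chn_mono)
  obtain z :: "'a list \<Rightarrow>\<^sub>0 'k" where fz: "fund_cycle n K z"
    using sph unfolding hsphere_def ..
  note z = fund_cycleD(1-3)[OF fz] and nb = fund_cycleD(4)[OF fz] and gen = fund_cycleD(5)[OF fz]
  have nb': "bd b \<noteq> z" if bL: "b \<in> chn L" for b
  proof
    assume "bd b = z"
    then have "bd b \<in> chn K" using z by simp
    then obtain y where "b - bd y \<in> chn K" using racycD[OF r bL] by blast
    moreover have "bd (b - bd y) = z" using \<open>bd b = z\<close> by (simp add: bd_lin)
    ultimately show False using nb by blast
  qed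
  have gen': "\<exists>s. \<exists>b\<in>chn L. c = scl s z + bd b" if c: "c \<in> chn L" "bd c = 0" for c
  proof -
    have "bd c \<in> chn K" using c by auto
    then obtain y where y: "y \<in> chn L" "c - bd y \<in> chn K" using racycD[OF r c(1)] by blast
    moreover have "bd (c - bd y) = 0" using c by (simp add: bd_lin)
    ultimately obtain s b where b: "b \<in> chn K" "c - bd y = scl s z + bd b" using gen by blast
    then have "c = scl s z + bd (b + y)" by (simp add: bd_lin algebra_simps)
    moreover have "b + y \<in> chn L" using b y m by blast
    ultimately show ?thesis by blast
  qed
  show ?thesis by (rule hsphereI[OF subsetD[OF m z(1)] z(2,3) nb' gen'])
qed

text \<open>Downwards the fundamental cycle itself has to be replaced by a homologous one supported
  in \<open>K\<close>, without losing homogeneity.\<close>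

lemma hsphere_down:
  assumes r: "racyc bd (chn K :: ('a list \<Rightarrow>\<^sub>0 'k::field) set) (chn L)" and KL: "K \<subseteq> L"
    and sph: "hsphere TYPE('k) n L"
  shows "hsphere TYPE('k) n K"
proof -
  have m: "chn K \<subseteq> (chn L :: ('a list \<Rightarrow>\<^sub>0 'k) set)" using KL by (rule chn_mono)
  obtain z :: "'a list \<Rightarrow>\<^sub>0 'k" where fz: "fund_cycle n L z"
    using sph unfolding hsphere_def ..
  note z = fund_cycleD(1-3)[OF fz] and nb = fund_cycleD(4)[OF fz] and gen = fund_cycleD(5)[OF fz]
  have "bd z \<in> chn K" using z by auto
  then obtain y0 where y0: "y0 \<in> chn L" "z - bd y0 \<in> chn K" using racycD[OF r z(1)] by blast
  \<comment> \<open>Only the homogeneous part of the correcting chain is subtracted, so that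
    \<open>w\<close> still consists of tuples of length \<open>n\<close>.\<close>
  define y where "y = lpart (Suc n) y0"
  define w where "w = z - bd y"
  have y: "y \<in> chn L" using y0 by (simp add: y_def lpart_chn)
  have w': "w = lpart n (z - bd y0)" by (simp add: w_def y_def bd_lpart klinearD[OF lin_lpart] z)
  then have w: "w \<in> chn K" using lpart_chn[OF y0(2), of n] by simp
  have "lpart n (lpart n c) = lpart n c" for c :: "'a list \<Rightarrow>\<^sub>0 'k"
    by (rule poly_mapping_eqI) (simp add: lpart_def)
  then have wl: "lpart n w = w" by (simp add: w')
  have wb: "bd w = 0" by (simp add: w_def bd_lin z)
  have nb': "bd b \<noteq> w" if "b \<in> chn K" for b
  proof
    assume "bd b = w"
    then have "bd (b + y) = z" by (simp add: bd_lin w_def)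
    then show False using nb[of "b + y"] that m y by blast
  qed
  have gen': "\<exists>s. \<exists>b\<in>chn K. c = scl s w + bd b" if c: "c \<in> chn K" "bd c = 0" for c
  proof -
    obtain s b where b: "b \<in> chn L" "c = scl s z + bd b" using gen c m by blast
    have eq: "c - scl s w = bd (b + scl s y)" using b by (simp add: w_def bd_lin scl_distrib)
    moreover have "c - scl s w \<in> chn K" using c w by blast
    moreover have "b + scl s y \<in> chn L" using b y by blast
    ultimately obtain e where e: "e \<in> chn L" "b + scl s y - bd e \<in> chn K"
      using racycD[OF r, of "b + scl s y"] by auto
    have "c = scl s w + bd (b + scl s y - bd e)" using eq by (simp add: bd_lin algebra_simps)
    then show ?thesis using e by blast
  qed
  show ?thesis by (rule hsphereI[OF w wl wb nb' gen'])
qed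

section \<open>Clique complexes\<close>

text \<open>Adjacency matters only between distinct vertices, and the empty simplex is included.\<close>

definition cliques :: "('a \<Rightarrow> 'a \<Rightarrow> bool) \<Rightarrow> 'a set \<Rightarrow> 'a set set" where
  "cliques adj A = {\<sigma>. finite \<sigma> \<and> \<sigma> \<subseteq> A \<and> (\<forall>x\<in>\<sigma>. \<forall>y\<in>\<sigma>. x \<noteq> y \<longrightarrow> adj x y)}"

lemma cliquesD:
  assumes "\<sigma> \<in> cliques adj A"
  shows "finite \<sigma>" "\<sigma> \<subseteq> A" "x \<in> \<sigma> \<Longrightarrow> y \<in> \<sigma> \<Longrightarrow> x \<noteq> y \<Longrightarrow> adj x y"
  using assms by (simp_all add: cliques_def)

lemma cliques_Int: "cliques adj A \<inter> cliques adj B = cliques adj (A \<inter> B)"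
  by (auto simp: cliques_def)

lemma cliques_subset: "\<sigma> \<in> cliques adj A \<Longrightarrow> \<sigma> \<subseteq> B \<Longrightarrow> \<sigma> \<in> cliques adj B"
  by (simp add: cliques_def)

lemma subclosed_cliques: "subclosed (cliques adj A)"
  by (auto simp: subclosed_def cliques_def intro: finite_subset)

lemma cliques_mono:
  assumes "A \<subseteq> B" "\<And>x y. x \<in> A \<Longrightarrow> y \<in> A \<Longrightarrow> adj x y \<Longrightarrow> adj' x y"
  shows "cliques adj A \<subseteq> cliques adj' B"
proof
  fix \<sigma> assume "\<sigma> \<in> cliques adj A"
  then have *: "finite \<sigma>" "\<sigma> \<subseteq> A" "\<And>x y. x \<in> \<sigma> \<Longrightarrow> y \<in> \<sigma> \<Longrightarrow> x \<noteq> y \<Longrightarrow> adj x y" by (simp_all add: cliques_def)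
  have "adj' x y" if "x \<in> \<sigma>" "y \<in> \<sigma>" "x \<noteq> y" for x y
    using assms(2)[of x y] *(2) *(3)[OF that] that by blast
  then show "\<sigma> \<in> cliques adj' B" using * assms(1) by (simp add: cliques_def)
qed

lemma insert_cliques:
  assumes "symp adj" "u \<in> A" "\<sigma> \<in> cliques adj A"
  shows "insert u \<sigma> \<in> cliques adj A \<longleftrightarrow> (\<forall>x\<in>\<sigma>. x = u \<or> adj u x)"
proof -
  have "adj x y \<longleftrightarrow> adj y x" for x y using sympD[OF assms(1)] by blast
  then show ?thesis using assms(2,3) unfolding cliques_def by (simp, metis)
qed

text \<open>A clique outside both stars would contain a non-neighbour of \<open>u\<close> and a
  non-neighbour of \<open>v\<close>, and \<open>cover\<close> forbids these to be equal or adjacent.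
  Thus two cones cover the complex, and since their apexes are not adjacent they meet in the cliques
  of common neighbours: for homology, a suspension.\<close>

lemma cliques_two_stars:
  assumes sym: "symp adj" and uv: "u \<in> A" "v \<in> A" "u \<noteq> v" "\<not> adj u v"
    and cover: "\<And>x y. x \<in> A \<Longrightarrow> y \<in> A \<Longrightarrow> x \<noteq> u \<Longrightarrow> \<not> adj u x \<Longrightarrow> y \<noteq> v \<Longrightarrow> \<not> adj v y \<Longrightarrow> x \<noteq> y \<and> \<not> adj x y"
  shows "cliques adj A = {\<sigma> \<in> cliques adj A. insert u \<sigma> \<in> cliques adj A} \<union> {\<sigma> \<in> cliques adj A. insert v \<sigma> \<in> cliques adj A}"
    and "{\<sigma> \<in> cliques adj A. insert u \<sigma> \<in> cliques adj A} \<inter> {\<sigma> \<in> cliques adj A. insert v \<sigma> \<in> cliques adj A} =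
      cliques adj {x \<in> A. x \<noteq> u \<and> x \<noteq> v \<and> adj u x \<and> adj v x}"
    and "subclosed {\<sigma> \<in> cliques adj A. insert w \<sigma> \<in> cliques adj A}"
proof -
  define S where "S \<equiv> \<lambda>w. {\<sigma> \<in> cliques adj A. insert w \<sigma> \<in> cliques adj A}"
  have 1: "cliques adj A = S u \<union> S v"
  proof (rule antisym; rule subsetI)
    fix \<sigma> assume \<sigma>: "\<sigma> \<in> cliques adj A"
    then have "(\<forall>x\<in>\<sigma>. x = u \<or> adj u x) \<or> (\<forall>x\<in>\<sigma>. x = v \<or> adj v x)"
      using cover unfolding cliques_def by blast
    then show "\<sigma> \<in> S u \<union> S v" using \<sigma> uv by (auto simp: S_def insert_cliques[OF sym])
  qed (auto simp: S_def)
  have vu: "\<not> adj v u" using uv sympD[OF sym] by blast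
  have 2: "S u \<inter> S v = cliques adj {x \<in> A. x \<noteq> u \<and> x \<noteq> v \<and> adj u x \<and> adj v x}"
  proof (rule antisym; rule subsetI)
    fix \<sigma> assume \<sigma>: "\<sigma> \<in> S u \<inter> S v"
    then have "\<forall>x\<in>\<sigma>. (x = u \<or> adj u x) \<and> (x = v \<or> adj v x)" "\<sigma> \<in> cliques adj A"
      using uv by (auto simp: S_def insert_cliques[OF sym])
    then show "\<sigma> \<in> cliques adj {x \<in> A. x \<noteq> u \<and> x \<noteq> v \<and> adj u x \<and> adj v x}"
      using uv vu by (auto simp: cliques_def)
  next
    fix \<sigma> assume \<sigma>: "\<sigma> \<in> cliques adj {x \<in> A. x \<noteq> u \<and> x \<noteq> v \<and> adj u x \<and> adj v x}"
    then have "\<sigma> \<in> cliques adj A" by (auto simp: cliques_def)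
    then show "\<sigma> \<in> S u \<inter> S v" using \<sigma> uv by (auto simp: S_def insert_cliques[OF sym]) (auto simp: cliques_def)
  qed
  have 3: "subclosed (S w)"
    unfolding subclosed_def
  proof (intro ballI allI impI)
    fix \<sigma> \<tau> assume "\<sigma> \<in> S w" "\<tau> \<subseteq> \<sigma>"
    then show "\<tau> \<in> S w" unfolding S_def
      using subclosedD[OF subclosed_cliques, of \<sigma> adj A \<tau>] subclosedD[OF subclosed_cliques, of "insert w \<sigma>" adj A "insert w \<tau>"]
      by blast
  qed
  show "cliques adj A = {\<sigma> \<in> cliques adj A. insert u \<sigma> \<in> cliques adj A} \<union> {\<sigma> \<in> cliques adj A. insert v \<sigma> \<in> cliques adj A}"
    and "{\<sigma> \<in> cliques adj A. insert u \<sigma> \<in> cliques adj A} \<inter> {\<sigma> \<in> cliques adj A. insert v \<sigma> \<in> cliques adj A} =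
      cliques adj {x \<in> A. x \<noteq> u \<and> x \<noteq> v \<and> adj u x \<and> adj v x}"
    and "subclosed {\<sigma> \<in> cliques adj A. insert w \<sigma> \<in> cliques adj A}"
    using 1 2 3 by (simp_all only: S_def)
qed

lemma acyc_suspension:
  assumes sym: "symp adj" and uv: "u \<in> A" "v \<in> A" "u \<noteq> v" "\<not> adj u v"
    and cover: "\<And>x y. x \<in> A \<Longrightarrow> y \<in> A \<Longrightarrow> x \<noteq> u \<Longrightarrow> \<not> adj u x \<Longrightarrow> y \<noteq> v \<Longrightarrow> \<not> adj v y \<Longrightarrow> x \<noteq> y \<and> \<not> adj x y"
    and acyc: "acyc bd (chn (cliques adj {x \<in> A. x \<noteq> u \<and> x \<noteq> v \<and> adj u x \<and> adj v x}) :: ('a list \<Rightarrow>\<^sub>0 'k::field) set)"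
  shows "acyc bd (chn (cliques adj A) :: ('a list \<Rightarrow>\<^sub>0 'k) set)"
proof -
  let ?S = "\<lambda>w. {\<sigma> \<in> cliques adj A. insert w \<sigma> \<in> cliques adj A}"
  note two = cliques_two_stars[OF sym uv cover]
  have "acyc bd (chn (?S u \<union> ?S v) :: ('a list \<Rightarrow>\<^sub>0 'k) set)"
  proof (rule acyc_Un_chn)
    show "acyc bd (chn (?S u \<inter> ?S v) :: ('a list \<Rightarrow>\<^sub>0 'k) set)" by (subst two(2)) (use acyc in auto)
    show "acyc bd (chn (?S u) :: ('a list \<Rightarrow>\<^sub>0 'k) set)" by (rule acyc_cone[of _ u]) auto
    show "acyc bd (chn (?S v) :: ('a list \<Rightarrow>\<^sub>0 'k) set)" by (rule acyc_cone[of _ v]) auto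
    show "subclosed (?S u)" "subclosed (?S v)" by (rule two(3); assumption)+
  qed
  then show ?thesis by (subst two(1)) auto
qed

lemma hsphere_cliques_suspension:
  assumes sym: "symp adj" and uv: "u \<in> A" "v \<in> A" "u \<noteq> v" "\<not> adj u v"
    and cover: "\<And>x y. x \<in> A \<Longrightarrow> y \<in> A \<Longrightarrow> x \<noteq> u \<Longrightarrow> \<not> adj u x \<Longrightarrow> y \<noteq> v \<Longrightarrow> \<not> adj v y \<Longrightarrow> x \<noteq> y \<and> \<not> adj x y"
    and sph: "hsphere TYPE('k::field) n (cliques adj {x \<in> A. x \<noteq> u \<and> x \<noteq> v \<and> adj u x \<and> adj v x})"
  shows "hsphere TYPE('k) (Suc n) (cliques adj A)"
proof -
  let ?S = "\<lambda>w. {\<sigma> \<in> cliques adj A. insert w \<sigma> \<in> cliques adj A}"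
  note two = cliques_two_stars[OF sym uv cover]
  have "hsphere TYPE('k) (Suc n) (?S u \<union> ?S v)"
  proof (rule hsphere_suspension[where x = u and y = v])
    show "hsphere TYPE('k) n (?S u \<inter> ?S v)" by (subst two(2)) (use sph in auto)
    show "subclosed (?S u)" "subclosed (?S v)" by (rule two(3); assumption)+
  qed auto
  then show ?thesis by (subst two(1)) auto
qed

lemma acyc_cliques_cone:
  assumes "symp adj" "u \<in> A" "\<And>x. x \<in> A \<Longrightarrow> x \<noteq> u \<Longrightarrow> adj u x"
  shows "acyc bd (chn (cliques adj A) :: ('a list \<Rightarrow>\<^sub>0 'k::field) set)"
proof (rule acyc_cone)
  fix \<sigma> assume "\<sigma> \<in> cliques adj A"
  then show "insert u \<sigma> \<in> cliques adj A" using assms by (subst insert_cliques) (auto simp: cliques_def)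
qed

text \<open>\<open>s\<close> is the sign of the first point and \<open>q\<close> the number of
  points. For \<open>q = 0\<close> the condition is void, so a length at which one sign admits a
  chain and the other does not is positive.\<close>

definition alt_chain :: "('a \<Rightarrow> 'a \<Rightarrow> bool) \<Rightarrow> ('a \<Rightarrow> bool) \<Rightarrow> ('a \<Rightarrow> real) \<Rightarrow> 'a set \<Rightarrow> bool \<Rightarrow> nat \<Rightarrow> (nat \<Rightarrow> 'a) \<Rightarrow> bool" where
  "alt_chain adj sg pos X s q f \<longleftrightarrow> (\<forall>i<q. f i \<in> X \<and> sg (f i) = (s = even i)) \<and>
     (\<forall>i. Suc i < q \<longrightarrow> adj (f i) (f (Suc i)) \<and> pos (f i) < pos (f (Suc i)))"

text \<open>
  Unless they dominate all of \<open>X\<close>, the leftmost points of either sign are nonadjacent and exhibit the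
  complex as a suspension; passing to its equator shortens the longest alternating chains of both
  kinds by one and exchanges the signs.
\<close>

lemma alternating_acyclic:
  fixes pos :: "'a \<Rightarrow> real"
  assumes sym: "symp adj"
    and "finite X"
    and "\<And>x y. x \<in> X \<Longrightarrow> y \<in> X \<Longrightarrow> sg x = sg y \<Longrightarrow> x \<noteq> y \<Longrightarrow> adj x y"
    and "\<And>x y. x \<in> X \<Longrightarrow> y \<in> X \<Longrightarrow> sg x \<noteq> sg y \<Longrightarrow> adj x y \<Longrightarrow> pos x \<noteq> pos y"
    and "\<And>x x' y y'. \<lbrakk>x \<in> X; x' \<in> X; y \<in> X; y' \<in> X; sg x' = sg x; sg y' = sg y; sg x \<noteq> sg y;
           pos x' \<le> pos x; pos y \<le> pos y'; pos x < pos y; adj x y\<rbrakk> \<Longrightarrow> adj x' y'"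
    and "alt_chain adj sg pos X s q f"
    and "\<And>g. \<not> alt_chain adj sg pos X (\<not> s) q g"
  shows "acyc bd (chn (cliques adj X) :: ('a list \<Rightarrow>\<^sub>0 'k::field) set)"
  using assms(2-)
proof (induction q arbitrary: X s f)
  case 0
  then show ?case by (simp add: alt_chain_def)
next
  case (Suc q)
  note fin = Suc.prems(1) and same = Suc.prems(2) and opp = Suc.prems(3) and mono = Suc.prems(4)
  note f = Suc.prems(5)[unfolded alt_chain_def] and nochain = Suc.prems(6)
  have symD: "adj x y \<Longrightarrow> adj y x" for x y using sympD[OF sym] .
  have min: "\<exists>u\<in>A. \<forall>x\<in>A. pos u \<le> pos x" if "A \<noteq> {}" "A \<subseteq> X" for A
  proof -
    have "finite (pos ` A)" "pos ` A \<noteq> {}" using fin that finite_subset by auto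
    then obtain u where "u \<in> A" "pos u = Min (pos ` A)" using Min_in[of "pos ` A"] by fastforce
    then show ?thesis using Min_le[OF \<open>finite (pos ` A)\<close>] by (intro bexI[of _ u]) auto
  qed
  have "f 0 \<in> {x \<in> X. sg x = s}" using f by auto
  then obtain u where u: "u \<in> X" "sg u = s" "\<And>x. x \<in> X \<Longrightarrow> sg x = s \<Longrightarrow> pos u \<le> pos x"
    using min[of "{x \<in> X. sg x = s}"] by blast
  show ?case
  proof (cases "{x \<in> X. sg x = (\<not> s)} = {}")
    case True
    then show ?thesis using u same by (intro acyc_cliques_cone[OF sym u(1)]) auto
  next
    case False
    then obtain v where v: "v \<in> X" "sg v = (\<not> s)" "\<And>x. x \<in> X \<Longrightarrow> sg x = (\<not> s) \<Longrightarrow> pos v \<le> pos x"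
      using min[of "{x \<in> X. sg x = (\<not> s)}"] by blast
    show ?thesis
    proof (cases "adj u v")
      \<comment> \<open>If the two leftmost points are adjacent, the left one of them is a cone
        apex: it is adjacent to its own sign anyway, and to the other sign by monotonicity, since
        those points lie at least as far right as their leftmost one.\<close>
      case adj: True
      then consider "pos u < pos v" | "pos v < pos u" using opp[OF u(1) v(1)] u v by force
      then show ?thesis
      proof cases
        case 1
        have "adj u x" if "x \<in> X" "x \<noteq> u" for x
        proof (cases "sg x = s")
          case False
          then show ?thesis using mono[OF u(1) u(1) v(1) that(1)] u v adj 1 that by auto
        qed (use same u that in auto)
        then show ?thesis by (rule acyc_cliques_cone[OF sym u(1)])
      next
        case 2
        have "adj v x" if "x \<in> X" "x \<noteq> v" for x
        proof (cases "sg x = s")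
          case True
          then show ?thesis using mono[OF v(1) v(1) u(1) that(1)] u v symD[OF adj] 2 that by auto
        qed (use same v that in auto)
        then show ?thesis by (rule acyc_cliques_cone[OF sym v(1)])
      qed
    next
      case nadj: False
      define X' where "X' = {x \<in> X. x \<noteq> u \<and> x \<noteq> v \<and> adj u x \<and> adj v x}"
      have X'X: "x \<in> X'  \<Longrightarrow> x \<in> X" for x by (simp add: X'_def)
      have adjmin: "adj w y" if "x \<in> X" "y \<in> X" "adj x y" "pos x < pos y" "sg x \<noteq> sg y"
        "w = (if sg x = s then u else v)" for x y w
        using mono[of x w y y] u v that by auto
      have "acyc bd (chn (cliques adj X') :: ('a list \<Rightarrow>\<^sub>0 'k) set)"
      proof (rule Suc.IH[where s = "\<not> s" and f = "\<lambda>i. f (Suc i)"])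
        show "finite X'" using fin by (simp add: X'_def)
        \<comment> \<open>Dropping \<open>f 0\<close> suffices. Each later point has a neighbour of
          opposite sign to its left, hence is adjacent to the leftmost point of that sign, and
          therefore is not itself the leftmost point of its own sign, because \<open>u\<close> and
          \<open>v\<close> are not adjacent.\<close>
        show "alt_chain adj sg pos X' (\<not> s) q (\<lambda>i. f (Suc i))"
          unfolding alt_chain_def
        proof (intro conjI allI impI)
          fix i assume i: "i < q"
          have fi: "f i \<in> X" "f (Suc i) \<in> X" "sg (f i) = (s = even i)" "sg (f (Suc i)) = (s = odd i)"
            "adj (f i) (f (Suc i))" "pos (f i) < pos (f (Suc i))"
            using f i by auto
          let ?w = "if sg (f i) = s then u else v" and ?w' = "if sg (f i) = s then v else u"
          have 1: "adj ?w (f (Suc i))" using adjmin[OF fi(1,2,5,6)] fi(3,4) by auto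
          have 2: "f (Suc i) \<noteq> ?w'" using 1 nadj symD by auto
          have 3: "f (Suc i) \<noteq> ?w" using fi(3,4) u(2) v(2) by auto
          have "adj ?w' (f (Suc i))"
            using same[of ?w' "f (Suc i)"] u v fi(2-4) 2 by auto
          then show "f (Suc i) \<in> X'" using 1 2 3 fi(2) by (auto simp: X'_def split: if_splits)
          show "sg (f (Suc i)) = ((\<not> s) = even i)" using fi by auto
        qed (use f in auto)
        show "\<not> alt_chain adj sg pos X' (\<not> \<not> s) q g" for g
        proof
          assume g: "alt_chain adj sg pos X' (\<not> \<not> s) q g"
          \<comment> \<open>A chain on the equator starting with sign \<open>s\<close> could be
            prolonged by \<open>v\<close> in front; were its first point to the left of
            \<open>v\<close>, monotonicity would make \<open>u\<close> and \<open>v\<close>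
            adjacent.\<close>
          define h where "h = (\<lambda>i. case i of 0 \<Rightarrow> v | Suc j \<Rightarrow> g j)"
          have "alt_chain adj sg pos X (\<not> s) (Suc q) h"
            unfolding alt_chain_def
          proof (intro conjI allI impI)
            fix i assume "i < Suc q"
            then show "h i \<in> X" "sg (h i) = ((\<not> s) = even i)"
              using g v X'X by (auto simp: h_def alt_chain_def split: nat.splits)
          next
            fix i assume i: "Suc i < Suc q"
            have "adj (h i) (h (Suc i)) \<and> pos (h i) < pos (h (Suc i))"
            proof (cases i)
              case 0
              then have g0: "g 0 \<in> X'" "sg (g 0) = s" using g i by (auto simp: alt_chain_def)
              then have a: "adj v (g 0)" "g 0 \<in> X" by (auto simp: X'_def)
              have "\<not> pos (g 0) < pos v"
              proof
                assume "pos (g 0) < pos v"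
                then have "adj u v" using mono[OF a(2) u(1) v(1) v(1)] u(3)[OF a(2) g0(2)] g0 u(2) v(2) symD[OF a(1)] by auto
                then show False using nadj by simp
              qed
              moreover have "pos v \<noteq> pos (g 0)" using opp[OF v(1) a(2)] a g0 v by auto
              ultimately show ?thesis using a 0 by (simp add: h_def)
            next
              case (Suc j)
              then show ?thesis using g i by (auto simp: h_def alt_chain_def)
            qed
            then show "adj (h i) (h (Suc i))" "pos (h i) < pos (h (Suc i))" by auto
          qed
          then show False using nochain by blast
        qed
        show "adj x' y'" if "x \<in> X'" "x' \<in> X'" "y \<in> X'" "y' \<in> X'" "sg x' = sg x" "sg y' = sg y"
          "sg x \<noteq> sg y" "pos x' \<le> pos x" "pos y \<le> pos y'" "pos x < pos y" "adj x y" for x x' y y'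
          using mono[OF X'X X'X X'X X'X] that by blast
      qed (use same opp X'X in auto)
      then show ?thesis
        unfolding X'_def
      proof (intro acyc_suspension[OF sym u(1) v(1) _ nadj])
        show "u \<noteq> v" using u v by auto
        fix x y assume xy: "x \<in> X" "y \<in> X" "x \<noteq> u" "\<not> adj u x" "y \<noteq> v" "\<not> adj v y"
        have sx: "sg x = (\<not> s)" using same[of u x] u xy by auto
        have sy: "sg y = s" using same[of v y] v xy by auto
        have "\<not> adj x y"
        proof
          assume a: "adj x y"
          then consider "pos x < pos y" | "pos y < pos x" using opp[of x y] xy sx sy by force
          then show False
            using adjmin[OF xy(1,2) a] adjmin[OF xy(2,1) symD[OF a]] sx sy xy by cases auto
        qed
        then show "x \<noteq> y \<and> \<not> adj x y" using sx sy by auto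
      qed
    qed
  qed
qed

text \<open>The new cliques lie in the cone from \<open>v\<close> over its link, and this cone meets
  the old complex exactly in the link.\<close>

lemma racyc_add_vertex:
  assumes sym: "symp adj" and v: "v \<notin> B"
    and ac: "acyc bd (chn (cliques adj {x \<in> B. adj v x}) :: ('a list \<Rightarrow>\<^sub>0 'k::field) set)"
  shows "racyc bd (chn (cliques adj B) :: ('a list \<Rightarrow>\<^sub>0 'k) set) (chn (cliques adj (insert v B)))"
proof -
  let ?X = "{x \<in> B. adj v x}"
  have symD: "adj x y \<Longrightarrow> adj y x" for x y using sympD[OF sym] .
  have U: "cliques adj (insert v B) = cliques adj B \<union> cliques adj (insert v ?X)"
  proof (intro antisym Un_least cliques_mono subsetI)
    fix \<sigma> assume \<sigma>: "\<sigma> \<in> cliques adj (insert v B)"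
    show "\<sigma> \<in> cliques adj B \<union> cliques adj (insert v ?X)"
    proof (cases "v \<in> \<sigma>")
      case True
      then have "\<sigma> \<subseteq> insert v ?X" using cliquesD(2)[OF \<sigma>] cliquesD(3)[OF \<sigma>, of v] by auto
      then show ?thesis using cliques_subset[OF \<sigma>] by simp
    next
      case False
      then have "\<sigma> \<subseteq> B" using cliquesD(2)[OF \<sigma>] by auto
      then show ?thesis using cliques_subset[OF \<sigma>] by simp
    qed
  qed auto
  have I: "cliques adj B \<inter> cliques adj (insert v ?X) = cliques adj ?X"
    unfolding cliques_Int by (rule arg_cong[of _ _ "cliques adj"]) (use v in auto)
  show ?thesis
    unfolding U
  proof (rule racyc_Un_chn)
    show "acyc bd (chn (cliques adj (insert v ?X)) :: ('a list \<Rightarrow>\<^sub>0 'k) set)"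
      by (rule acyc_cliques_cone[OF sym, of v]) auto
  qed (simp_all add: subclosed_cliques I ac)
qed

text \<open>The cliques containing the new edge lie in its join with the link, which is a cone. It
  meets the old complex in the suspension of the link with poles \<open>a\<close> and
  \<open>b\<close>, and this is acyclic whenever the link is.\<close>

lemma racyc_add_edge:
  assumes sym: "symp adj" and ab: "a \<in> B" "b \<in> B" "a \<noteq> b" "\<not> adj a b"
    and ac: "acyc bd (chn (cliques adj {x \<in> B. x \<noteq> a \<and> x \<noteq> b \<and> adj a x \<and> adj b x}) :: ('a list \<Rightarrow>\<^sub>0 'k::field) set)"
  defines "adj' \<equiv> \<lambda>x y. adj x y \<or> x = a \<and> y = b \<or> x = b \<and> y = a"
  shows "racyc bd (chn (cliques adj B) :: ('a list \<Rightarrow>\<^sub>0 'k) set) (chn (cliques adj' B))"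
proof -
  let ?X = "{x \<in> B. x \<noteq> a \<and> x \<noteq> b \<and> adj a x \<and> adj b x}"
  have symD: "adj x y \<Longrightarrow> adj y x" for x y using sympD[OF sym] .
  have sym': "symp adj'" using symD by (auto simp: symp_def adj'_def)
  have nba: "\<not> adj b a" using ab symD by blast
  have U: "cliques adj' B = cliques adj B \<union> cliques adj' (insert a (insert b ?X))"
  proof (intro antisym Un_least cliques_mono subsetI)
    fix \<sigma> assume \<sigma>: "\<sigma> \<in> cliques adj' B"
    show "\<sigma> \<in> cliques adj B \<union> cliques adj' (insert a (insert b ?X))"
    proof (cases "a \<in> \<sigma> \<and> b \<in> \<sigma>")
      case True
      have "x \<in> insert a (insert b ?X)" if "x \<in> \<sigma>" for x
        using cliquesD(2)[OF \<sigma>] cliquesD(3)[OF \<sigma>, of a x] cliquesD(3)[OF \<sigma>, of b x] True that ab by (auto simp: adj'_def)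
      then show ?thesis using cliquesD(1)[OF \<sigma>] cliquesD(3)[OF \<sigma>] by (auto simp: cliques_def)
    next
      case False
      then have "adj x y" if "x \<in> \<sigma>" "y \<in> \<sigma>" "x \<noteq> y" for x y
        using cliquesD(3)[OF \<sigma> that] that by (auto simp: adj'_def)
      then show ?thesis using cliquesD(1,2)[OF \<sigma>] by (simp add: cliques_def)
    qed
  qed (use ab in \<open>auto simp: adj'_def\<close>)
  have I: "cliques adj B \<inter> cliques adj' (insert a (insert b ?X)) = cliques adj (insert a ?X) \<union> cliques adj (insert b ?X)"
  proof (intro antisym Un_least Int_greatest cliques_mono subsetI)
    fix \<sigma> assume \<sigma>: "\<sigma> \<in> cliques adj B \<inter> cliques adj' (insert a (insert b ?X))"
    then have 1: "\<sigma> \<in> cliques adj B" and 2: "\<sigma> \<subseteq> insert a (insert b ?X)" using cliquesD(2) by auto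
    have "\<not> (a \<in> \<sigma> \<and> b \<in> \<sigma>)" using cliquesD(3)[OF 1, of a b] ab by blast
    then have "\<sigma> \<subseteq> insert a ?X \<or> \<sigma> \<subseteq> insert b ?X" using 2 by blast
    then show "\<sigma> \<in> cliques adj (insert a ?X) \<union> cliques adj (insert b ?X)" using cliques_subset[OF 1] by auto
  qed (use ab in \<open>auto simp: adj'_def\<close>)
  have I2: "cliques adj (insert a ?X) \<inter> cliques adj (insert b ?X) = cliques adj ?X"
    unfolding cliques_Int by (rule arg_cong[of _ _ "cliques adj"]) (use ab(3) in auto)
  have ca: "acyc bd (chn (cliques adj (insert a ?X)) :: ('a list \<Rightarrow>\<^sub>0 'k) set)"
    by (rule acyc_cliques_cone[OF sym, of a]) auto
  have cb: "acyc bd (chn (cliques adj (insert b ?X)) :: ('a list \<Rightarrow>\<^sub>0 'k) set)"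
    by (rule acyc_cliques_cone[OF sym, of b]) auto
  have cab: "acyc bd (chn (cliques adj' (insert a (insert b ?X))) :: ('a list \<Rightarrow>\<^sub>0 'k) set)"
    by (rule acyc_cliques_cone[OF sym', of a]) (auto simp: adj'_def)
  have "acyc bd (chn (cliques adj (insert a ?X) \<union> cliques adj (insert b ?X)) :: ('a list \<Rightarrow>\<^sub>0 'k) set)"
    by (rule acyc_Un_chn) (simp_all only: subclosed_cliques ca cb I2 ac)
  then show ?thesis
    unfolding U by (intro racyc_Un_chn) (simp_all only: subclosed_cliques cab I)
qed

text \<open>The complex whose only simplex is empty is the sphere of dimension -1, its homology
  being spanned by the empty tuple. Iterated suspension starts here.\<close>

lemma hsphere_empty: "hsphere TYPE('k::field) 0 {{}}"
proof (rule hsphereI[where z = "Poly_Mapping.single [] 1"])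
  have *: "c = scl (Poly_Mapping.lookup c []) (Poly_Mapping.single [] 1)" if "c \<in> chn {{}}" for c :: "'a list \<Rightarrow>\<^sub>0 'k"
  proof (rule poly_mapping_eqI)
    fix k
    show "Poly_Mapping.lookup c k = Poly_Mapping.lookup (scl (Poly_Mapping.lookup c []) (Poly_Mapping.single [] 1)) k"
      using that by (cases "k = []") (auto simp: chn_def cspan_iff lookup_single when_def)
  qed
  show "bd b \<noteq> Poly_Mapping.single [] 1" if "b \<in> chn {{}}" for b :: "'a list \<Rightarrow>\<^sub>0 'k"
  proof -
    have "bd b = 0" by (subst *[OF that]) (simp add: bd_single)
    then show ?thesis by (metis lookup_single_eq lookup_zero zero_neq_one)
  qed
  show "\<exists>s. \<exists>b\<in>chn {{}}. c = scl s (Poly_Mapping.single [] 1) + bd b" if "c \<in> chn {{}}" for c :: "'a list \<Rightarrow>\<^sub>0 'k"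
    using *[OF that] by (intro exI[of _ "Poly_Mapping.lookup c []"] bexI[of _ 0]) (auto simp: bd_lin)
qed (auto simp: chn_def lpart_single bd_single)

text \<open>The antipodal pair \<open>u n\<close>, \<open>v n\<close> suspends the cross-polytope on
  the remaining pairs.\<close>

lemma hsphere_cross_polytope:
  assumes sym: "symp adj"
    and "\<And>i j. i < n \<Longrightarrow> j < n \<Longrightarrow> u i \<noteq> v j"
    and "\<And>i j. i < n \<Longrightarrow> j < n \<Longrightarrow> i \<noteq> j \<Longrightarrow> u i \<noteq> u j \<and> v i \<noteq> v j \<and> adj (u i) (u j) \<and> adj (v i) (v j)"
    and "\<And>i j. i < n \<Longrightarrow> j < n \<Longrightarrow> adj (u i) (v j) \<longleftrightarrow> i \<noteq> j"
  shows "hsphere TYPE('k::field) n (cliques adj (u ` {..<n} \<union> v ` {..<n}))"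
  using assms(2-)
proof (induction n)
  case 0
  have "cliques adj {} = {{}}" by (auto simp: cliques_def)
  then show ?case using hsphere_empty by simp
next
  case (Suc n)
  note d1 = Suc.prems(1) and d2 = Suc.prems(2) and d3 = Suc.prems(3)
  have symD: "adj x y \<Longrightarrow> adj y x" for x y using sympD[OF sym] .
  let ?A = "u ` {..<Suc n} \<union> v ` {..<Suc n}"
  have vu: "adj (v i) (u j) \<longleftrightarrow> i \<noteq> j" if "i < Suc n" "j < Suc n" for i j
    using d3[OF that(2,1)] symD by blast
  have rest: "{x \<in> ?A. x \<noteq> u n \<and> x \<noteq> v n \<and> adj (u n) x \<and> adj (v n) x} = u ` {..<n} \<union> v ` {..<n}" (is "?L = ?R")
  proof (intro antisym subsetI)
    fix x assume "x \<in> ?L"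
    then show "x \<in> ?R" by (auto simp: less_Suc_eq)
  next
    fix x assume "x \<in> ?R"
    then consider i where "i < n" "x = u i" | i where "i < n" "x = v i" by blast
    then show "x \<in> ?L"
    proof cases
      case 1
      then show ?thesis using d2[of i n] d1[of i n] vu[of n i] symD by fastforce
    next
      case 2
      then show ?thesis using d2[of i n] d1[of n i] d3[of n i] symD by fastforce
    qed
  qed
  show ?case
  proof (rule hsphere_cliques_suspension[OF sym, of "u n" _ "v n"])
    show "hsphere TYPE('k) n (cliques adj {x \<in> ?A. x \<noteq> u n \<and> x \<noteq> v n \<and> adj (u n) x \<and> adj (v n) x})"
      unfolding rest by (rule Suc.IH) (use d1 d2 d3 in auto)
    show "u n \<noteq> v n" "\<not> adj (u n) (v n)" using d1 d3 by auto
    fix x y assume x: "x \<in> ?A" "x \<noteq> u n" "\<not> adj (u n) x" and y: "y \<in> ?A" "y \<noteq> v n" "\<not> adj (v n) y"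
    have "x = v n" using x d2[of n] d3[of n] by (fastforce simp: less_Suc_eq)
    moreover have "y = u n" using y d2[of n] vu[of n] by (fastforce simp: less_Suc_eq)
    ultimately show "x \<noteq> y \<and> \<not> adj x y" using d1[of n n] vu[of n n] by auto
  qed auto
qed

section \<open>The circle at a fixed scale\<close>

text \<open>The distance to the nearest integer, that is, arc length on a circle of length
  1.\<close>

definition int_dist :: "real \<Rightarrow> real" where
  "int_dist z = min (frac z) (1 - frac z)"

lemma int_dist_of_int: "z - w \<in> \<int> \<Longrightarrow> int_dist z = int_dist w"
proof -
  assume "z - w \<in> \<int>"
  then obtain k where "z = w + of_int k" by (metis Ints_cases add.commute diff_add_cancel)
  then show ?thesis by (simp add: int_dist_def frac_def)
qed

lemma int_dist_minus: "int_dist (- z) = int_dist z"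
proof (cases "z \<in> \<int>")
  case True
  then have "frac z = 0" "frac (- z) = 0" by (auto simp: frac_eq_0_iff)
  then show ?thesis by (simp only: int_dist_def)
qed (auto simp: int_dist_def frac_neg)

lemma int_dist_small: "\<bar>z\<bar> < 1 \<Longrightarrow> int_dist z = min \<bar>z\<bar> (1 - \<bar>z\<bar>)"
proof -
  have *: "int_dist z = min z (1 - z)" if "0 \<le> z" "z < 1" for z using that by (simp add: int_dist_def frac_eq)
  assume "\<bar>z\<bar> < 1"
  then show ?thesis using *[of z] *[of "- z"] int_dist_minus[of z] by (cases "0 \<le> z") auto
qed

lemma frac_add_Ints: "z - w \<in> \<int> \<Longrightarrow> frac z = frac w"
proof -
  assume "z - w \<in> \<int>"
  then obtain k where "z = w + of_int k" by (metis Ints_cases add.commute diff_add_cancel)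
  then show ?thesis by (simp add: frac_def)
qed

text \<open>
  The coordinate \<open>ang\<close> is the angle in units of a full turn, and \<open>cd\<close> the arc length in the same
  unit. Seen from \<open>a\<close>, the point \<open>x\<close> lies at the counterclockwise angle \<open>th a x\<close>; the antipodal
  map moves it to the half circle starting at \<open>a\<close> if \<open>sg a x\<close> is false, and \<open>pos a x\<close> is its
  position there. Thus points of the same sign are close if their positions are, and points
  of opposite signs if their positions are far apart.
\<close>

locale circle_coords =
  fixes V :: "'a set" and ang :: "'a \<Rightarrow> real"
  assumes bij: "bij_betw ang V {0..<1}"
begin

definition cd :: "'a \<Rightarrow> 'a \<Rightarrow> real" where "cd x y = int_dist (ang x - ang y)"
definition near :: "real \<Rightarrow> 'a \<Rightarrow> 'a \<Rightarrow> bool" where "near t x y \<longleftrightarrow> cd x y < t"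
definition pt :: "real \<Rightarrow> 'a" where "pt w = inv_into V ang (frac w)"
definition th :: "'a \<Rightarrow> 'a \<Rightarrow> real" where "th a x = frac (ang x - ang a)"
definition sg :: "'a \<Rightarrow> 'a \<Rightarrow> bool" where "sg a x \<longleftrightarrow> th a x < 1/2"
definition pos :: "'a \<Rightarrow> 'a \<Rightarrow> real" where "pos a x = (if sg a x then th a x else th a x - 1/2)"

lemma ang_range: "x \<in> V \<Longrightarrow> 0 \<le> ang x \<and> ang x < 1"
  using bij by (auto simp: bij_betw_def)

lemma ang_inj: "x \<in> V \<Longrightarrow> y \<in> V \<Longrightarrow> ang x = ang y \<Longrightarrow> x = y"
  using bij by (auto simp: bij_betw_def inj_on_def)

lemma pt: "pt w \<in> V" "ang (pt w) = frac w"
proof -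
  have "frac w \<in> ang ` V" using bij by (auto simp: bij_betw_def frac_lt_1)
  then show "pt w \<in> V" "ang (pt w) = frac w" unfolding pt_def by (auto simp: inv_into_into f_inv_into_f)
qed

lemma cd_sym: "cd x y = cd y x"
  unfolding cd_def using int_dist_minus[of "ang x - ang y"] by simp

lemma symp_near: "symp (near t)"
  by (auto simp: symp_def near_def cd_sym)

lemma frac_diff_Ints: "z - frac z \<in> \<int>"
  by (simp add: frac_def)

lemma cd_th: "cd x y = int_dist (th a x - th a y)"
proof -
  have "(ang x - ang y) - (th a x - th a y)
      = ((ang x - ang a) - frac (ang x - ang a)) - ((ang y - ang a) - frac (ang y - ang a))"
    by (simp add: th_def)
  also have "\<dots> \<in> \<int>" by (intro Ints_diff frac_diff_Ints)
  finally show ?thesis unfolding cd_def by (rule int_dist_of_int)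
qed

lemma th_range: "0 \<le> th a x" "th a x < 1"
  by (simp_all add: th_def frac_lt_1)

lemma th_self [simp]: "th a a = 0" by (simp add: th_def)

lemma th_inj: "x \<in> V \<Longrightarrow> y \<in> V \<Longrightarrow> th a x = th a y \<Longrightarrow> x = y"
proof (rule ang_inj)
  assume xy: "x \<in> V" "y \<in> V" and eq: "th a x = th a y"
  have "ang x - ang y = ((ang x - ang a) - frac (ang x - ang a)) - ((ang y - ang a) - frac (ang y - ang a))"
    using eq by (simp add: th_def)
  also have "\<dots> \<in> \<int>" by (intro Ints_diff frac_diff_Ints)
  finally obtain k where k: "ang x - ang y = of_int k" by (metis Ints_cases)
  then have "- 1 < (of_int k :: real)" "(of_int k :: real) < 1" using ang_range[OF xy(1)] ang_range[OF xy(2)] by linarith+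
  then have "k = 0" by linarith
  then show "ang x = ang y" using k by simp
qed

lemma pos_range: "0 \<le> pos a x" "pos a x < 1/2"
  using th_range[of a x] by (auto simp: pos_def sg_def)

lemma pos_inj: "x \<in> V \<Longrightarrow> y \<in> V \<Longrightarrow> sg a x = sg a y \<Longrightarrow> pos a x = pos a y \<Longrightarrow> x = y"
  by (rule th_inj[of x y a]) (auto simp: pos_def split: if_splits)

lemma cd_same: "sg a x = sg a y \<Longrightarrow> cd x y = \<bar>pos a x - pos a y\<bar>"
  using pos_range[of a x] pos_range[of a y]
  by (subst cd_th[of _ _ a], subst int_dist_small) (auto simp: pos_def split: if_splits)

lemma cd_opp: "sg a x \<noteq> sg a y \<Longrightarrow> cd x y = 1/2 - \<bar>pos a x - pos a y\<bar>"
  using pos_range[of a x] pos_range[of a y]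
  by (subst cd_th[of _ _ a], subst int_dist_small) (auto simp: pos_def min_def abs_if split: if_splits)

lemma sg_self [simp]: "sg a a" "pos a a = 0" by (simp_all add: sg_def pos_def)

lemma th_pt:
  assumes "x \<in> V" "ang x = frac (ang a + w)"
  shows "th a x = frac w"
proof -
  have "(ang x - ang a) - w = - ((ang a + w) - frac (ang a + w))" using assms by simp
  also have "\<dots> \<in> \<int>" by (intro Ints_minus frac_diff_Ints)
  finally show ?thesis unfolding th_def by (rule frac_add_Ints)
qed

lemma sg_pos_pt:
  assumes "x \<in> V" "ang x = frac (ang a + (p + (if s then 0 else 1/2)))" "0 \<le> p" "p < 1/2"
  shows "sg a x = s" "pos a x = p"
proof -
  have "th a x = p + (if s then 0 else 1/2)"
    using th_pt[OF assms(1,2)] assms(3,4) by (simp add: frac_eq)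
  then show "sg a x = s" "pos a x = p" using assms(3,4) by (auto simp: sg_def pos_def)
qed

end

lemma alt_chain_gaps:
  assumes "alt_chain adj sg pos X s q g"
    and "\<And>x y. x \<in> X \<Longrightarrow> y \<in> X \<Longrightarrow> sg x \<noteq> sg y \<Longrightarrow> adj x y \<Longrightarrow> pos x < pos y \<Longrightarrow> \<delta> \<le> pos y - pos x"
    and "i < q"
  shows "pos (g 0) + real i * \<delta> \<le> pos (g i)"
  using assms(3)
proof (induction i)
  case (Suc i)
  have "\<delta> \<le> pos (g (Suc i)) - pos (g i)"
    using assms(1) Suc.prems by (intro assms(2)) (auto simp: alt_chain_def)
  then show ?case using Suc by (simp add: algebra_simps)
qed simp

text \<open>The scales, as fractions of a full turn, at which the homology of the complex changes.\<close>

definition crit :: "nat \<Rightarrow> real" where "crit l = real l / (2 * real l + 1)"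

lemma crit_iff:
  "crit l < t \<longleftrightarrow> real l < (2 * real l + 1) * t"
  "t < crit l \<longleftrightarrow> (2 * real l + 1) * t < real l"
  "t \<le> crit l \<longleftrightarrow> (2 * real l + 1) * t \<le> real l"
  by (auto simp: crit_def field_simps)

lemma crit_half: "crit l < 1/2" by (simp add: crit_def field_simps)
lemma crit_nonneg: "0 \<le> crit l" by (simp add: crit_def)

section \<open>Links on the circle\<close>

context circle_coords
begin

text \<open>The relation \<open>adj\<close> is only sandwiched between arc length below \<tau> and
  at most \<tau>, because edges of equal length are added one after the other. Seen from
  \<open>a\<close>, the points of the link of positive sign lie strictly between \<open>a\<close>
  and \<open>b\<close>; those of negative sign have positions at distance at least \<delta> from the
  positions 0 and \<tau> of \<open>a\<close> and \<open>b\<close>.\<close>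

lemma edge_link_acyclic:
  assumes B: "finite B" "B \<subseteq> V" and sym: "symp adj"
    and lo: "\<And>x y. x \<in> B \<Longrightarrow> y \<in> B \<Longrightarrow> x \<noteq> y \<Longrightarrow> cd x y < \<tau> \<Longrightarrow> adj x y"
    and hi: "\<And>x y. x \<in> B \<Longrightarrow> y \<in> B \<Longrightarrow> adj x y \<Longrightarrow> cd x y \<le> \<tau>"
    and ab: "a \<in> B" "b \<in> B" "th a b = \<tau>"
    and \<tau>: "crit l < \<tau>" "\<tau> < crit (Suc l)"
    and \<eta>: "0 < \<eta>" "(2 * real l + 1) * \<eta> < (2 * real l + 1) * \<tau> - real l"
    and grid: "\<And>w. \<exists>x\<in>B. \<exists>\<xi>. 0 < \<xi> \<and> \<xi> \<le> \<eta> \<and> ang x = frac (w + \<xi>)"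
  shows "acyc bd (chn (cliques adj {x \<in> B. x \<noteq> a \<and> x \<noteq> b \<and> adj a x \<and> adj b x}) :: ('a list \<Rightarrow>\<^sub>0 'k::field) set)"
proof -
  define X where "X = {x \<in> B. x \<noteq> a \<and> x \<noteq> b \<and> adj a x \<and> adj b x}"
  define \<delta> where "\<delta> = 1/2 - \<tau>"
  have \<tau>1: "real l < (2 * real l + 1) * \<tau>" "(2 * real l + 3) * \<tau> < real l + 1"
    using \<tau> by (simp_all add: crit_iff algebra_simps)
  have \<tau>0: "0 < \<tau>" "\<tau> < 1/2" using \<tau> crit_nonneg[of l] crit_half[of "Suc l"] by linarith+
  have bs: "sg a b" "pos a b = \<tau>" using ab \<tau>0 by (simp_all add: pos_def sg_def)
  have XV: "x \<in> V" if "x \<in> X" for x using that B by (auto simp: X_def)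
  have abV: "a \<in> V" "b \<in> V" using ab B by auto
  have plus: "0 < pos a x" "pos a x < \<tau>" if "x \<in> X" "sg a x" for x
  proof -
    have x: "x \<in> B" "x \<noteq> a" "x \<noteq> b" "adj a x" using that by (auto simp: X_def)
    have "pos a x \<noteq> 0" using pos_inj[of x a a] x that abV XV by auto
    then show "0 < pos a x" using pos_range[of a x] by auto
    have "pos a x \<noteq> \<tau>" using pos_inj[of x b a] x that abV XV bs by auto
    moreover have "pos a x \<le> \<tau>" using hi[OF ab(1) x(1,4)] cd_same[of a a x] that pos_range[of a x] by simp
    ultimately show "pos a x < \<tau>" by simp
  qed
  have minus: "\<delta> \<le> pos a x" "pos a x \<le> \<tau> - \<delta>" if "x \<in> X" "\<not> sg a x" for x
  proof -
    have x: "x \<in> B" "adj a x" "adj b x" using that by (auto simp: X_def)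
    show "\<delta> \<le> pos a x" using hi[OF ab(1) x(1,2)] cd_opp[of a a x] that pos_range[of a x] by (simp add: \<delta>_def)
    show "pos a x \<le> \<tau> - \<delta>"
      using hi[OF ab(2) x(1,3)] cd_opp[of a b x] that pos_range[of a x] bs \<tau>0 by (simp add: \<delta>_def abs_if split: if_splits)
  qed
  have gap: "\<delta> \<le> pos a y - pos a x" if "x \<in> X" "y \<in> X" "sg a x \<noteq> sg a y" "adj x y" "pos a x < pos a y" for x y
    using hi[of x y] cd_opp[OF that(3)] that by (simp add: X_def \<delta>_def)
  \<comment> \<open>The target positions are spaced by \<open>\<delta> + \<eta>\<close>. A point of
    \<open>B\<close> overshoots its target by at most \<eta>, so consecutive gaps still exceed
    \<delta>; the half turn at odd \<open>i\<close> produces the negative sign.\<close>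
  define f where "f = (\<lambda>i. SOME x. x \<in> B \<and> (\<exists>\<xi>. 0 < \<xi> \<and> \<xi> \<le> \<eta> \<and> ang x = frac (ang a + (real i * (\<delta> + \<eta>) + (if even i then 0 else 1/2)) + \<xi>)))"
  have f: "f i \<in> B" "\<exists>\<xi>. 0 < \<xi> \<and> \<xi> \<le> \<eta> \<and> ang (f i) = frac (ang a + (real i * (\<delta> + \<eta>) + (if even i then 0 else 1/2)) + \<xi>)" for i
  proof -
    have "\<exists>x. x \<in> B \<and> (\<exists>\<xi>. 0 < \<xi> \<and> \<xi> \<le> \<eta> \<and> ang x = frac (ang a + (real i * (\<delta> + \<eta>) + (if even i then 0 else 1/2)) + \<xi>))"
      using grid by blast
    from someI_ex[OF this] show "f i \<in> B"
      "\<exists>\<xi>. 0 < \<xi> \<and> \<xi> \<le> \<eta> \<and> ang (f i) = frac (ang a + (real i * (\<delta> + \<eta>) + (if even i then 0 else 1/2)) + \<xi>)"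
      unfolding f_def by blast+
  qed
  have f_pos: "real i * (\<delta> + \<eta>) < pos a (f i)" "pos a (f i) \<le> real i * (\<delta> + \<eta>) + \<eta>" "pos a (f i) < \<tau>"
    "sg a (f i) = even i" if "i < 2 * l + 1" for i
  proof -
    obtain \<xi> where \<xi>: "0 < \<xi>" "\<xi> \<le> \<eta>" "ang (f i) = frac (ang a + (real i * (\<delta> + \<eta>) + (if even i then 0 else 1/2)) + \<xi>)"
      using f(2) by blast
    let ?p = "real i * (\<delta> + \<eta>) + \<xi>"
    have "real i * (\<delta> + \<eta>) \<le> 2 * real l * (\<delta> + \<eta>)"
      using that \<eta> \<tau>0 by (intro mult_right_mono) (auto simp: \<delta>_def)
    \<comment> \<open>The largest possible position, at \<open>i = 2 * l\<close>, stays below \<tau>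
      precisely by the bound assumed for \<eta>.\<close>
    also have "2 * real l * (\<delta> + \<eta>) + \<eta> = real l - 2 * real l * \<tau> + (2 * real l + 1) * \<eta>"
      by (simp add: \<delta>_def algebra_simps)
    also have "\<dots> < \<tau>" using \<eta>(2) by (simp add: algebra_simps)
    finally have p1: "?p < \<tau>" using \<xi> by simp
    have p0: "0 \<le> ?p" using \<xi> \<eta> \<tau>0 by (simp add: \<delta>_def)
    have "sg a (f i) = even i" "pos a (f i) = ?p"
      using sg_pos_pt[of "f i" a ?p "even i"] f(1)[of i] B(2) \<xi>(3) p0 p1 \<tau>0 by (auto simp: algebra_simps)
    then show "real i * (\<delta> + \<eta>) < pos a (f i)" "pos a (f i) \<le> real i * (\<delta> + \<eta>) + \<eta>" "pos a (f i) < \<tau>"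
      "sg a (f i) = even i" using \<xi> p1 by auto
  qed
  have f_step: "\<delta> < pos a (f (Suc i)) - pos a (f i)" if "Suc i < 2 * l + 1" for i
    using f_pos(2)[of i] f_pos(1)[of "Suc i"] that by (simp add: algebra_simps)
  have fX: "f i \<in> X" if i: "i < 2 * l + 1" for i
  proof (cases "even i")
    case True
    have "0 < pos a (f i)" using f_pos(1)[OF i] \<eta> \<tau>0 by (auto simp: \<delta>_def intro: le_less_trans[rotated])
    then have "f i \<noteq> a" "f i \<noteq> b" "cd a (f i) < \<tau>" "cd b (f i) < \<tau>"
      using f_pos(3,4)[OF i] True cd_same[of a a "f i"] cd_same[of a b "f i"] bs by auto
    then show ?thesis using lo f(1)[of i] ab by (auto simp: X_def)
  next
    case False
    then have i': "Suc i < 2 * l + 1" "0 < i" using i by (presburger, cases i) auto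
    have "\<delta> < pos a (f i)" using f_step[of "i - 1"] pos_range[of a "f (i - 1)"] i' by simp
    moreover have "pos a (f i) < \<tau> - \<delta>" using f_step[OF i'(1)] f_pos(3)[OF i'(1)] by simp
    moreover have s: "\<not> sg a (f i)" using f_pos(4)[OF i] False by simp
    ultimately have "cd a (f i) < \<tau>" "cd b (f i) < \<tau>"
      using cd_opp[of a a "f i"] cd_opp[of a b "f i"] bs \<tau>0 by (auto simp: \<delta>_def)
    moreover have "f i \<noteq> a" "f i \<noteq> b" using s bs by auto
    ultimately show ?thesis using lo f(1)[of i] ab by (auto simp: X_def)
  qed
  have "acyc bd (chn (cliques adj X) :: ('a list \<Rightarrow>\<^sub>0 'k) set)"
  proof (rule alternating_acyclic[OF sym, where sg = "sg a" and pos = "pos a" and s = True and q = "2 * l + 1" and f = f])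
    show "finite X" using B by (simp add: X_def)
    show "adj x y" if "x \<in> X" "y \<in> X" "sg a x = sg a y" "x \<noteq> y" for x y
    proof (rule lo)
      show "cd x y < \<tau>"
        using cd_same[OF that(3)] that plus[of x] plus[of y] minus[of x] minus[of y] \<tau>0
        by (cases "sg a x") (auto simp: \<delta>_def)
    qed (use that in \<open>auto simp: X_def\<close>)
    show "pos a x \<noteq> pos a y" if "x \<in> X" "y \<in> X" "sg a x \<noteq> sg a y" "adj x y" for x y
      using hi[of x y] cd_opp[OF that(3)] that \<tau>0 by (auto simp: X_def)
    show "adj x' y'" if *: "x \<in> X" "x' \<in> X" "y \<in> X" "y' \<in> X" "sg a x' = sg a x" "sg a y' = sg a y" "sg a x \<noteq> sg a y"
      "pos a x' \<le> pos a x" "pos a y \<le> pos a y'" "pos a x < pos a y" "adj x y" for x x' y y'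
    \<comment> \<open>Ties at arc length \<tau> are harmless: if a gap becomes strictly wider, the
      arc becomes shorter than \<tau> and \<open>lo\<close> applies; otherwise the points have not
      changed.\<close>
    proof (cases "pos a x' = pos a x \<and> pos a y' = pos a y")
      case True
      then have "x' = x" "y' = y" using pos_inj[of _ _ a] XV * by blast+
      then show ?thesis using * by simp
    next
      case False
      then have "\<delta> < pos a y' - pos a x'" using gap[of x y] * by linarith
      then have "cd x' y' < \<tau>" using cd_opp[of a x' y'] * by (simp add: \<delta>_def)
      then show ?thesis using lo[of x' y'] * by (auto simp: X_def)
    qed
    show "alt_chain adj (sg a) (pos a) X True (2 * l + 1) f"
      unfolding alt_chain_def
    proof (intro conjI allI impI)
      fix i assume i: "Suc i < 2 * l + 1"
      then have i': "i < 2 * l + 1" by simp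
      show "pos a (f i) < pos a (f (Suc i))" using f_step[OF i] \<tau>0 by (simp add: \<delta>_def)
      have "cd (f i) (f (Suc i)) < \<tau>"
        using cd_opp[of a "f i" "f (Suc i)"] f_pos(4)[OF i] f_pos(4)[OF i'] f_step[OF i] \<tau>0 by (auto simp: \<delta>_def)
      moreover have "f i \<noteq> f (Suc i)" using f_pos(4)[OF i] f_pos(4)[OF i'] by auto
      ultimately show "adj (f i) (f (Suc i))" using lo f(1) by blast
    qed (use f_pos fX in auto)
    show "\<not> alt_chain adj (sg a) (pos a) X (\<not> True) (2 * l + 1) g" for g
    proof
      assume g: "alt_chain adj (sg a) (pos a) X (\<not> True) (2 * l + 1) g"
      then have g2: "g 0 \<in> X" "\<not> sg a (g 0)" "g (2 * l) \<in> X" "\<not> sg a (g (2 * l))"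
        by (auto simp: alt_chain_def)
      \<comment> \<open>Such a chain has odd length, so it starts and ends with a negative point.
        Two margins and \<open>2 * l\<close> gaps, each at least \<delta>, would have to fit into
        \<tau>, against \<open>\<tau> < crit (Suc l)\<close>.\<close>
      have "pos a (g 0) + real (2 * l) * \<delta> \<le> pos a (g (2 * l))"
        by (rule alt_chain_gaps[OF g gap]) auto
      then have "real (2 * l) * \<delta> + 2 * \<delta> \<le> \<tau>" using minus(1)[OF g2(1,2)] minus(2)[OF g2(3,4)] by linarith
      then show False using \<tau>1 by (simp add: \<delta>_def algebra_simps)
    qed
  qed
  then show ?thesis by (simp add: X_def)
qed

section \<open>Equidistant points and the two comparisons\<close>

definition grid :: "nat \<Rightarrow> 'a set" where "grid M = (\<lambda>j. pt (real j / real M)) ` {..<M}"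

lemma finite_grid: "finite (grid M)" and grid_V: "grid M \<subseteq> V"
  by (auto simp: grid_def pt)

lemma gridI:
  assumes "0 < M" "x \<in> V" "ang x = frac (of_int k / real M)"
  shows "x \<in> grid M"
proof -
  define j where "j = nat (k mod int M)"
  have j: "int j = k mod int M" "j < M" using assms(1) by (auto simp: j_def nat_less_iff)
  have "real_of_int k = of_int (k div int M) * real M + real j"
    using j(1) by (metis div_mult_mod_eq of_int_add of_int_mult of_int_of_nat_eq)
  then have "of_int k / real M - real j / real M = of_int (k div int M)"
    using assms(1) by (simp add: field_simps)
  then have "frac (of_int k / real M) = frac (real j / real M)" by (intro frac_add_Ints) simp
  then have "x = pt (real j / real M)" using assms pt by (intro ang_inj) auto
  then show ?thesis using j by (auto simp: grid_def)
qed

lemma grid_dense: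
  assumes "0 < M"
  shows "\<exists>x\<in>grid M. \<exists>\<xi>. 0 < \<xi> \<and> \<xi> \<le> 1 / real M \<and> ang x = frac (w + \<xi>)"
proof -
  \<comment> \<open>Adding 1 to the floor gives the first grid multiple strictly beyond
    \<open>w\<close>, so that \<xi> is positive.\<close>
  define k where "k = \<lfloor>real M * w\<rfloor> + 1"
  have k: "real M * w < of_int k" "of_int k \<le> real M * w + 1" by (simp_all add: k_def)
  have "pt (of_int k / real M) \<in> grid M" using assms pt by (intro gridI[where k = k]) auto
  moreover have "0 < of_int k / real M - w" "of_int k / real M - w \<le> 1 / real M"
  proof -
    have "of_int k / real M \<le> (real M * w + 1) / real M" using k(2) by (intro divide_right_mono) auto
    then show "of_int k / real M - w \<le> 1 / real M" using assms by (simp add: add_divide_distrib)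
  qed (use k assms in \<open>simp add: field_simps\<close>)
  ultimately show ?thesis using pt(2)[of "of_int k / real M"]
    by (intro bexI exI[of _ "of_int k / real M - w"]) auto
qed

text \<open>The missing pairs are added in order of length, ties in any order. The induction
  therefore runs over all relations between the two radii that contain every pair strictly shorter
  than one of their own pairs (the last hypothesis of \<open>main\<close>), and counts the pairs
  still missing.\<close>

lemma racyc_threshold:
  assumes B: "finite B" "B \<subseteq> V" and t: "crit l < t" "t \<le> crit (Suc l)"
    and M: "0 < M" "(2 * real l + 1) / real M < (2 * real l + 1) * t - real l" "grid M \<subseteq> B"
  shows "racyc bd (chn (cliques (near t) B) :: ('a list \<Rightarrow>\<^sub>0 'k::field) set) (chn (cliques (near (crit (Suc l))) B))"
proof -
  let ?T = "crit (Suc l)"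
  have main: "racyc bd (chn (cliques adj B) :: ('a list \<Rightarrow>\<^sub>0 'k) set) (chn (cliques (near ?T) B))"
    if "symp adj" and lo: "\<And>x y. x \<in> B \<Longrightarrow> y \<in> B \<Longrightarrow> cd x y < t \<Longrightarrow> adj x y"
      and hi: "\<And>x y. x \<in> B \<Longrightarrow> y \<in> B \<Longrightarrow> adj x y \<Longrightarrow> cd x y < ?T"
      and dc: "\<And>x y x' y'. x \<in> B \<Longrightarrow> y \<in> B \<Longrightarrow> x' \<in> B \<Longrightarrow> y' \<in> B \<Longrightarrow> adj x y \<Longrightarrow> cd x' y' < cd x y \<Longrightarrow> adj x' y'" for adj
    using that
  proof (induction "card {(x, y) \<in> B \<times> B. cd x y < ?T \<and> \<not> adj x y}" arbitrary: adj rule: less_induct)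
    case less
    note sym = less.prems(1) and lo = less.prems(2) and hi = less.prems(3) and dc = less.prems(4)
    let ?m = "\<lambda>adj. {(x, y) \<in> B \<times> B. cd x y < ?T \<and> \<not> adj x y}"
    have symD: "adj x y \<Longrightarrow> adj y x" for x y using sympD[OF sym] .
    have fin: "finite (?m r)" for r using B by (auto intro: finite_subset[of _ "B \<times> B"])
    show ?case
    proof (cases "?m adj = {}")
      case True
      have "cliques (near ?T) B = cliques adj B"
      proof (intro antisym cliques_mono)
        show "adj x y" if "x \<in> B" "y \<in> B" "near ?T x y" for x y using True that by (auto simp: near_def)
      qed (use hi in \<open>auto simp: near_def\<close>)
      moreover have "racyc bd (chn (cliques adj B)) (chn (cliques adj B) :: ('a list \<Rightarrow>\<^sub>0 'k) set)"
        unfolding racyc_def by (intro ballI impI bexI[of _ 0]) (auto simp: bd_lin)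
      ultimately show ?thesis by simp
    next
      case False
      define \<tau> where "\<tau> = Min ((\<lambda>(x, y). cd x y) ` ?m adj)"
      have "\<tau> \<in> (\<lambda>(x, y). cd x y) ` ?m adj" unfolding \<tau>_def using fin False by (intro Min_in) auto
      then obtain a0 b0 where ab0: "a0 \<in> B" "b0 \<in> B" "\<tau> < ?T" "\<not> adj a0 b0" "cd a0 b0 = \<tau>" by auto
      have min: "\<tau> \<le> cd x y" if "x \<in> B" "y \<in> B" "cd x y < ?T" "\<not> adj x y" for x y
        unfolding \<tau>_def using fin that by (intro Min_le) (auto intro!: image_eqI[of _ _ "(x, y)"])
      have t\<tau>: "t \<le> \<tau>" using lo ab0 by (meson not_le)
      have \<tau>l: "crit l < \<tau>" using t\<tau> t by simp
      have \<tau>0: "0 < \<tau>" "\<tau> < 1/2" using \<tau>l ab0 crit_nonneg[of l] crit_half[of "Suc l"] by linarith+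
      \<comment> \<open>The pair is oriented so that its counterclockwise angle is the short arc
        \<tau> and not its complement.\<close>
      have "\<tau> = th a0 b0 \<or> \<tau> = th b0 a0"
      proof -
        have "\<tau> = int_dist (ang b0 - ang a0)" using ab0 cd_sym[of a0 b0] by (simp add: cd_def)
        moreover have "th a0 b0 + th b0 a0 = 1" if "ang b0 - ang a0 \<notin> \<int>"
          using frac_neg[of "ang b0 - ang a0"] that by (simp add: th_def)
        moreover have "ang b0 - ang a0 \<notin> \<int>"
        proof
          assume "ang b0 - ang a0 \<in> \<int>"
          then have "int_dist (ang b0 - ang a0) = 0" using int_dist_of_int[of "ang b0 - ang a0" 0] by (simp add: int_dist_def)
          then show False using \<tau>0 calculation by simp
        qed
        ultimately show ?thesis by (auto simp: int_dist_def th_def min_def split: if_splits)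
      qed
      then obtain a b where ab: "a \<in> B" "b \<in> B" "\<not> adj a b" "cd a b = \<tau>" "th a b = \<tau>"
        using ab0 symD cd_sym by metis
      have ne: "a \<noteq> b" using ab \<tau>0 by auto
      define adj' where "adj' = (\<lambda>x y. adj x y \<or> x = a \<and> y = b \<or> x = b \<and> y = a)"
      have sandwich: "adj x y" if "x \<in> B" "y \<in> B" "cd x y < \<tau>" for x y
        using min[OF that(1,2)] that ab0 by fastforce
      have upper: "cd x y \<le> \<tau>" if "x \<in> B" "y \<in> B" "adj x y" for x y
        using dc[OF that(1,2) ab(1,2) that(3)] ab by fastforce
      have link: "acyc bd (chn (cliques adj {x \<in> B. x \<noteq> a \<and> x \<noteq> b \<and> adj a x \<and> adj b x}) :: ('a list \<Rightarrow>\<^sub>0 'k) set)"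
      proof (rule edge_link_acyclic[OF B sym, where \<tau> = \<tau> and l = l and \<eta> = "1 / real M"])
        show "\<exists>x\<in>B. \<exists>\<xi>. 0 < \<xi> \<and> \<xi> \<le> 1 / real M \<and> ang x = frac (w + \<xi>)" for w
          using grid_dense[OF M(1)] M(3) by blast
        have "(2 * real l + 1) * t \<le> (2 * real l + 1) * \<tau>" using t\<tau> by (intro mult_left_mono) auto
        then show "(2 * real l + 1) * (1 / real M) < (2 * real l + 1) * \<tau> - real l"
          using M(2) unfolding times_divide_eq_right mult_1_right by linarith
      qed (use sandwich upper ab \<tau>l ab0 M in auto)
      have r1: "racyc bd (chn (cliques adj B) :: ('a list \<Rightarrow>\<^sub>0 'k) set) (chn (cliques adj' B))"
        unfolding adj'_def by (rule racyc_add_edge[OF sym ab(1,2) ne ab(3) link])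
      have r2: "racyc bd (chn (cliques adj' B) :: ('a list \<Rightarrow>\<^sub>0 'k) set) (chn (cliques (near ?T) B))"
      proof (rule less.hyps)
        have "?m adj' \<subset> ?m adj"
        proof
          show "?m adj' \<subseteq> ?m adj" by (auto simp: adj'_def)
          have "(a, b) \<in> ?m adj" "(a, b) \<notin> ?m adj'" using ab ab0 by (auto simp: adj'_def)
          then show "?m adj' \<noteq> ?m adj" by blast
        qed
        then show "card (?m adj') < card (?m adj)" by (rule psubset_card_mono[OF fin])
        show "symp adj'" using symD by (auto simp: symp_def adj'_def)
        show "adj' x y" if "x \<in> B" "y \<in> B" "cd x y < t" for x y using lo that by (simp add: adj'_def)
        show "cd x y < ?T" if "x \<in> B" "y \<in> B" "adj' x y" for x y
          using hi that ab ab0 cd_sym[of a b] by (auto simp: adj'_def)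
        show "adj' x' y'" if "x \<in> B" "y \<in> B" "x' \<in> B" "y' \<in> B" "adj' x y" "cd x' y' < cd x y" for x y x' y'
        proof (cases "adj x y")
          case True
          then show ?thesis using dc[OF that(1-4)] that by (simp add: adj'_def)
        next
          case False
          then have "cd x y = \<tau>" using that ab cd_sym[of a b] by (auto simp: adj'_def)
          then show ?thesis using sandwich that by (simp add: adj'_def)
        qed
      qed
      show ?thesis
      proof (rule bd.racyc_trans[OF r1 r2])
        show "chn (cliques adj B) \<subseteq> (chn (cliques adj' B) :: ('a list \<Rightarrow>\<^sub>0 'k) set)"
          by (intro chn_mono cliques_mono) (auto simp: adj'_def)
        show "chn (cliques adj' B) \<subseteq> (chn (cliques (near ?T) B) :: ('a list \<Rightarrow>\<^sub>0 'k) set)"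
          by (intro chn_mono cliques_mono) (use hi ab ab0 cd_sym[of a b] in \<open>auto simp: adj'_def near_def\<close>)
      qed (simp_all add: stable_chn subclosed_cliques)
    qed
  qed
  show ?thesis
    by (rule main[OF symp_near]) (use t in \<open>auto simp: near_def\<close>)
qed

text \<open>At this radius \<delta> is 1/(4l + 6) and \<open>(2l + 2) * \<delta>\<close> equals
  \<open>T\<close>. Grid points at spacing 1/(4l + 4) > \<delta>, alternately moved by half a turn,
  give a chain of 2l + 2 points starting with positive sign. A chain starting with negative sign
  would need 2l + 2 margins and gaps of total length less than \<open>T\<close>, which the equality
  rules out.\<close>

lemma vertex_link_acyclic:
  assumes B: "finite B" "B \<subseteq> V" "grid (4 * l + 4) \<subseteq> B" and v: "v \<in> V" "v \<notin> B"
  shows "acyc bd (chn (cliques (near (crit (Suc l))) {x \<in> B. near (crit (Suc l)) v x}) :: ('a list \<Rightarrow>\<^sub>0 'k::field) set)"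
proof -
  define T where "T = crit (Suc l)"
  define X where "X = {x \<in> B. near T v x}"
  define \<delta> where "\<delta> = 1/2 - T"
  define M where "M = 4 * l + 4"
  have M: "0 < M" "real M = 4 * real l + 4" by (auto simp: M_def)
  have Teq: "(2 * real l + 3) * T = real l + 1" by (simp add: T_def crit_def field_simps)
  have T0: "0 < T" "T < 1/2" using crit_half[of "Suc l"] by (auto simp: T_def crit_def field_simps)
  have \<delta>M: "\<delta> < 1 / real M" and MT: "(2 * real l + 1) / real M < T"
    by (simp_all add: \<delta>_def T_def M crit_def field_simps)
  have XV: "x \<in> V" if "x \<in> X" for x using that B by (auto simp: X_def)
  have plus: "pos v x < T" if "x \<in> X" "sg v x" for x
    using that cd_same[of v v x] pos_range[of v x] by (simp add: X_def near_def)
  have minus: "\<delta> < pos v x" if "x \<in> X" "\<not> sg v x" for x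
    using that cd_opp[of v v x] pos_range[of v x] by (simp add: X_def near_def \<delta>_def)
  have gap: "\<delta> \<le> pos v y - pos v x" if "x \<in> X" "y \<in> X" "sg v x \<noteq> sg v y" "near T x y" "pos v x < pos v y" for x y
    using cd_opp[OF that(3)] that by (simp add: near_def \<delta>_def)
  \<comment> \<open>The first grid point after \<open>v\<close>. Its offset \<xi> is strictly less
    than the spacing because \<open>v\<close> is not a grid point itself.\<close>
  define k0 where "k0 = \<lfloor>real M * ang v\<rfloor> + 1"
  define \<xi> where "\<xi> = of_int k0 / real M - ang v"
  have \<xi>: "0 < \<xi>" "\<xi> \<le> 1 / real M" "\<xi> \<noteq> 1 / real M"
  proof -
    have k: "real M * ang v < of_int k0" "of_int k0 \<le> real M * ang v + 1" by (simp_all add: k0_def)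
    show "0 < \<xi>" using k M(1) by (simp add: \<xi>_def field_simps)
    have "of_int k0 / real M \<le> (real M * ang v + 1) / real M" using k by (intro divide_right_mono) auto
    then show "\<xi> \<le> 1 / real M" using M(1) by (simp add: \<xi>_def add_divide_distrib)
    show "\<xi> \<noteq> 1 / real M"
    proof
      assume "\<xi> = 1 / real M"
      then have "ang v = of_int (k0 - 1) / real M" by (simp add: \<xi>_def diff_divide_distrib)
      then have "ang v = frac (of_int (k0 - 1) / real M)" using ang_range[OF v(1)] by (metis frac_eq)
      then have "v \<in> grid M" using M v by (intro gridI[where k = "k0 - 1"]) auto
      then show False using v B by (auto simp: M_def)
    qed
  qed
  define p where "p = (\<lambda>i. real i / real M + \<xi>)"
  define f where "f = (\<lambda>i. pt (ang v + (p i + (if even i then 0 else 1/2))))"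
  \<comment> \<open>Half a turn is \<open>2 * l + 2\<close> grid steps, so antipodes of grid points
    are again grid points and the chain stays in \<open>B\<close>.\<close>
  have half: "(2 * real l + 2) / real M = 1/2" using M by (simp add: field_simps)
  have fB: "f i \<in> B" for i
  proof -
    let ?k = "k0 + int i + (if even i then 0 else 2 * int l + 2)"
    have "ang v + (p i + (if even i then 0 else 1/2)) = of_int ?k / real M"
      using half by (simp add: p_def \<xi>_def add_divide_distrib)
    then have "f i \<in> grid M" using pt M by (intro gridI[where k = ?k]) (auto simp: f_def)
    then show ?thesis using B by (auto simp: M_def)
  qed
  have p0: "0 < p i" for i using \<xi> M by (simp add: p_def add_nonneg_pos)
  have p_step: "p (Suc i) = p i + 1 / real M" for i by (simp add: p_def add_divide_distrib)
  have p_bound: "p i < real (Suc i) / real M" for i using \<xi> by (simp add: p_def add_divide_distrib)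
  have p_half: "p i < 1/2" if "i < 2 * l + 2" for i
  proof -
    have "real (Suc i) / real M \<le> (2 * real l + 2) / real M" using that by (intro divide_right_mono) auto
    then show ?thesis using p_bound[of i] half by linarith
  qed
  have f_pos: "sg v (f i) = even i" "pos v (f i) = p i" if "i < 2 * l + 2" for i
  proof -
    have "ang (f i) = frac (ang v + (p i + (if even i then 0 else 1/2)))" unfolding f_def by (rule pt)
    then show "sg v (f i) = even i" "pos v (f i) = p i"
      using sg_pos_pt[of "f i" v "p i" "even i"] fB[of i] B(2) p0[of i] p_half[OF that] by auto
  qed
  have fX: "f i \<in> X" if i: "i < 2 * l + 2" for i
  proof (cases "even i")
    case True
    then have "Suc i \<le> 2 * l + 1" using i by presburger
    then have "real (Suc i) / real M \<le> (2 * real l + 1) / real M" by (intro divide_right_mono) auto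
    then have "p i < T" using p_bound[of i] MT by linarith
    then have "cd v (f i) < T" using cd_same[of v v "f i"] f_pos[OF i] True p0[of i] by simp
    then show ?thesis using fB by (simp add: X_def near_def)
  next
    case False
    then obtain j where j: "i = Suc j" by (cases i) auto
    have "\<delta> < p i" using p_step[of j] p0[of j] \<delta>M j by simp
    then have "cd v (f i) < T" using cd_opp[of v v "f i"] f_pos[OF i] False p0[of i] by (simp add: \<delta>_def)
    then show ?thesis using fB by (simp add: X_def near_def)
  qed
  have "acyc bd (chn (cliques (near T) X) :: ('a list \<Rightarrow>\<^sub>0 'k) set)"
  proof (rule alternating_acyclic[OF symp_near, where sg = "sg v" and pos = "pos v" and s = True and q = "2 * l + 2" and f = f])
    show "finite X" using B by (simp add: X_def)
    show "near T x y" if "x \<in> X" "y \<in> X" "sg v x = sg v y" "x \<noteq> y" for x y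
    proof -
      have "\<bar>pos v x - pos v y\<bar> < T"
        using that plus[of x] plus[of y] minus[of x] minus[of y] T0 pos_range[of v x] pos_range[of v y]
        by (cases "sg v x") (auto simp: \<delta>_def)
      then show ?thesis using cd_same[OF that(3)] by (simp add: near_def)
    qed
    show "pos v x \<noteq> pos v y" if "x \<in> X" "y \<in> X" "sg v x \<noteq> sg v y" "near T x y" for x y
      using cd_opp[OF that(3)] that T0 by (auto simp: near_def)
    show "near T x' y'" if *: "x \<in> X" "x' \<in> X" "y \<in> X" "y' \<in> X" "sg v x' = sg v x" "sg v y' = sg v y" "sg v x \<noteq> sg v y"
      "pos v x' \<le> pos v x" "pos v y \<le> pos v y'" "pos v x < pos v y" "near T x y" for x x' y y'
      using cd_opp[of v x' y'] cd_opp[of v x y] * by (simp add: near_def)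
    show "alt_chain (near T) (sg v) (pos v) X True (2 * l + 2) f"
      unfolding alt_chain_def
    proof (intro conjI allI impI)
      fix i assume i: "Suc i < 2 * l + 2"
      then have i': "i < 2 * l + 2" by simp
      show "pos v (f i) < pos v (f (Suc i))" using f_pos[OF i] f_pos[OF i'] p_step[of i] M by simp
      show "near T (f i) (f (Suc i))"
        using cd_opp[of v "f i" "f (Suc i)"] f_pos[OF i] f_pos[OF i'] p_step[of i] \<delta>M M by (simp add: near_def \<delta>_def)
    qed (use f_pos fX in auto)
    show "\<not> alt_chain (near T) (sg v) (pos v) X (\<not> True) (2 * l + 2) g" for g
    proof
      assume g: "alt_chain (near T) (sg v) (pos v) X (\<not> True) (2 * l + 2) g"
      then have g2: "g 0 \<in> X" "\<not> sg v (g 0)" "g (2 * l + 1) \<in> X" "sg v (g (2 * l + 1))"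
        by (auto simp: alt_chain_def)
      have "pos v (g 0) + real (2 * l + 1) * \<delta> \<le> pos v (g (2 * l + 1))"
        by (rule alt_chain_gaps[OF g gap]) auto
      then have "\<delta> + real (2 * l + 1) * \<delta> < T" using minus[OF g2(1,2)] plus[OF g2(3,4)] by linarith
      then show False using Teq by (simp add: \<delta>_def algebra_simps)
    qed
  qed
  then show ?thesis by (simp add: X_def T_def)
qed

lemma racyc_refine:
  assumes C: "finite C" "C \<subseteq> V"
  shows "racyc bd (chn (cliques (near (crit (Suc l))) (grid (4 * l + 4))) :: ('a list \<Rightarrow>\<^sub>0 'k::field) set)
    (chn (cliques (near (crit (Suc l))) (grid (4 * l + 4) \<union> C)))"
  using C
proof (induction C)
  case empty
  show ?case unfolding racyc_def by (intro ballI impI bexI[of _ 0]) (auto simp: bd_lin)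
next
  case (insert v C)
  let ?G = "grid (4 * l + 4)" and ?adj = "near (crit (Suc l))"
  show ?case
  proof (cases "v \<in> ?G \<union> C")
    case True
    then have "?G \<union> insert v C = ?G \<union> C" by blast
    then show ?thesis using insert by simp
  next
    case False
    have r1: "racyc bd (chn (cliques ?adj (?G \<union> C)) :: ('a list \<Rightarrow>\<^sub>0 'k) set) (chn (cliques ?adj (insert v (?G \<union> C))))"
      by (rule racyc_add_vertex[OF symp_near False vertex_link_acyclic])
        (use insert False finite_grid grid_V in auto)
    have r2: "racyc bd (chn (cliques ?adj ?G) :: ('a list \<Rightarrow>\<^sub>0 'k) set) (chn (cliques ?adj (?G \<union> C)))"
      using insert by simp
    have "racyc bd (chn (cliques ?adj ?G) :: ('a list \<Rightarrow>\<^sub>0 'k) set) (chn (cliques ?adj (insert v (?G \<union> C))))"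
    proof (rule bd.racyc_trans[OF r2 r1])
      show "chn (cliques ?adj ?G) \<subseteq> (chn (cliques ?adj (?G \<union> C)) :: ('a list \<Rightarrow>\<^sub>0 'k) set)"
        "chn (cliques ?adj (?G \<union> C)) \<subseteq> (chn (cliques ?adj (insert v (?G \<union> C))) :: ('a list \<Rightarrow>\<^sub>0 'k) set)"
        by (intro chn_mono cliques_mono; auto)+
    qed (simp_all add: stable_chn subclosed_cliques)
    then show ?thesis by simp
  qed
qed

text \<open>At this scale two of the \<open>4l + 4\<close> grid points are nonadjacent exactly if they are antipodal.\<close>

lemma hsphere_grid: "hsphere TYPE('k::field) (2 * l + 2) (cliques (near (crit (Suc l))) (grid (4 * l + 4)))"
proof -
  define M where "M = 4 * l + 4"
  let ?h = "2 * l + 2" and ?T = "crit (Suc l)"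
  define w where "w = (\<lambda>j. pt (real j / real M))"
  have M: "0 < M" "M = ?h + ?h" by (auto simp: M_def)
  have ang: "ang (w j) = real j / real M" if "j < M" for j
    using that by (simp add: w_def pt frac_eq)
  have adj: "near ?T (w i) (w j) \<longleftrightarrow> i + ?h \<noteq> j \<and> j + ?h \<noteq> i" if "i < M" "j < M" for i j
  proof -
    define D where "D = \<bar>int i - int j\<bar>"
    have D: "0 \<le> D" "D < int M" using that by (auto simp: D_def)
    have e: "\<bar>ang (w i) - ang (w j)\<bar> = real_of_int D / real M"
      using M that by (simp add: ang D_def diff_divide_distrib[symmetric])
    have "real_of_int D / real M < 1" using D M by simp
    then have "cd (w i) (w j) = min (real_of_int D / real M) (1 - real_of_int D / real M)"
      unfolding cd_def e[symmetric] by (intro int_dist_small) (simp add: e)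
    also have "\<dots> = real_of_int (min D (int M - D)) / real M"
    proof -
      have "1 - real_of_int D / real M = real_of_int (int M - D) / real M"
        using M(1) by (simp add: diff_divide_distrib)
      moreover have "min (x / real M) (y / real M) = min x y / real M" for x y
        using M(1) by (simp add: min_def divide_le_cancel)
      ultimately show ?thesis by (simp only: of_int_min)
    qed
    finally have "near ?T (w i) (w j) \<longleftrightarrow> real_of_int (min D (int M - D)) / real M < ?T"
      by (simp add: near_def)
    also have "\<dots> \<longleftrightarrow> real_of_int (min D (int M - D)) * (2 * real l + 3) < (4 * real l + 4) * (real l + 1)"
      by (simp add: crit_def M_def field_simps)
    also have "\<dots> \<longleftrightarrow> min D (int M - D) * (2 * int l + 3) < (4 * int l + 4) * (int l + 1)"
    proof -
      have "real_of_int (min D (int M - D)) * (2 * real l + 3) = of_int (min D (int M - D) * (2 * int l + 3))"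
        "(4 * real l + 4) * (real l + 1) = of_int ((4 * int l + 4) * (int l + 1))" by simp_all
      then show ?thesis by (simp only: of_int_less_iff)
    qed
    also have "\<dots> \<longleftrightarrow> min D (int M - D) < 2 * int l + 2"
    proof
      \<comment> \<open>Measured in grid steps the radius lies strictly between
        \<open>2 * l + 1\<close> and \<open>2 * l + 2\<close>: the product of 2l + 1 and 2l + 3 is
        one less than the square of 2l + 2.\<close>
      have e2: "(4 * int l + 4) * (int l + 1) = (2 * int l + 1) * (2 * int l + 3) + 1" by (simp add: algebra_simps)
      {
        assume a: "min D (int M - D) * (2 * int l + 3) < (4 * int l + 4) * (int l + 1)"
        show "min D (int M - D) < 2 * int l + 2"
        proof (rule ccontr)
          assume "\<not> ?thesis"
          then have "(2 * int l + 2) * (2 * int l + 3) \<le> min D (int M - D) * (2 * int l + 3)"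
            by (intro mult_right_mono) auto
          then show False using a by (simp add: algebra_simps)
        qed
      }
      assume "min D (int M - D) < 2 * int l + 2"
      then have "min D (int M - D) * (2 * int l + 3) \<le> (2 * int l + 1) * (2 * int l + 3)"
        by (intro mult_right_mono) auto
      then show "min D (int M - D) * (2 * int l + 3) < (4 * int l + 4) * (int l + 1)" using e2 by linarith
    qed
    also have "\<dots> \<longleftrightarrow> D \<noteq> int ?h" using D by (auto simp: M_def)
    also have "\<dots> \<longleftrightarrow> i + ?h \<noteq> j \<and> j + ?h \<noteq> i" by (auto simp: D_def)
    finally show ?thesis .
  qed
  have inj: "w i \<noteq> w j" if "i < M" "j < M" "i \<noteq> j" for i j
    using ang[OF that(1)] ang[OF that(2)] that M by auto
  have "grid M = w ` {..<M}" by (simp add: grid_def w_def)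
  also have "{..<M} = {..<?h} \<union> (\<lambda>i. i + ?h) ` {..<?h}"
  proof (intro antisym subsetI)
    fix x assume "x \<in> {..<M}"
    then show "x \<in> {..<?h} \<union> (\<lambda>i. i + ?h) ` {..<?h}"
      using M(2) by (cases "x < ?h") (auto intro!: image_eqI[of _ _ "x - ?h"])
  qed (use M(2) in auto)
  finally have g: "grid M = w ` {..<?h} \<union> (\<lambda>i. w (i + ?h)) ` {..<?h}" by (simp add: image_Un image_image)
  have "hsphere TYPE('k) ?h (cliques (near ?T) (w ` {..<?h} \<union> (\<lambda>i. w (i + ?h)) ` {..<?h}))"
  proof (rule hsphere_cross_polytope[OF symp_near])
    fix i j assume ij: "i < ?h" "j < ?h"
    show "w i \<noteq> w (j + ?h)" using ij by (intro inj) (auto simp: M_def)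
    show "near ?T (w i) (w (j + ?h)) \<longleftrightarrow> i \<noteq> j" using ij by (subst adj) (auto simp: M_def)
    assume "i \<noteq> j"
    then show "w i \<noteq> w j \<and> w (i + ?h) \<noteq> w (j + ?h) \<and> near ?T (w i) (w j) \<and> near ?T (w (i + ?h)) (w (j + ?h))"
      using ij by (intro conjI inj; (subst adj)?) (auto simp: M_def)
  qed
  then show ?thesis using g by (simp add: M_def)
qed

section \<open>From finite subsets to the whole circle\<close>

lemma chn_finite_support:
  assumes "c \<in> chn (cliques adj V)"
  shows "\<exists>B. finite B \<and> B \<subseteq> V \<and> (\<forall>B' adj'. B \<subseteq> B' \<longrightarrow> c \<in> chn (cliques adj' V) \<longrightarrow> c \<in> chn (cliques adj' B'))"
proof (intro exI[of _ "\<Union> (set ` Poly_Mapping.keys c)"] conjI allI impI)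
  let ?B = "\<Union> (set ` Poly_Mapping.keys c)"
  show "finite ?B" by simp
  show "?B \<subseteq> V" using assms by (auto simp: chn_def cspan_def cliques_def)
  fix B' adj' assume *: "?B \<subseteq> B'" "c \<in> chn (cliques adj' V)"
  have "set xs \<in> cliques adj' B'" if "xs \<in> Poly_Mapping.keys c" for xs
  proof (rule cliques_subset)
    show "set xs \<in> cliques adj' V" using that * by (auto simp: chn_def cspan_def)
  qed (use that * in blast)
  then show "c \<in> chn (cliques adj' B')" by (auto simp: chn_def cspan_def)
qed

lemma bd_cliques_Int:
  assumes "c \<in> chn (cliques adj B)" "bd c \<in> chn (cliques adj' V)"
  shows "bd c \<in> chn (cliques adj' B)"
proof -
  have "bd c \<in> chn (cliques adj B \<inter> cliques adj' V)" using assms bd_chn[OF assms(1) subclosed_cliques] by (simp add: chn_Int)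
  then show ?thesis by (rule subsetD[OF chn_mono, rotated]) (auto simp: cliques_def)
qed

text \<open>A relative cycle involves finitely many points. Together with a grid fine enough for
  \<open>t\<close> they form a finite set in which the filling can be found.\<close>

lemma racyc_circle:
  assumes t: "crit l < t" "t \<le> crit (Suc l)"
  shows "racyc bd (chn (cliques (near t) V) :: ('a list \<Rightarrow>\<^sub>0 'k::field) set) (chn (cliques (near (crit (Suc l))) V))"
proof -
  let ?T = "crit (Suc l)"
  \<comment> \<open>This is \<open>t - crit l\<close>, the slack that the grid spacing has to
    undercut.\<close>
  define \<kappa> where "\<kappa> = ((2 * real l + 1) * t - real l) / (2 * real l + 1)"
  have "0 < \<kappa>" using t by (simp add: \<kappa>_def crit_iff)
  then obtain M where M: "0 < M" "1 / real M < \<kappa>" using reals_Archimedean[of \<kappa>] by (metis inverse_eq_divide zero_less_Suc)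
  have M2: "(2 * real l + 1) / real M < (2 * real l + 1) * t - real l"
    using mult_strict_right_mono[OF M(2), of "2 * real l + 1"] by (simp add: \<kappa>_def)
  show ?thesis
    unfolding racyc_def
  proof (intro ballI impI)
    fix c :: "'a list \<Rightarrow>\<^sub>0 'k" assume c: "c \<in> chn (cliques (near ?T) V)" "bd c \<in> chn (cliques (near t) V)"
    obtain B where B: "finite B" "B \<subseteq> V" "\<forall>B' adj'. B \<subseteq> B' \<longrightarrow> c \<in> chn (cliques adj' V) \<longrightarrow> c \<in> chn (cliques adj' B')"
      using chn_finite_support[OF c(1)] by blast
    let ?B = "grid M \<union> B"
    have BV: "finite ?B" "?B \<subseteq> V" using B finite_grid grid_V by auto
    have cB: "c \<in> chn (cliques (near ?T) ?B)" using B(3) c(1) by auto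
    have "bd c \<in> chn (cliques (near t) ?B)" by (rule bd_cliques_Int[OF cB c(2)])
    then obtain y where y: "y \<in> chn (cliques (near ?T) ?B)" "c - bd y \<in> chn (cliques (near t) ?B)"
      using racycD[OF racyc_threshold[OF BV t M(1) M2 Un_upper1] cB] by blast
    have sub: "chn (cliques (near r) ?B) \<subseteq> (chn (cliques (near r) V) :: ('a list \<Rightarrow>\<^sub>0 'k) set)" for r
      by (intro chn_mono cliques_mono BV)
    show "\<exists>y\<in>chn (cliques (near ?T) V). c - bd y \<in> chn (cliques (near t) V)"
      using y subsetD[OF sub] by (intro bexI[of _ y]) auto
  qed
qed

theorem hsphere_circle:
  assumes t: "crit l < t" "t \<le> crit (Suc l)"
  shows "hsphere TYPE('k::field) (2 * l + 2) (cliques (near t) V)"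
proof -
  let ?T = "crit (Suc l)" and ?G = "grid (4 * l + 4)"
  have up: "racyc bd (chn (cliques (near ?T) ?G) :: ('a list \<Rightarrow>\<^sub>0 'k) set) (chn (cliques (near ?T) V))"
    unfolding racyc_def
  proof (intro ballI impI)
    fix c :: "'a list \<Rightarrow>\<^sub>0 'k" assume c: "c \<in> chn (cliques (near ?T) V)" "bd c \<in> chn (cliques (near ?T) ?G)"
    obtain B where B: "finite B" "B \<subseteq> V" "\<forall>B' adj'. B \<subseteq> B' \<longrightarrow> c \<in> chn (cliques adj' V) \<longrightarrow> c \<in> chn (cliques adj' B')"
      using chn_finite_support[OF c(1)] by blast
    have cB: "c \<in> chn (cliques (near ?T) (?G \<union> B))" using B(3) c(1) by auto
    obtain y where y: "y \<in> chn (cliques (near ?T) (?G \<union> B))" "c - bd y \<in> chn (cliques (near ?T) ?G)"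
      using racycD[OF racyc_refine[OF B(1,2)] cB c(2)] by blast
    have "chn (cliques (near ?T) (?G \<union> B)) \<subseteq> (chn (cliques (near ?T) V) :: ('a list \<Rightarrow>\<^sub>0 'k) set)"
      by (intro chn_mono cliques_mono) (use B(2) grid_V in auto)
    then show "\<exists>y\<in>chn (cliques (near ?T) V). c - bd y \<in> chn (cliques (near ?T) ?G)"
      using y by (intro bexI[of _ y]) auto
  qed
  note down = racyc_circle[OF t]
  have "cliques (near ?T) ?G \<subseteq> cliques (near ?T) V" by (rule cliques_mono[OF grid_V])
  then have "hsphere TYPE('k) (2 * l + 2) (cliques (near ?T) V)" by (rule hsphere_up[OF up _ hsphere_grid])
  moreover have "cliques (near t) V \<subseteq> cliques (near ?T) V" by (rule cliques_mono) (use t in \<open>auto simp: near_def\<close>)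
  ultimately show ?thesis by (intro hsphere_down[OF down])
qed

end

section \<open>Cocycles dual to the homology\<close>

text \<open>A basis of \<open>S\<close> together with \<open>z\<close> is independent, and the
  prescribed values on it extend linearly. The cocycles of positive degree that detect the classes
  of the circle arise from this.\<close>

lemma functional_exists:
  fixes z :: "'b \<Rightarrow>\<^sub>0 'k::field"
  assumes S: "0 \<in> S" "\<And>x y. x \<in> S \<Longrightarrow> y \<in> S \<Longrightarrow> x + y \<in> S" "\<And>a x. x \<in> S \<Longrightarrow> scl a x \<in> S" and z: "z \<notin> S"
  shows "\<exists>f. linf f \<and> (\<forall>x\<in>S. f x = 0) \<and> f z = 1"
proof -
  interpret p: vector_space_pair "scl :: 'k \<Rightarrow> ('b \<Rightarrow>\<^sub>0 'k) \<Rightarrow> _" "(*) :: 'k \<Rightarrow> 'k \<Rightarrow> 'k"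
    by unfold_locales (auto simp: scl_distrib algebra_simps)
  have sub: "chain_space.subspace S" using S by (simp add: chain_space.subspace_def)
  obtain B where B: "B \<subseteq> S" "chain_space.independent B" "S \<subseteq> chain_space.span B" "card B = chain_space.dim S"
    by (rule chain_space.basis_exists)
  have spB: "chain_space.span B \<subseteq> S" using B(1) sub by (rule chain_space.span_minimal)
  have "chain_space.independent (insert z B)"
    using B(2) z spB by (intro chain_space.independent_insertI) auto
  from p.linear_independent_extend[OF this, of "\<lambda>x. if x = z then 1 else 0"]
  obtain g where g: "Vector_Spaces.linear scl (*) g" "\<And>x. x \<in> insert z B \<Longrightarrow> g x = (if x = z then 1 else 0)"
    by blast
  interpret g: Vector_Spaces.linear scl "(*)" g by (rule g(1))
  have "linf g" by (simp add: klinear_def g.add g.scale)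
  moreover have "g x = 0" if "x \<in> S" for x
  proof -
    have "x \<in> chain_space.span B" using that B(3) by blast
    then show ?thesis
    proof (rule p.linear_eq_0_on_span[OF g(1), rotated])
      show "g y = 0" if "y \<in> B" for y using that z B(1) g(2)[of y] by auto
    qed
  qed
  moreover have "g z = 1" using g(2)[of z] by simp
  ultimately show ?thesis by blast
qed

text \<open>\<open>bdu\<close> is the boundary without the augmentation \<open>eps\<close>.\<close>

definition eps :: "('a list \<Rightarrow>\<^sub>0 'k::field) \<Rightarrow> 'k" where
  "eps c = Poly_Mapping.lookup (bd c) []"

definition bdu :: "('a list \<Rightarrow>\<^sub>0 'k::field) \<Rightarrow> ('a list \<Rightarrow>\<^sub>0 'k)" where
  "bdu c = bd c - Poly_Mapping.single [] (eps c)"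

lemma linf_eps: "linf eps"
  by (auto simp: klinear_def eps_def bd_lin lookup_add)

lemma lin_bdu: "lin bdu"
  by (auto simp: klinear_def bdu_def bd_lin klinearD[OF linf_eps] single_add scl_distrib)

lemmas eps_lin = klinearD[OF linf_eps]
lemmas bdu_lin = klinearD[OF lin_bdu]

lemma bd_Nil [simp]: "bd (Poly_Mapping.single [] a) = 0"
  by (simp add: bd_single)

lemma eps_bdu [simp]: "eps (bdu c) = 0" by (simp add: eps_def bdu_def bd_lin)

lemma bd_bdu [simp]: "bd (bdu c) = 0" by (simp add: bdu_def bd_lin)

lemma bdu_bdu [simp]: "bdu (bdu c) = 0" by (simp add: bdu_def[of "bdu c"])

lemma bdu_eq: "eps c = 0 \<Longrightarrow> bdu c = bd c" by (simp add: bdu_def)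

lemma lookup_bdu_Nil [simp]: "Poly_Mapping.lookup (bdu c) [] = 0"
  by (simp add: bdu_def eps_def lookup_minus)

lemma chn_Nil_free: "{} \<notin> K \<Longrightarrow> c \<in> chn K \<Longrightarrow> Poly_Mapping.lookup c [] = 0"
  by (simp add: chn_def cspan_iff)

lemma chn_lookup: "c \<in> chn L \<longleftrightarrow> (\<forall>xs. Poly_Mapping.lookup c xs \<noteq> 0 \<longrightarrow> set xs \<in> L)"
  by (auto simp: chn_def cspan_def in_keys_iff)

lemma chn_remove_Nil:
  assumes "c \<in> chn L" "Poly_Mapping.lookup c [] = 0"
  shows "c \<in> chn (L - {{}})"
  unfolding chn_lookup
proof (intro allI impI)
  fix xs assume "Poly_Mapping.lookup c xs \<noteq> 0"
  moreover from this have "xs \<noteq> []" using assms(2) by auto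
  ultimately show "set xs \<in> L - {{}}" using assms(1) by (simp add: chn_lookup)
qed

lemma chn_insert_Nil: "c \<in> chn (insert {} K) \<Longrightarrow> Poly_Mapping.lookup c [] = 0 \<Longrightarrow> c \<in> chn K"
  by (drule (1) chn_remove_Nil) (auto simp: chn_lookup)

definition simplicial :: "'a set set \<Rightarrow> bool" where
  "simplicial K \<longleftrightarrow> (\<forall>\<sigma>\<in>K. \<sigma> \<noteq> {} \<and> finite \<sigma> \<and> (\<forall>\<tau>. \<tau> \<subseteq> \<sigma> \<longrightarrow> \<tau> \<noteq> {} \<longrightarrow> \<tau> \<in> K))"

lemma simplicialD:
  assumes "simplicial K"
  shows "{} \<notin> K" "\<sigma> \<in> K \<Longrightarrow> finite \<sigma>" "\<sigma> \<in> K \<Longrightarrow> \<tau> \<subseteq> \<sigma> \<Longrightarrow> \<tau> \<noteq> {} \<Longrightarrow> \<tau> \<in> K"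
    "subclosed (insert {} K)"
proof -
  show "{} \<notin> K" using assms unfolding simplicial_def by fast
  have face: "\<sigma> \<noteq> {} \<and> finite \<sigma> \<and> (\<forall>\<tau>. \<tau> \<subseteq> \<sigma> \<longrightarrow> \<tau> \<noteq> {} \<longrightarrow> \<tau> \<in> K)" if "\<sigma> \<in> K" for \<sigma>
    using assms that unfolding simplicial_def by (rule bspec)
  show "finite \<sigma>" if "\<sigma> \<in> K" for \<sigma> using face[OF that] by (elim conjE)
  show *: "\<tau> \<in> K" if "\<sigma> \<in> K" "\<tau> \<subseteq> \<sigma>" "\<tau> \<noteq> {}" for \<sigma> \<tau>
    using face[OF that(1)] that(2,3) by (elim conjE) simp
  show "subclosed (insert {} K)"
    unfolding subclosed_def
  proof (intro ballI allI impI)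
    fix \<sigma> \<tau> assume "\<sigma> \<in> insert {} K" "\<tau> \<subseteq> \<sigma>"
    then show "\<tau> \<in> insert {} K" using *[of \<sigma> \<tau>] by (cases "\<tau> = {}") auto
  qed
qed

lemma simplicialI:
  assumes "\<And>\<sigma>. \<sigma> \<in> K \<Longrightarrow> \<sigma> \<noteq> {} \<and> finite \<sigma>" "\<And>\<sigma> \<tau>. \<sigma> \<in> K \<Longrightarrow> \<tau> \<subseteq> \<sigma> \<Longrightarrow> \<tau> \<noteq> {} \<Longrightarrow> \<tau> \<in> K"
  shows "simplicial K"
  unfolding simplicial_def using assms by (intro ballI conjI allI impI; blast)

lemma bdu_chn: "simplicial K \<Longrightarrow> c \<in> chn K \<Longrightarrow> bdu c \<in> chn K"
proof (rule chn_insert_Nil)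
  assume K: "simplicial K" "c \<in> chn K"
  then have "c \<in> chn (insert {} K)" using chn_mono[of K "insert {} K"] by auto
  then have "bd c \<in> chn (insert {} K)" by (rule bd_chn[OF _ simplicialD(4)[OF K(1)]])
  moreover have "Poly_Mapping.single [] (eps c) \<in> chn (insert {} K)" by auto
  ultimately show "bdu c \<in> chn (insert {} K)" unfolding bdu_def by blast
qed simp

text \<open>\<open>good K I \<phi>\<close>: the cocycles \<open>\<phi> i\<close>, \<open>i \<in> I\<close>, induce an isomorphism from the total homology of
  the complex onto the functions on \<open>I\<close>.\<close>

definition good :: "'a set set \<Rightarrow> 'i set \<Rightarrow> ('i \<Rightarrow> ('a list \<Rightarrow>\<^sub>0 'k::field) \<Rightarrow> 'k) \<Rightarrow> bool" where
  "good K I \<phi> \<longleftrightarrow> (\<forall>i\<in>I. \<forall>c\<in>chn K. \<phi> i (bdu c) = 0) \<and>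
     (\<forall>c\<in>chn K. bdu c = 0 \<longrightarrow> (\<forall>i\<in>I. \<phi> i c = 0) \<longrightarrow> (\<exists>b\<in>chn K. c = bdu b)) \<and>
     (\<forall>v. \<exists>c\<in>chn K. bdu c = 0 \<and> (\<forall>i\<in>I. \<phi> i c = v i))"

lemma goodD:
  assumes "good K I \<phi>"
  shows "i \<in> I \<Longrightarrow> c \<in> chn K \<Longrightarrow> \<phi> i (bdu c) = 0"
    and "c \<in> chn K \<Longrightarrow> bdu c = 0 \<Longrightarrow> (\<And>i. i \<in> I \<Longrightarrow> \<phi> i c = 0) \<Longrightarrow> \<exists>b\<in>chn K. c = bdu b"
    and "\<exists>c\<in>chn K. bdu c = 0 \<and> (\<forall>i\<in>I. \<phi> i c = v i)"
  using assms by (simp_all add: good_def)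

lemma goodI:
  assumes "\<And>i c. i \<in> I \<Longrightarrow> c \<in> chn K \<Longrightarrow> \<phi> i (bdu c) = 0"
    and "\<And>c. c \<in> chn K \<Longrightarrow> bdu c = 0 \<Longrightarrow> (\<And>i. i \<in> I \<Longrightarrow> \<phi> i c = 0) \<Longrightarrow> \<exists>b\<in>chn K. c = bdu b"
    and "\<And>v. \<exists>c\<in>chn K. bdu c = 0 \<and> (\<forall>i\<in>I. \<phi> i c = v i)"
  shows "good K I \<phi>"
  using assms by (simp add: good_def)

lemma chn_empty: "chn {} = {0}"
  by (auto simp: chn_def cspan_def)

lemma good_empty: "good {} {} \<phi>"
  by (rule goodI) (auto simp: chn_empty bdu_lin)

lemma eps_single: "eps (Poly_Mapping.single xs a) = (if length xs = 1 then a else (0 :: 'k::field))"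
proof (cases xs)
  case (Cons x ys)
  have "Poly_Mapping.lookup (push_cons x d) [] = 0" for d :: "_ \<Rightarrow>\<^sub>0 'k"
  proof -
    have "push_cons x d \<in> cspan {zs. zs \<noteq> []}"
      by (rule cons_cspan[of _ UNIV]) (auto simp: cspan_def)
    then show ?thesis by (simp add: cspan_iff)
  qed
  then show ?thesis using Cons by (simp add: eps_def bd_single lookup_minus lookup_single when_def)
qed (simp add: eps_def)

lemma bdu_vertex: "bdu (Poly_Mapping.single [x] a) = 0"
  by (simp add: bdu_def eps_single bd_single cons_lin)

text \<open>Removing the empty tuple from \<open>b\<close> does not affect its boundary. Since
  \<open>c\<close> has no component at the empty tuple, the augmentation of the filling vanishes and
  the two boundaries agree on it.\<close>

lemma bd_preimage:
  assumes "b \<in> chn L" "c = bd b" "Poly_Mapping.lookup c [] = 0"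
  shows "\<exists>b\<in>chn (L - {{}}). c = bdu b"
proof (intro bexI)
  let ?b = "b - Poly_Mapping.single [] (Poly_Mapping.lookup b [])"
  have "bd ?b = c" using assms by (simp add: bd_lin)
  then show "c = bdu ?b" using assms by (simp add: bdu_def eps_def)
  show "?b \<in> chn (L - {{}})"
    using assms(1) by (intro chn_remove_Nil) (auto simp: chn_lookup lookup_minus lookup_single when_def split: if_splits)
qed

text \<open>An acyclic augmented complex has the ordinary homology of a point, which the
  augmentation detects.\<close>

lemma good_acyclic:
  assumes L: "acyc bd (chn L :: ('a list \<Rightarrow>\<^sub>0 'k::field) set)" and x: "{x} \<in> L" and \<phi>: "\<phi> i = (eps :: ('a list \<Rightarrow>\<^sub>0 'k) \<Rightarrow> 'k)"
  shows "good (L - {{}}) {i} \<phi>"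
proof (rule goodI)
  show "\<exists>b\<in>chn (L - {{}}). c = bdu b" if c: "c \<in> chn (L - {{}})" "bdu c = 0" "\<And>j. j \<in> {i} \<Longrightarrow> \<phi> j c = 0" for c
  proof -
    have "eps c = 0" using c(3)[of i] \<phi> by simp
    then have "bd c = 0" using c(2) by (simp add: bdu_def)
    moreover have "c \<in> chn L" using c(1) chn_mono[of "L - {{}}" L] by auto
    ultimately obtain b where b: "b \<in> chn L" "c = bd b" using acycD[OF L] by blast
    then show ?thesis using chn_Nil_free[OF _ c(1)] by (intro bd_preimage[OF b]) auto
  qed
  show "\<exists>c\<in>chn (L - {{}}). bdu c = 0 \<and> (\<forall>j\<in>{i}. \<phi> j c = v j)" for v
    using x \<phi> by (intro bexI[of _ "Poly_Mapping.single [x] (v i)"]) (auto simp: bdu_vertex eps_single)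
qed (use \<phi> in simp)

definition graded_functional :: "nat \<Rightarrow> (('a list \<Rightarrow>\<^sub>0 'k::field) \<Rightarrow> 'k) \<Rightarrow> bool" where
  "graded_functional n \<phi> \<longleftrightarrow> linf \<phi> \<and> (\<forall>xs a. length xs \<noteq> Suc n \<longrightarrow> \<phi> (Poly_Mapping.single xs a) = 0)"

text \<open>One family of functionals serves all scales: at each scale those whose bar contains it
  are dual to the homology. By the last clause a functional vanishes on every chain present before
  its bar opens, so older classes pair to zero with it. This makes the rank from \<open>s\<close> to
  \<open>t\<close> the number of bars containing both.\<close>

definition barcode_basis :: "(real \<Rightarrow> 'a set set) \<Rightarrow> 'i set \<Rightarrow> ('i \<Rightarrow> real set) \<Rightarrow> ('i \<Rightarrow> nat) \<Rightarrow> ('i \<Rightarrow> ('a list \<Rightarrow>\<^sub>0 'k::field) \<Rightarrow> 'k) \<Rightarrow> bool" where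
  "barcode_basis K I J deg \<phi> \<longleftrightarrow> (\<forall>i\<in>I. graded_functional (deg i) (\<phi> i)) \<and>
     (\<forall>\<epsilon>. simplicial (K \<epsilon>) \<and> finite {i \<in> I. \<epsilon> \<in> J i} \<and> good (K \<epsilon>) {i \<in> I. \<epsilon> \<in> J i} \<phi>) \<and>
     (\<forall>i\<in>I. \<forall>s t. s \<le> t \<longrightarrow> s \<notin> J i \<longrightarrow> t \<in> J i \<longrightarrow> (\<forall>c\<in>chn (K s). \<phi> i c = 0))"

section \<open>Order of the critical values\<close>

lemma crit_less: "l < m \<Longrightarrow> crit l < crit m"
  by (simp add: crit_def field_simps)

lemma crit_less_iff: "crit l < crit m \<longleftrightarrow> l < m"
  by (metis crit_less less_asym' linorder_neqE_nat order_less_irrefl)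

lemma crit_exceeds:
  assumes "t < 1/2"
  shows "\<exists>l. t < crit l"
proof -
  obtain n where n: "t / (1 - 2 * t) < real n" using reals_Archimedean2 by blast
  have "t < (1 - 2 * t) * real n" using n assms by (simp add: field_simps)
  then have "t < crit n" by (simp add: crit_iff algebra_simps)
  then show ?thesis ..
qed

lemma crit_interval:
  assumes "0 < t" "t < 1/2"
  shows "\<exists>l. crit l < t \<and> t \<le> crit (Suc l)"
proof -
  obtain m where m: "t < crit m" using crit_exceeds assms by blast
  define P where "P = (\<lambda>l. t \<le> crit l)"
  have P: "P m" "\<not> P 0" using m assms by (auto simp: P_def crit_def)
  define l where "l = (LEAST l. P l)"
  have 1: "P l" unfolding l_def using P(1) by (rule LeastI)
  then have "l \<noteq> 0" using P(2) by metis
  then obtain k where k: "l = Suc k" by (cases l) auto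
  have "\<not> P k" using not_less_Least[of k P] k by (simp add: l_def)
  then have "crit k < t" "t \<le> crit (Suc k)" using 1 k by (simp_all add: P_def not_le)
  then show ?thesis by blast
qed

lemma crit_interval_unique:
  "crit l < t \<Longrightarrow> t \<le> crit (Suc l) \<Longrightarrow> crit m < t \<Longrightarrow> t \<le> crit (Suc m) \<Longrightarrow> l = m"
  using crit_less_iff[of l "Suc m"] crit_less_iff[of m "Suc l"] by linarith

lemma lpart_lpart: "lpart m (lpart n c) = (if m = n then lpart n c else 0)"
  by (rule poly_mapping_eqI) (simp add: lpart_def)

lemma graded_functional_lpart:
  assumes "linf f" shows "graded_functional n (\<lambda>c. f (lpart (Suc n) c))"
  unfolding graded_functional_def
  using klinear_compose[OF lin_lpart assms] by (simp add: lpart_single klinearD(3)[OF assms])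

lemma graded_functional_lookup_Nil:
  "graded_functional n \<phi> \<Longrightarrow> \<phi> (Poly_Mapping.single [] a) = 0"
  by (simp add: graded_functional_def)

section \<open>Dual cocycles on the circle\<close>

context circle_coords
begin

lemma V_nonempty: "V \<noteq> {}"
  using pt by blast

text \<open>The functional has to vanish on the boundaries at \<open>crit (Suc l)\<close> and on all
  chains at \<open>crit l\<close>, but not on the fundamental cycle. This is consistent: homology at
  \<open>crit l\<close> sits in a lower degree, so the component of tuple length
  \<open>2 * l + 2\<close> of any cycle there is a boundary.\<close>

lemma circle_functional:
  "\<exists>\<phi> :: ('a list \<Rightarrow>\<^sub>0 'k::field) \<Rightarrow> 'k. graded_functional (2 * l + 1) \<phi> \<and>
     (\<forall>c\<in>chn (cliques (near (crit (Suc l))) V). \<phi> (bd c) = 0) \<and>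
     (\<forall>t z. crit l < t \<longrightarrow> t \<le> crit (Suc l) \<longrightarrow> fund_cycle (2 * l + 2) (cliques (near t) V) z \<longrightarrow> \<phi> z \<noteq> 0) \<and>
     (0 < l \<longrightarrow> (\<forall>c\<in>chn (cliques (near (crit l)) V). \<phi> c = 0))"
proof -
  let ?T = "crit (Suc l)" and ?n = "2 * l + 2"
  \<comment> \<open>For \<open>l = 0\<close> no earlier complex is meant. At
    \<open>crit 0 = 0\<close> the cliques would still comprise the vertices and the empty simplex,
    so the empty family takes their place.\<close>
  let ?K = "cliques (near ?T) V" and ?K' = "if l = 0 then {} else cliques (near (crit l)) V"
  have "hsphere TYPE('k) ?n ?K" by (rule hsphere_circle) (auto intro: crit_less)
  then obtain z :: "'a list \<Rightarrow>\<^sub>0 'k" where z: "fund_cycle ?n ?K z" by (auto simp: hsphere_def)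
  have "cliques (near (crit l)) V \<subseteq> ?K"
    by (rule cliques_mono) (use crit_less[of l "Suc l"] in \<open>auto simp: near_def\<close>)
  then have "?K' \<subseteq> ?K" by simp
  then have K'K: "chn ?K' \<subseteq> (chn ?K :: ('a list \<Rightarrow>\<^sub>0 'k) set)" by (rule chn_mono)
  have bound: "\<exists>e\<in>chn ?K. lpart ?n w = bd e" if w: "w \<in> chn ?K'" "bd w = 0" for w :: "'a list \<Rightarrow>\<^sub>0 'k"
  proof (cases l)
    case 0
    then show ?thesis using w by (intro bexI[of _ 0]) (auto simp: chn_empty bd_lin klinearD[OF lin_lpart])
  next
    case (Suc m)
    have "hsphere TYPE('k) (2 * m + 2) (cliques (near (crit l)) V)"
      by (rule hsphere_circle) (auto simp: Suc intro: crit_less)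
    then obtain z' :: "'a list \<Rightarrow>\<^sub>0 'k" where z': "fund_cycle (2 * m + 2) ?K' z'" by (auto simp: hsphere_def Suc)
    then obtain s b where b: "b \<in> chn ?K'" "w = scl s z' + bd b" using fund_cycleD(5)[OF z' w] by blast
    have "lpart ?n z' = 0"
      using fund_cycleD(2)[OF z'] lpart_lpart[of ?n "2 * m + 2" z'] by (simp add: Suc)
    then have "lpart ?n w = bd (lpart (Suc ?n) b)"
      unfolding b(2) by (simp only: klinearD[OF lin_lpart] bd_lpart scl_simps add_0_left)
    then show ?thesis using lpart_chn b(1) K'K by blast
  qed
  define S where "S = {x :: 'a list \<Rightarrow>\<^sub>0 'k. \<exists>b\<in>chn ?K. \<exists>w\<in>chn ?K'. x = bd b + w}"
  have S0: "0 \<in> S" unfolding S_def by (auto intro!: bexI[of _ 0] simp: bd_lin)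
  have S1: "x + y \<in> S" if "x \<in> S" "y \<in> S" for x y
  proof -
    obtain b w b' w' where *: "b \<in> chn ?K" "w \<in> chn ?K'" "x = bd b + w" "b' \<in> chn ?K" "w' \<in> chn ?K'" "y = bd b' + w'"
      using \<open>x \<in> S\<close> \<open>y \<in> S\<close> unfolding S_def by blast
    then have "x + y = bd (b + b') + (w + w')" by (simp add: bd_lin)
    then show ?thesis unfolding S_def using chn_closed(2) * by blast
  qed
  have S2: "scl a x \<in> S" if "x \<in> S" for a x
  proof -
    obtain b w where *: "b \<in> chn ?K" "w \<in> chn ?K'" "x = bd b + w" using \<open>x \<in> S\<close> unfolding S_def by blast
    then have "scl a x = bd (scl a b) + scl a w" by (simp add: bd_lin scl_distrib)
    then show ?thesis unfolding S_def using chn_closed(5) * by blast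
  qed
  have "z \<notin> S"
  proof
    assume "z \<in> S"
    then obtain b w where *: "b \<in> chn ?K" "w \<in> chn ?K'" "z = bd b + w" unfolding S_def by blast
    have "bd w = 0" using fund_cycleD(3)[OF z] unfolding *(3) by (simp add: bd_lin)
    then obtain e where e: "e \<in> chn ?K" "lpart ?n w = bd e" using bound *(2) by blast
    have "z = lpart ?n (bd b + w)" using fund_cycleD(2)[OF z] *(3) by simp
    also have "\<dots> = bd (lpart (Suc ?n) b + e)"
      by (simp only: klinearD(1)[OF lin_lpart] bd_lpart e(2) bd_lin)
    finally show False using fund_cycleD(4)[OF z, of "lpart (Suc ?n) b + e"] lpart_chn *(1) e(1) by auto
  qed
  then obtain f where f: "linf f" "\<forall>x\<in>S. f x = 0" "f z = 1"
    using functional_exists[OF S0 S1 S2] by blast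
  have S_bd: "bd b \<in> S" if "b \<in> chn ?K" for b
    unfolding S_def by (rule CollectI, rule bexI[OF _ that], rule bexI[of _ 0]) auto
  have S_K': "w \<in> S" if "w \<in> chn ?K'" for w
    unfolding S_def by (rule CollectI, rule bexI[of _ 0], rule bexI[OF _ that]) (auto simp: bd_lin)
  define \<phi> where "\<phi> = (\<lambda>c. f (lpart ?n c))"
  have gf: "graded_functional (2 * l + 1) \<phi>"
    unfolding \<phi>_def using graded_functional_lpart[OF f(1), of "2 * l + 1"] by simp
  then have lf: "linf \<phi>" by (simp add: graded_functional_def)
  have \<phi>bd: "\<phi> (bd c) = 0" if "c \<in> chn ?K" for c
    using f(2) S_bd[OF lpart_chn[OF that, of "Suc ?n"]] by (simp add: \<phi>_def bd_lpart)
  \<comment> \<open>A fundamental cycle at \<open>t\<close> with value 0 would bound at the upper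
    critical value, and relative acyclicity would move the bounding chain back to
    \<open>t\<close>.\<close>
  have nz: "\<phi> z' \<noteq> 0" if t: "crit l < t" "t \<le> ?T" and z': "fund_cycle ?n (cliques (near t) V) z'" for t z'
  proof
    assume 0: "\<phi> z' = 0"
    have sub: "cliques (near t) V \<subseteq> ?K" by (rule cliques_mono) (use t in \<open>auto simp: near_def\<close>)
    have z'K: "z' \<in> chn ?K" using fund_cycleD(1)[OF z'] chn_mono[OF sub] by blast
    obtain s b where b: "b \<in> chn ?K" "z' = scl s z + bd b"
      using fund_cycleD(5)[OF z z'K fund_cycleD(3)[OF z']] by blast
    have "\<phi> z' = s * \<phi> z" using b \<phi>bd by (simp add: klinearD[OF lf])
    also have "\<phi> z = 1" using fund_cycleD(2)[OF z] f(3) by (simp add: \<phi>_def)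
    finally have "z' = bd b" using 0 b(2) by simp
    then have "bd b \<in> chn (cliques (near t) V)" using fund_cycleD(1)[OF z'] by simp
    then obtain y where "b - bd y \<in> chn (cliques (near t) V)" using racycD[OF racyc_circle[OF t] b(1)] by blast
    moreover have "bd (b - bd y) = z'" using \<open>z' = bd b\<close> by (simp add: bd_lin)
    ultimately show False using fund_cycleD(4)[OF z'] by blast
  qed
  have van: "\<phi> c = 0" if "0 < l" "c \<in> chn (cliques (near (crit l)) V)" for c
    using f(2) S_K' that lpart_chn[OF that(2), of ?n] by (simp add: \<phi>_def)
  show ?thesis using gf \<phi>bd nz van by blast
qed

theorem circle_good:
  "\<exists>\<phi> :: nat \<Rightarrow> ('a list \<Rightarrow>\<^sub>0 'k::field) \<Rightarrow> 'k. (\<forall>m. graded_functional m (\<phi> m)) \<and> \<phi> 0 = eps \<and>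
     (\<forall>l t. crit l < t \<longrightarrow> t \<le> crit (Suc l) \<longrightarrow> good (cliques (near t) V - {{}}) {0, 2 * l + 1} \<phi>) \<and>
     good (cliques (near (1/2)) V - {{}}) {0} \<phi> \<and>
     (\<forall>l>0. \<forall>c\<in>chn (cliques (near (crit l)) V). \<phi> (2 * l + 1) c = 0)"
proof -
  define P where "P = (\<lambda>l (\<phi> :: ('a list \<Rightarrow>\<^sub>0 'k) \<Rightarrow> 'k). graded_functional (2 * l + 1) \<phi> \<and>
     (\<forall>c\<in>chn (cliques (near (crit (Suc l))) V). \<phi> (bd c) = 0) \<and>
     (\<forall>t z. crit l < t \<longrightarrow> t \<le> crit (Suc l) \<longrightarrow> fund_cycle (2 * l + 2) (cliques (near t) V) z \<longrightarrow> \<phi> z \<noteq> 0) \<and>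
     (0 < l \<longrightarrow> (\<forall>c\<in>chn (cliques (near (crit l)) V). \<phi> c = 0)))"
  define F where "F = (\<lambda>l. SOME \<phi>. P l \<phi>)"
  have F: "P l (F l)" for l
  proof -
    have "\<exists>\<phi>. P l \<phi>" unfolding P_def by (rule circle_functional)
    then show ?thesis unfolding F_def by (rule someI_ex)
  qed
  define \<phi> where "\<phi> = (\<lambda>m. if m = 0 then eps else if odd m then F (m div 2) else (\<lambda>_. 0))"
  have \<phi>0: "\<phi> 0 = eps" and \<phi>l: "\<phi> (2 * l + 1) = F l" for l by (simp_all add: \<phi>_def)
  have gr: "graded_functional m (\<phi> m)" for m
  proof -
    consider "m = 0" | l where "m = 2 * l + 1" | "m \<noteq> 0" "even m" by (meson oddE)
    then show ?thesis
    proof cases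
      case 1
      then show ?thesis using linf_eps by (simp add: \<phi>0 graded_functional_def eps_single)
    next
      case 2
      then show ?thesis using F[of l] unfolding P_def by (simp only: \<phi>l)
    next
      case 3
      then show ?thesis by (simp add: \<phi>_def graded_functional_def klinear_def)
    qed
  qed
  have lf: "linf (\<phi> m)" for m using gr by (simp add: graded_functional_def)
  obtain x0 where x0: "x0 \<in> V" using V_nonempty by blast
  have good: "good (cliques (near t) V - {{}}) {0, 2 * l + 1} \<phi>" if t: "crit l < t" "t \<le> crit (Suc l)" for l t
  proof -
    let ?L = "cliques (near t) V" and ?T = "crit (Suc l)"
    have sub: "chn ?L \<subseteq> (chn (cliques (near ?T) V) :: ('a list \<Rightarrow>\<^sub>0 'k) set)"
      by (intro chn_mono cliques_mono) (use t in \<open>auto simp: near_def\<close>)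
    have subN: "chn (?L - {{}}) \<subseteq> (chn ?L :: ('a list \<Rightarrow>\<^sub>0 'k) set)" by (rule chn_mono) auto
    obtain z :: "'a list \<Rightarrow>\<^sub>0 'k" where z: "fund_cycle (2 * l + 2) ?L z"
      using hsphere_circle[OF t] by (auto simp: hsphere_def)
    have Fz: "F l z \<noteq> 0" using F[of l] t z unfolding P_def by blast
    have Fbd: "F l (bd c) = 0" if "c \<in> chn ?L" for c using F[of l] sub that unfolding P_def by blast
    have linF: "linf (F l)" using lf[of "2 * l + 1"] by (simp only: \<phi>l)
    have FN: "F l (Poly_Mapping.single xs a) = 0" if "length xs \<noteq> 2 * l + 2" for xs a
      using gr[of "2 * l + 1"] that unfolding \<phi>l by (simp add: graded_functional_def)
    show ?thesis
    proof (rule goodI)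
      fix i and c :: "'a list \<Rightarrow>\<^sub>0 'k" assume i: "i \<in> {0, 2 * l + 1}" and c: "c \<in> chn (?L - {{}})"
      have "F l (bdu c) = 0"
        unfolding bdu_def using Fbd[of c] c subN by (simp add: klinearD[OF linF] FN subset_iff)
      then show "\<phi> i (bdu c) = 0" using i \<phi>0 \<phi>l[of l] by auto
    next
      fix c :: "'a list \<Rightarrow>\<^sub>0 'k" assume c: "c \<in> chn (?L - {{}})" "bdu c = 0" "\<And>i. i \<in> {0, 2 * l + 1} \<Longrightarrow> \<phi> i c = 0"
      have e: "eps c = 0" "F l c = 0" using c(3)[of 0] c(3)[of "2 * l + 1"] unfolding \<phi>0 \<phi>l by simp_all
      then have "bd c = 0" using c(2) by (simp add: bdu_def)
      then obtain s b where b: "b \<in> chn ?L" "c = scl s z + bd b"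
        using fund_cycleD(5)[OF z] c(1) subN by blast
      have "F l c = s * F l z" using b Fbd by (simp add: klinearD[OF linF])
      then have "c = bd b" using e Fz b by simp
      then show "\<exists>b\<in>chn (?L - {{}}). c = bdu b" using chn_Nil_free[OF _ c(1)] by (intro bd_preimage[OF b(1)]) auto
    next
      fix v :: "nat \<Rightarrow> 'k"
      have "Poly_Mapping.lookup (lpart (2 * l + 2) z) [] = 0" by (simp add: lpart_def)
      then have zN: "Poly_Mapping.lookup z [] = 0" using fund_cycleD(2)[OF z] by simp
      have zc: "z \<in> chn (?L - {{}})" using chn_remove_Nil[OF fund_cycleD(1)[OF z] zN] .
      have ez: "eps z = 0" using fund_cycleD(3)[OF z] by (simp add: eps_def)
      then have zb: "bdu z = 0" using fund_cycleD(3)[OF z] by (simp add: bdu_def)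
      let ?c = "Poly_Mapping.single [x0] (v 0) + scl (v (2 * l + 1) / F l z) z"
      have "?c \<in> chn (?L - {{}})" using x0 zc by (intro chn_closed) (auto simp: cliques_def)
      moreover have "bdu ?c = 0" by (simp add: bdu_lin bdu_vertex zb)
      moreover have "\<phi> 0 ?c = v 0" by (simp add: \<phi>0 eps_lin eps_single ez)
      moreover have "\<phi> (2 * l + 1) ?c = v (2 * l + 1)" unfolding \<phi>l using Fz by (simp add: klinearD[OF linF] FN)
      ultimately show "\<exists>c\<in>chn (?L - {{}}). bdu c = 0 \<and> (\<forall>i\<in>{0, 2 * l + 1}. \<phi> i c = v i)" by blast
    qed
  qed
  have van: "\<phi> (2 * l + 1) c = 0" if "0 < l" "c \<in> chn (cliques (near (crit l)) V)" for l c
    using F[of l] that unfolding P_def \<phi>l by blast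
  \<comment> \<open>The critical values accumulate at \<open>1/2\<close>. The finitely many
    distances occurring in a cycle stay below some \<open>crit l\<close>; at the next critical value
    its class is detected by \<open>F l\<close>, which vanishes on chains from
    \<open>crit l\<close>, so the cycle bounds there.\<close>
  have "acyc bd (chn (cliques (near (1/2)) V) :: ('a list \<Rightarrow>\<^sub>0 'k) set)"
    unfolding acyc_def
  proof (intro ballI impI)
    fix c :: "'a list \<Rightarrow>\<^sub>0 'k" assume c: "c \<in> chn (cliques (near (1/2)) V)" "bd c = 0"
    obtain B where B: "finite B" "B \<subseteq> V" "\<forall>B' adj'. B \<subseteq> B' \<longrightarrow> c \<in> chn (cliques adj' V) \<longrightarrow> c \<in> chn (cliques adj' B')"
      using chn_finite_support[OF c(1)] by blast
    have cB: "c \<in> chn (cliques (near (1/2)) B)" using B(3) c(1) by auto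
    define D where "D = insert 0 {cd x y | x y. x \<in> B \<and> y \<in> B \<and> cd x y < 1/2}"
    have "finite D"
      using finite_subset[of D "insert 0 ((\<lambda>(x, y). cd x y) ` (B \<times> B))"] B(1) by (auto simp: D_def)
    moreover have "D \<noteq> {}" by (simp add: D_def)
    ultimately have "Max D \<in> D" and le: "\<And>x. x \<in> D \<Longrightarrow> x \<le> Max D" by (auto intro: Max_in)
    then have "Max D < 1/2" by (auto simp: D_def)
    then obtain l where l: "Max D < crit l" using crit_exceeds by blast
    have lpos: "0 < l" using l le[of 0] by (cases l) (auto simp: D_def crit_def)
    have "cliques (near (1/2)) B \<subseteq> cliques (near (crit l)) V"
    proof (rule cliques_mono[OF B(2)])
      fix x y assume "x \<in> B" "y \<in> B" "near (1/2) x y"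
      then have "cd x y \<in> D" by (auto simp: D_def near_def)
      then show "near (crit l) x y" using le l by (force simp: near_def)
    qed
    then have cl: "c \<in> chn (cliques (near (crit l)) V)" using chn_mono cB by blast
    let ?T = "crit (Suc l)"
    have T: "crit l < ?T" by (simp add: crit_less)
    have "cliques (near (crit l)) V \<subseteq> cliques (near ?T) V" by (rule cliques_mono) (use T in \<open>auto simp: near_def\<close>)
    then have cT: "c \<in> chn (cliques (near ?T) V)" using chn_mono cl by blast
    obtain z :: "'a list \<Rightarrow>\<^sub>0 'k" where z: "fund_cycle (2 * l + 2) (cliques (near ?T) V) z"
      using hsphere_circle[OF T order_refl] by (auto simp: hsphere_def)
    obtain s b where b: "b \<in> chn (cliques (near ?T) V)" "c = scl s z + bd b" using fund_cycleD(5)[OF z cT c(2)] by blast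
    have linF: "linf (F l)" using lf[of "2 * l + 1"] by (simp only: \<phi>l)
    have "F l z \<noteq> 0" "F l (bd b) = 0" using F[of l] T z b(1) unfolding P_def by blast+
    moreover have "F l c = 0" using van[OF lpos cl] by (simp only: \<phi>l)
    ultimately have "c = bd b" using b(2) by (simp add: klinearD[OF linF])
    moreover have "cliques (near ?T) V \<subseteq> cliques (near (1/2)) V"
      by (rule cliques_mono) (use crit_half[of "Suc l"] in \<open>auto simp: near_def\<close>)
    then have "b \<in> chn (cliques (near (1/2)) V)" using chn_mono b(1) by blast
    ultimately show "\<exists>y\<in>chn (cliques (near (1/2)) V). c = bd y" by blast
  qed
  then have "good (cliques (near (1/2)) V - {{}}) {0} \<phi>"
    by (rule good_acyclic[where x = x0]) (use x0 in \<open>auto simp: cliques_def \<phi>0\<close>)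
  then show ?thesis using gr \<phi>0 good van by blast
qed

end

section \<open>Vietoris--Rips complexes of Euclidean circles\<close>

text \<open>The formula of \<open>circle_bar\<close> for an arbitrary radius, so that the geometry
  is independent of Fourier coefficients.\<close>

definition arc_bar :: "real \<Rightarrow> nat \<Rightarrow> real set" where
  "arc_bar r n =
     (if n = 0 then {0<..}
      else if odd n then
        (let k = real (n div 2) in
          {2 * r * sin (pi * (k / (2*k + 1))) <..
           2 * r * sin (pi * ((k + 1) / (2*k + 3)))})
      else {})"

definition circle_points :: "real \<Rightarrow> (real \<times> real) set" where
  "circle_points r = {(x, y). x\<^sup>2 + y\<^sup>2 = r\<^sup>2}"

lemma arc_bar_odd: "arc_bar r (2 * l + 1) = {2 * r * sin (pi * crit l) <.. 2 * r * sin (pi * crit (Suc l))}"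
proof -
  have "(2 * l + 1) div 2 = l" by simp
  moreover have "crit (Suc l) = (real l + 1) / (2 * real l + 3)" by (simp add: crit_def algebra_simps)
  ultimately show ?thesis by (simp add: arc_bar_def Let_def crit_def)
qed

lemma arc_bar_0: "arc_bar r 0 = {0<..}" by (simp add: arc_bar_def)

lemma arc_bar_even: "0 < n \<Longrightarrow> even n \<Longrightarrow> arc_bar r n = {}" by (simp add: arc_bar_def)

lemma nat_cases_parity:
  obtains "m = 0" | l :: nat where "m = 2 * l + 1" | "0 < m" "even m"
  by (metis gr0I oddE)

lemma vietoris_rips_mono: "s \<le> t \<Longrightarrow> vietoris_rips d X s \<subseteq> vietoris_rips d X t"
  unfolding vietoris_rips_def by (intro Collect_mono impI) (meson less_le_trans)

lemma vietoris_rips_empty: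
  assumes "\<And>x. x \<in> V \<Longrightarrow> \<epsilon> \<le> d x x" shows "vietoris_rips d V \<epsilon> = {}"
  using assms by (force simp: vietoris_rips_def)

lemma simplicial_vietoris_rips: "simplicial (vietoris_rips d V \<epsilon>)"
  unfolding simplicial_def vietoris_rips_def by (auto intro: finite_subset)

lemma vietoris_rips_cliques:
  assumes "\<And>x. x \<in> V \<Longrightarrow> d x x < \<epsilon>"
  shows "vietoris_rips d V \<epsilon> = cliques (\<lambda>x y. d x y < \<epsilon>) V - {{}}"
proof (rule Set.set_eqI)
  fix \<sigma>
  have "d x y < \<epsilon>" if "\<sigma> \<subseteq> V" "\<forall>x\<in>\<sigma>. \<forall>y\<in>\<sigma>. x \<noteq> y \<longrightarrow> d x y < \<epsilon>" "x \<in> \<sigma>" "y \<in> \<sigma>" for x y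
    using assms that by (cases "x = y") auto
  then have "\<sigma> \<subseteq> V \<Longrightarrow> (\<forall>x\<in>\<sigma>. \<forall>y\<in>\<sigma>. d x y < \<epsilon>) = (\<forall>x\<in>\<sigma>. \<forall>y\<in>\<sigma>. x \<noteq> y \<longrightarrow> d x y < \<epsilon>)"
    by meson
  then show "\<sigma> \<in> vietoris_rips d V \<epsilon> \<longleftrightarrow> \<sigma> \<in> cliques (\<lambda>x y. d x y < \<epsilon>) V - {{}}"
    unfolding vietoris_rips_def cliques_def mem_Collect_eq Diff_iff singleton_iff by argo
qed

lemma good_full:
  assumes x: "x \<in> V" and d: "\<And>x y. x \<in> V \<Longrightarrow> y \<in> V \<Longrightarrow> d x y < \<epsilon>"
    and \<phi>: "\<phi> i = (eps :: ('a list \<Rightarrow>\<^sub>0 'k::field) \<Rightarrow> 'k)"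
  shows "good (vietoris_rips d V \<epsilon>) {i} \<phi>"
proof -
  have "cliques (\<lambda>x y. d x y < \<epsilon>) V = cliques (\<lambda>_ _. True) V"
    by (intro antisym cliques_mono) (use d in auto)
  then have 1: "vietoris_rips d V \<epsilon> = cliques (\<lambda>_ _. True) V - {{}}"
    using vietoris_rips_cliques[of V d \<epsilon>] d by simp
  have "acyc bd (chn (cliques (\<lambda>_ _. True) V) :: ('a list \<Rightarrow>\<^sub>0 'k) set)"
    by (rule acyc_cliques_cone[OF _ x]) (auto simp: symp_def)
  then show ?thesis unfolding 1 by (rule good_acyclic[where x = x]) (use x \<phi> in \<open>auto simp: cliques_def\<close>)
qed

text \<open>For radius 0 the circle degenerates to a point: the odd bars are empty and only the
  augmentation remains.\<close>

lemma point_basis: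
  "barcode_basis (vietoris_rips dist (circle_points 0)) UNIV (arc_bar 0) id
     (\<lambda>m. if m = 0 then (eps :: _ \<Rightarrow> 'k::field) else (\<lambda>_. 0))"
proof -
  let ?\<phi> = "\<lambda>m :: nat. if m = 0 then (eps :: ((real \<times> real) list \<Rightarrow>\<^sub>0 'k) \<Rightarrow> 'k) else (\<lambda>_. 0)"
  have V: "circle_points 0 = {(0, 0)}" by (auto simp: circle_points_def)
  have J: "\<epsilon> \<in> arc_bar 0 m \<longleftrightarrow> m = 0 \<and> 0 < \<epsilon>" for \<epsilon> m
    by (cases m rule: nat_cases_parity) (auto simp: arc_bar_0 arc_bar_even arc_bar_odd simp del: One_nat_def)
  have neg: "vietoris_rips dist (circle_points 0) \<epsilon> = {}" if "\<epsilon> \<le> 0" for \<epsilon>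
    by (rule vietoris_rips_empty) (use that in simp)
  have "good (vietoris_rips dist (circle_points 0) \<epsilon>) {m \<in> UNIV. \<epsilon> \<in> arc_bar 0 m} ?\<phi>" for \<epsilon>
  proof (cases "0 < \<epsilon>")
    case True
    then have "{m \<in> UNIV. \<epsilon> \<in> arc_bar 0 m} = {0}" using J by auto
    then show ?thesis using good_full[of "(0, 0)" "circle_points 0" dist \<epsilon> ?\<phi> 0] True by (simp add: V)
  next
    case False
    then have "{m \<in> UNIV. \<epsilon> \<in> arc_bar 0 m} = {}" using J by auto
    then show ?thesis using neg[of \<epsilon>] False by (simp add: good_empty)
  qed
  moreover have "finite {m \<in> UNIV. \<epsilon> \<in> arc_bar 0 m}" for \<epsilon> using J by auto
  moreover have "?\<phi> i c = 0" if "s \<notin> arc_bar 0 i" "t \<in> arc_bar 0 i" "c \<in> chn (vietoris_rips dist (circle_points 0) s)" for i s t c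
    using that J neg[of s] by (auto simp: chn_empty eps_lin)
  moreover have "graded_functional (id m) (?\<phi> m)" for m
    by (simp add: graded_functional_def eps_single linf_eps klinear_def[of "(*)" "\<lambda>_. 0"])
  ultimately show ?thesis unfolding barcode_basis_def using simplicial_vietoris_rips by blast
qed

section \<open>Chords and arcs\<close>

definition circle_param :: "real \<Rightarrow> real \<Rightarrow> real \<times> real" where
  "circle_param r x = (r * cos (2 * pi * x), r * sin (2 * pi * x))"

lemma dist_circle_param:
  assumes "0 \<le> r"
  shows "dist (circle_param r x) (circle_param r y) = 2 * r * \<bar>sin (pi * (x - y))\<bar>"
proof -
  let ?a = "2 * pi * x" and ?b = "2 * pi * y"
  have *: "(r * a - r * b)\<^sup>2 + (r * c - r * d)\<^sup>2 =
      r\<^sup>2 * (a\<^sup>2 + c\<^sup>2) + r\<^sup>2 * (b\<^sup>2 + d\<^sup>2) - 2 * r\<^sup>2 * (a * b + c * d)" for a b c d :: real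
    by (simp add: power2_eq_square algebra_simps)
  have "(r * cos ?a - r * cos ?b)\<^sup>2 + (r * sin ?a - r * sin ?b)\<^sup>2
      = r\<^sup>2 * ((cos ?a)\<^sup>2 + (sin ?a)\<^sup>2) + r\<^sup>2 * ((cos ?b)\<^sup>2 + (sin ?b)\<^sup>2)
        - 2 * r\<^sup>2 * (cos ?a * cos ?b + sin ?a * sin ?b)"
    by (rule *)
  also have "\<dots> = 2 * r\<^sup>2 * (1 - cos (?a - ?b))"
    by (simp only: cos_diff sin_cos_squared_add2) (simp add: algebra_simps)
  also have "?a - ?b = 2 * (pi * (x - y))" by (simp add: algebra_simps)
  also have "1 - cos (2 * (pi * (x - y))) = 2 * (sin (pi * (x - y)))\<^sup>2"
    by (simp add: cos_double_sin)
  also have "2 * r\<^sup>2 * (2 * (sin (pi * (x - y)))\<^sup>2) = (2 * r * \<bar>sin (pi * (x - y))\<bar>)\<^sup>2"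
    by (simp add: power2_eq_square algebra_simps)
  finally have "sqrt ((r * cos ?a - r * cos ?b)\<^sup>2 + (r * sin ?a - r * sin ?b)\<^sup>2) = 2 * r * \<bar>sin (pi * (x - y))\<bar>"
    using assms by (simp add: real_sqrt_abs)
  then show ?thesis by (simp add: circle_param_def dist_Pair_Pair dist_real_def)
qed

lemma abs_sin_int_dist:
  assumes "\<bar>z\<bar> < 1"
  shows "\<bar>sin (pi * z)\<bar> = sin (pi * int_dist z)"
proof -
  have "\<bar>sin (pi * z)\<bar> = sin (pi * \<bar>z\<bar>)"
  proof -
    have "0 \<le> sin (pi * \<bar>z\<bar>)" using assms by (intro sin_ge_zero) auto
    then show ?thesis by (cases "0 \<le> z") auto
  qed
  moreover have "sin (pi * (1 - \<bar>z\<bar>)) = sin (pi * \<bar>z\<bar>)" by (simp add: right_diff_distrib)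
  ultimately show ?thesis unfolding int_dist_small[OF assms] by (simp add: min_def)
qed

lemma int_dist_range: "0 \<le> int_dist z" "int_dist z \<le> 1/2"
  using frac_lt_1[of z] by (auto simp: int_dist_def min_def)

lemma bij_circle_param:
  assumes r: "0 < r"
  shows "bij_betw (circle_param r) {0..<1} (circle_points r)"
  unfolding bij_betw_def
proof
  show "inj_on (circle_param r) {0..<1}"
  proof (rule inj_onI)
    fix x y assume xy: "x \<in> {0..<1}" "y \<in> {0..<1}" "circle_param r x = circle_param r y"
    have z: "\<bar>x - y\<bar> < 1" using xy by auto
    have "sin (pi * int_dist (x - y)) = 0"
      using dist_circle_param[of r x y] xy r abs_sin_int_dist[OF z] by simp
    have "\<not> 0 < int_dist (x - y)"
    proof
      assume "0 < int_dist (x - y)"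
      then have "0 < pi * int_dist (x - y)" "pi * int_dist (x - y) < pi * 1"
        using int_dist_range[of "x - y"] by (simp, intro mult_strict_left_mono) auto
      then show False using sin_gt_zero[of "pi * int_dist (x - y)"] \<open>sin (pi * int_dist (x - y)) = 0\<close> by simp
    qed
    then have "int_dist (x - y) = 0" using int_dist_range[of "x - y"] by linarith
    then show "x = y" using int_dist_small[OF z] z by (simp add: min_def split: if_splits)
  qed
  show "circle_param r ` {0..<1} = circle_points r"
  proof (intro antisym subsetI)
    fix p assume "p \<in> circle_param r ` {0..<1}"
    then obtain x where "p = circle_param r x" by blast
    then show "p \<in> circle_points r"
      by (simp add: circle_points_def circle_param_def power_mult_distrib distrib_left[symmetric])
  next
    fix p assume "p \<in> circle_points r"
    then obtain a b where p: "p = (a, b)" "a\<^sup>2 + b\<^sup>2 = r\<^sup>2" by (auto simp: circle_points_def)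
    have "(a / r)\<^sup>2 + (b / r)\<^sup>2 = 1" using p r by (simp add: power_divide add_divide_distrib[symmetric])
    then obtain t where t: "0 \<le> t" "t < 2 * pi" "a / r = cos t" "b / r = sin t"
      using sincos_total_2pi by blast
    have "p = circle_param r (t / (2 * pi))" using p t r by (simp add: circle_param_def field_simps)
    moreover have "t / (2 * pi) \<in> {0..<1}" using t by (simp add: field_simps)
    ultimately show "p \<in> circle_param r ` {0..<1}" by blast
  qed
qed

lemma sin_chord_mono:
  assumes "0 < r" "0 \<le> s" "s \<le> 1/2" "0 \<le> t" "t \<le> 1/2"
  shows "2 * r * sin (pi * s) < 2 * r * sin (pi * t) \<longleftrightarrow> s < t"
proof -
  have *: "- (pi / 2) \<le> pi * x" "pi * x \<le> pi / 2" if "0 \<le> x" "x \<le> 1/2" for x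
  proof -
    show "pi * x \<le> pi / 2" using mult_left_mono[OF that(2), of pi] by simp
    have "0 \<le> pi * x" using that by simp
    then show "- (pi / 2) \<le> pi * x" using pi_ge_zero by linarith
  qed
  have "sin (pi * s) < sin (pi * t) \<longleftrightarrow> pi * s < pi * t"
    by (rule sin_mono_less_eq) (use * assms in auto)
  then show ?thesis using assms(1) by simp
qed

text \<open>For positive radius the substitution \<open>2 * r * sin (pi * t)\<close> turns arcs
  \<open>t \<le> 1/2\<close> into chords monotonically and carries the critical values to the ends
  of the bars. Nonpositive scales give the empty complex, and scales beyond the diameter the full
  simplex.\<close>

lemma circle_basis:
  assumes r0: "0 \<le> r"
  shows "\<exists>\<phi> :: nat \<Rightarrow> ((real \<times> real) list \<Rightarrow>\<^sub>0 'k::field) \<Rightarrow> 'k.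
    barcode_basis (vietoris_rips dist (circle_points r)) UNIV (arc_bar r) id \<phi>"
proof (cases "r = 0")
  case True
  then show ?thesis using point_basis by blast
next
  case False
  then have r: "0 < r" using r0 by simp
  let ?V = "circle_points r" and ?K = "vietoris_rips dist (circle_points r)"
  define ang where "ang = inv_into {0..<1} (circle_param r)"
  have bij: "bij_betw ang ?V {0..<1}" unfolding ang_def by (rule bij_betw_inv_into[OF bij_circle_param[OF r]])
  interpret circle_coords ?V ang by unfold_locales (rule bij)
  have param: "circle_param r (ang p) = p" if "p \<in> ?V" for p
    using that bij_circle_param[OF r] unfolding ang_def by (auto simp: bij_betw_def intro: f_inv_into_f)
  have cdr: "0 \<le> cd p q" "cd p q \<le> 1/2" for p q unfolding cd_def by (rule int_dist_range)+
  have dist: "dist p q = 2 * r * sin (pi * cd p q)" if "p \<in> ?V" "q \<in> ?V" for p q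
  proof -
    have "\<bar>ang p - ang q\<bar> < 1" using ang_range[OF that(1)] ang_range[OF that(2)] by auto
    then show ?thesis using dist_circle_param[of r "ang p" "ang q"] r param that by (simp add: abs_sin_int_dist cd_def)
  qed
  have near_dist: "dist p q < 2 * r * sin (pi * t) \<longleftrightarrow> near t p q"
    if "0 < t" "t \<le> 1/2" "p \<in> ?V" "q \<in> ?V" for t p q
    unfolding near_def dist[OF that(3,4)] by (rule sin_chord_mono) (use r cdr that in auto)
  have spos: "0 < 2 * r * sin (pi * t)" if "0 < t" "t \<le> 1/2" for t
    using r that sin_gt_zero[of "pi * t"] by simp
  have K: "?K (2 * r * sin (pi * t)) = cliques (near t) ?V - {{}}" if t: "0 < t" "t \<le> 1/2" for t
  proof -
    have "?K (2 * r * sin (pi * t)) = cliques (\<lambda>x y. dist x y < 2 * r * sin (pi * t)) ?V - {{}}"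
      by (rule vietoris_rips_cliques) (use spos[OF t] in simp)
    also have "cliques (\<lambda>x y. dist x y < 2 * r * sin (pi * t)) ?V = cliques (near t) ?V"
      by (intro antisym cliques_mono) (use near_dist[OF t] in auto)
    finally show ?thesis .
  qed
  have Kneg: "?K \<epsilon> = {}" if "\<epsilon> \<le> 0" for \<epsilon>
    by (rule vietoris_rips_empty) (use that in simp)
  have surj: "\<exists>t. 0 < t \<and> t \<le> 1/2 \<and> \<epsilon> = 2 * r * sin (pi * t)" if "0 < \<epsilon>" "\<epsilon> \<le> 2 * r" for \<epsilon>
  proof (intro exI conjI)
    let ?y = "\<epsilon> / (2 * r)"
    have y: "0 < ?y" "?y \<le> 1" using that r by (simp_all add: field_simps)
    show "0 < arcsin ?y / pi" using y arcsin_less_arcsin[of 0 ?y] by simp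
    show "arcsin ?y / pi \<le> 1/2" using y arcsin_ubound[of ?y] by (simp add: field_simps)
    show "\<epsilon> = 2 * r * sin (pi * (arcsin ?y / pi))" using y r by (simp add: sin_arcsin)
  qed
  have critr: "0 \<le> crit l" "crit l \<le> 1/2" for l using crit_nonneg crit_half[of l] by (auto simp: less_imp_le)
  have Jodd: "2 * r * sin (pi * t) \<in> arc_bar r (2 * l + 1) \<longleftrightarrow> crit l < t \<and> t \<le> crit (Suc l)"
    if "0 < t" "t \<le> 1/2" for t l
    unfolding arc_bar_odd greaterThanAtMost_iff not_less[symmetric]
    by (subst (1 2) sin_chord_mono) (use r that critr in auto)
  have Jpos: "0 < \<epsilon>" if "\<epsilon> \<in> arc_bar r m" for \<epsilon> m
  proof (cases m rule: nat_cases_parity)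
    case (2 l)
    have "0 \<le> 2 * r * sin (pi * crit l)" using r sin_ge_zero[of "pi * crit l"] critr[of l] by simp
    then show ?thesis using that unfolding 2 arc_bar_odd by simp
  qed (use that in \<open>auto simp: arc_bar_0 arc_bar_even\<close>)
  have Jle: "m = 0 \<or> \<epsilon> \<le> 2 * r" if "\<epsilon> \<in> arc_bar r m" for \<epsilon> m
  proof (cases m rule: nat_cases_parity)
    case (2 l)
    have "2 * r * sin (pi * crit (Suc l)) \<le> 2 * r * 1" using r by (intro mult_left_mono) auto
    then show ?thesis using that unfolding 2 arc_bar_odd by simp
  qed (use that in \<open>auto simp: arc_bar_0 arc_bar_even\<close>)
  obtain \<phi> :: "nat \<Rightarrow> ((real \<times> real) list \<Rightarrow>\<^sub>0 'k) \<Rightarrow> 'k" where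
    gr: "\<forall>m. graded_functional m (\<phi> m)" and \<phi>0: "\<phi> 0 = eps" and
    gd: "\<forall>l t. crit l < t \<longrightarrow> t \<le> crit (Suc l) \<longrightarrow> good (cliques (near t) ?V - {{}}) {0, 2 * l + 1} \<phi>" and
    gh: "good (cliques (near (1/2)) ?V - {{}}) {0} \<phi>" and
    van: "\<forall>l>0. \<forall>c\<in>chn (cliques (near (crit l)) ?V). \<phi> (2 * l + 1) c = 0"
    using circle_good by blast
  have lf: "linf (\<phi> m)" for m using gr by (simp add: graded_functional_def)
  define I where "I = (\<lambda>\<epsilon>. {m \<in> UNIV. \<epsilon> \<in> arc_bar r m})"
  have main: "good (?K \<epsilon>) (I \<epsilon>) \<phi> \<and> finite (I \<epsilon>)" for \<epsilon>
  proof -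
    consider "\<epsilon> \<le> 0" | "2 * r < \<epsilon>" | "0 < \<epsilon>" "\<epsilon> \<le> 2 * r" by linarith
    then show ?thesis
    proof cases
      case 1
      then have "I \<epsilon> = {}" using Jpos by (force simp: I_def)
      then show ?thesis using Kneg[OF 1] by (simp add: good_empty)
    next
      case 2
      then have "I \<epsilon> = {0}" using Jle r by (fastforce simp: I_def arc_bar_0)
      moreover have "dist p q < \<epsilon>" if "p \<in> ?V" "q \<in> ?V" for p q
      proof -
        have "2 * r * sin (pi * cd p q) \<le> 2 * r * 1" using r by (intro mult_left_mono) auto
        then show ?thesis using dist[OF that] 2 by simp
      qed
      moreover obtain p where "p \<in> ?V" using V_nonempty by blast
      ultimately show ?thesis using good_full[of p ?V dist \<epsilon> \<phi> 0] \<phi>0 by simp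
    next
      case 3
      then obtain t where t: "0 < t" "t \<le> 1/2" "\<epsilon> = 2 * r * sin (pi * t)" using surj by blast
      have I: "m \<in> I \<epsilon> \<longleftrightarrow> m = 0 \<or> (\<exists>l. m = 2 * l + 1 \<and> crit l < t \<and> t \<le> crit (Suc l))" for m
      proof (cases m rule: nat_cases_parity)
        case 1
        then show ?thesis using 3 by (simp add: I_def arc_bar_0)
      next
        case (2 l)
        then show ?thesis unfolding I_def t(3) using Jodd[OF t(1,2), of l] by auto
      next
        case 3
        then show ?thesis unfolding I_def by (auto simp: arc_bar_even)
      qed
      show ?thesis
      proof (cases "t = 1/2")
        \<comment> \<open>At the diameter itself antipodal points are not yet joined, so the complex
          is not a full simplex; but every odd bar has ended and only degree 0 is left.\<close>
        case True
        have "\<not> t \<le> crit (Suc l)" for l using crit_half[of "Suc l"] True by simp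
        then have "I \<epsilon> = {0}" using I by (intro Set.set_eqI) simp
        then show ?thesis using gh K[OF t(1,2)] t(3) True by simp
      next
        case False
        then obtain l where l: "crit l < t" "t \<le> crit (Suc l)" using crit_interval t by force
        then have "I \<epsilon> = {0, 2 * l + 1}" using I crit_interval_unique[OF l] by blast
        then show ?thesis using gd l K[OF t(1,2)] t(3) by simp
      qed
    qed
  qed
  have van': "\<phi> m c = 0" if "s \<le> t" "s \<notin> arc_bar r m" "t \<in> arc_bar r m" and c: "c \<in> chn (?K s)" for m s t c
  proof (cases "s \<le> 0")
    case True
    then show ?thesis using Kneg[OF True] c by (simp add: chn_empty klinearD(3)[OF lf])
  next
    case s0: False
    show ?thesis
    proof (cases m rule: nat_cases_parity)
      case (2 l)
      have s: "s \<le> 2 * r * sin (pi * crit l)" using that unfolding 2 arc_bar_odd by auto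
      then have "0 < l" using s0 by (cases l) (auto simp: crit_def)
      have c0: "0 < crit l" using \<open>0 < l\<close> by (simp add: crit_def)
      have "?K s \<subseteq> ?K (2 * r * sin (pi * crit l))"
        using s by (rule vietoris_rips_mono)
      also have "\<dots> \<subseteq> cliques (near (crit l)) ?V" using K[OF c0 critr(2)] by auto
      finally have "c \<in> chn (cliques (near (crit l)) ?V)" using chn_mono c by blast
      then show ?thesis using van \<open>0 < l\<close> 2 by blast
    qed (use that s0 in \<open>auto simp: arc_bar_0 arc_bar_even\<close>)
  qed
  show ?thesis
    unfolding barcode_basis_def using gr main simplicial_vietoris_rips van' by (intro exI[of _ \<phi>]) (auto simp: I_def)
qed

section \<open>Prisms and slant products\<close>

definition push :: "('a \<Rightarrow> 'b) \<Rightarrow> ('a list \<Rightarrow>\<^sub>0 'k::field) \<Rightarrow> ('b list \<Rightarrow>\<^sub>0 'k)" where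
  "push g = lext (\<lambda>xs. Poly_Mapping.single (map g xs) 1)"

lemma lin_push: "lin (push g)" by (simp add: push_def lin_lext)
lemmas push_lin = klinearD[OF lin_push]

lemma push_single [simp]: "push g (Poly_Mapping.single xs a) = Poly_Mapping.single (map g xs) a"
  by (simp add: push_def)

lemma push_push_cons: "push g (push_cons x c) = push_cons (g x) (push g c)"
  by (rule klinear_eqI[OF klinear_compose[OF lin_cons lin_push] klinear_compose[OF lin_push lin_cons] in_cspan_UNIV]) simp

lemma push_push: "push f (push g c) = push (f \<circ> g) c"
  by (rule klinear_eqI[OF klinear_compose[OF lin_push lin_push] lin_push in_cspan_UNIV]) simp

lemma bd_list_map: "bd_list (map g xs) = push g (bd_list xs)"
  by (induction xs) (simp_all add: push_lin push_push_cons)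

lemma bd_push: "bd (push g c) = push g (bd c)"
  by (rule klinear_eqI[OF klinear_compose[OF lin_push lin_bd] klinear_compose[OF lin_bd lin_push] in_cspan_UNIV])
    (simp add: bd_single bd_list_map push_lin)

lemma eps_push: "eps (push g c) = eps c"
  by (rule klinear_eqI[OF klinear_compose[OF lin_push linf_eps] linf_eps in_cspan_UNIV]) (simp add: eps_single)

lemma bdu_push: "bdu (push g c) = push g (bdu c)"
  by (simp add: bdu_def eps_push bd_push push_lin)

lemma push_chn: "c \<in> chn K \<Longrightarrow> (\<And>\<sigma>. \<sigma> \<in> K \<Longrightarrow> g ` \<sigma> \<in> K') \<Longrightarrow> push g c \<in> chn K'"
  unfolding chn_def by (rule lin_cspan[OF lin_push]) auto

lemma push_id_on: "c \<in> chn K \<Longrightarrow> (\<And>\<sigma> x. \<sigma> \<in> K \<Longrightarrow> x \<in> \<sigma> \<Longrightarrow> g x = x) \<Longrightarrow> push g c = c"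
  unfolding chn_def by (rule klinear_eqI[OF lin_push lin_id]) (auto intro!: arg_cong[of _ _ "\<lambda>xs. Poly_Mapping.single xs 1"] map_idI)

text \<open>The prism operator: the alternating sum of the tuples that follow \<open>f\<close> up to
  some vertex, repeat this vertex under \<open>g\<close>, and continue with
  \<open>g\<close>.\<close>

fun prism_list :: "('a \<Rightarrow> 'b) \<Rightarrow> ('a \<Rightarrow> 'b) \<Rightarrow> 'a list \<Rightarrow> ('b list \<Rightarrow>\<^sub>0 'k::field)" where
  "prism_list f g [] = 0"
| "prism_list f g (x # xs) = Poly_Mapping.single (f x # g x # map g xs) 1 - push_cons (f x) (prism_list f g xs)"

definition prism :: "('a \<Rightarrow> 'b) \<Rightarrow> ('a \<Rightarrow> 'b) \<Rightarrow> ('a list \<Rightarrow>\<^sub>0 'k::field) \<Rightarrow> ('b list \<Rightarrow>\<^sub>0 'k)" where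
  "prism f g = lext (prism_list f g)"

lemma lin_prism: "lin (prism f g)" by (simp add: prism_def lin_lext)
lemmas prism_lin = klinearD[OF lin_prism]

lemma prism_single: "prism f g (Poly_Mapping.single xs a) = scl a (prism_list f g xs)"
  by (simp add: prism_def)

lemma prism_push_cons: "prism f g (push_cons x c) = push_cons (f x) (push_cons (g x) (push g c)) - push_cons (f x) (prism f g c)"
  by (rule klinear_eqI[OF klinear_compose[OF lin_cons lin_prism]
        lin_diff[OF klinear_compose[OF klinear_compose[OF lin_push lin_cons] lin_cons] klinear_compose[OF lin_prism lin_cons]] in_cspan_UNIV])
    (simp add: prism_single)

lemma prism_homotopy_list:
  "bd (prism_list f g xs) + prism f g (bd_list xs) =
    Poly_Mapping.single (map g xs) 1 - Poly_Mapping.single (map f xs) (1 :: 'k::field)"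
proof (induction xs)
  case (Cons x xs)
  let ?P = "prism_list f g xs :: _ \<Rightarrow>\<^sub>0 'k" and ?d = "bd_list xs :: _ \<Rightarrow>\<^sub>0 'k"
  have G: "Poly_Mapping.single (f x # g x # map g xs) (1::'k) = push_cons (f x) (push_cons (g x) (Poly_Mapping.single (map g xs) 1))"
    by simp
  have bP: "bd (prism_list f g (x # xs)) =
      push_cons (g x) (Poly_Mapping.single (map g xs) (1::'k)) - push_cons (f x) (Poly_Mapping.single (map g xs) 1 - push_cons (g x) (push g ?d))
       - ?P + push_cons (f x) (bd ?P)"
    by (simp only: prism_list.simps G bd_lin bd_cons bd_single bd_list_map scl_simps) (simp add: cons_lin)
  have Pb: "prism f g (bd_list (x # xs)) =
      ?P - push_cons (f x) (push_cons (g x) (push g ?d)) + push_cons (f x) (prism f g ?d)"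
    by (simp add: prism_lin prism_single prism_push_cons)
  have "bd (prism_list f g (x # xs)) + prism f g (bd_list (x # xs)) =
      push_cons (g x) (Poly_Mapping.single (map g xs) 1) - push_cons (f x) (Poly_Mapping.single (map g xs) 1)
       + push_cons (f x) (bd ?P + prism f g ?d)"
    unfolding bP Pb by (simp add: cons_lin)
  also have "\<dots> = Poly_Mapping.single (map g (x # xs)) 1 - Poly_Mapping.single (map f (x # xs)) 1"
    unfolding Cons.IH by (simp add: cons_lin)
  finally show ?case .
qed (simp add: bd_lin prism_lin)

lemma prism_homotopy: "bd (prism f g c) + prism f g (bd c) = push g c - push f c"
  by (rule klinear_eqI[OF lin_add[OF klinear_compose[OF lin_prism lin_bd] klinear_compose[OF lin_bd lin_prism]]
        lin_diff[OF lin_push lin_push] in_cspan_UNIV])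
    (simp add: prism_single bd_single prism_homotopy_list)

lemma prism_list_cspan:
  "(prism_list f g xs :: 'b list \<Rightarrow>\<^sub>0 'k::field) \<in> cspan {ys. ys \<noteq> [] \<and> length ys \<noteq> 1 \<and> set ys \<subseteq> f ` set xs \<union> g ` set xs}"
proof (induction xs)
  case (Cons x xs)
  have "push_cons (f x) (prism_list f g xs :: 'b list \<Rightarrow>\<^sub>0 'k)
      \<in> cspan {ys. ys \<noteq> [] \<and> length ys \<noteq> 1 \<and> set ys \<subseteq> f ` set (x # xs) \<union> g ` set (x # xs)}"
    using Cons.IH by (rule cons_cspan) auto
  then show ?case by (auto intro!: cspan_closed)
qed auto

lemma eps_cspan_zero: "c \<in> cspan T \<Longrightarrow> (\<And>xs. xs \<in> T \<Longrightarrow> length xs \<noteq> 1) \<Longrightarrow> eps c = 0"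
  by (rule klinear_cspan_zero[OF linf_eps]) (auto simp: eps_single)

lemma eps_prism: "eps (prism f g c) = 0"
proof (rule eps_cspan_zero)
  show "prism f g c \<in> cspan {ys. length ys \<noteq> 1}"
    by (rule lin_cspan[OF lin_prism _ in_cspan_UNIV])
      (use prism_list_cspan[of f g] in \<open>auto simp: prism_single cspan_def\<close>)
qed auto

text \<open>A cycle for \<open>bdu\<close> may have nonzero augmentation, but then \<open>bd\<close>
  sends it to a multiple of the empty tuple, which the prism annihilates.\<close>

lemma prism_cycle:
  assumes "bdu c = 0"
  shows "push g c - push f c = bdu (prism f g c)"
proof -
  have "bd c = Poly_Mapping.single [] (eps c)" using assms by (simp add: bdu_def)
  then have "prism f g (bd c) = 0" by (simp add: prism_single)
  then show ?thesis using prism_homotopy[of f g c] by (simp add: bdu_def eps_prism)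
qed

lemma prism_chn:
  assumes "c \<in> chn K" "\<And>\<sigma> \<tau>. \<sigma> \<in> K \<Longrightarrow> \<tau> \<noteq> {} \<Longrightarrow> \<tau> \<subseteq> f ` \<sigma> \<union> g ` \<sigma> \<Longrightarrow> \<tau> \<in> K'"
  shows "prism f g c \<in> chn K'"
  unfolding chn_def
proof (rule lin_cspan[OF lin_prism])
  show "c \<in> cspan {xs. set xs \<in> K}" using assms(1) by (simp add: chn_def)
  fix xs assume "xs \<in> {xs. set xs \<in> K}"
  then have xs: "set xs \<in> K" by simp
  have "prism_list f g xs \<in> cspan {ys. set ys \<in> K'}"
    by (rule cspan_weaken[OF prism_list_cspan]) (use assms(2)[OF xs] in auto)
  then show "prism f g (Poly_Mapping.single xs 1) \<in> cspan {ys. set ys \<in> K'}"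
    by (simp add: prism_single)
qed

text \<open>Evaluating a cocycle of degree \<open>d\<close> on the second components of the back \<open>d\<close>-face and
  keeping the first components of the front face.\<close>

fun slant_list :: "('v \<Rightarrow> 'a) \<Rightarrow> ('v \<Rightarrow> 'b) \<Rightarrow> nat \<Rightarrow> (('b list \<Rightarrow>\<^sub>0 'k::field) \<Rightarrow> 'k) \<Rightarrow> 'v list \<Rightarrow> ('a list \<Rightarrow>\<^sub>0 'k)" where
  "slant_list p q d \<phi> [] = 0"
| "slant_list p q d \<phi> (z # zs) =
    (if length zs = d then Poly_Mapping.single [p z] (\<phi> (Poly_Mapping.single (map q (z # zs)) 1))
     else push_cons (p z) (slant_list p q d \<phi> zs))"

definition slant :: "('v \<Rightarrow> 'a) \<Rightarrow> ('v \<Rightarrow> 'b) \<Rightarrow> nat \<Rightarrow> (('b list \<Rightarrow>\<^sub>0 'k::field) \<Rightarrow> 'k) \<Rightarrow> ('v list \<Rightarrow>\<^sub>0 'k) \<Rightarrow> ('a list \<Rightarrow>\<^sub>0 'k)" where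
  "slant p q d \<phi> = lext (slant_list p q d \<phi>)"

lemma lin_slant: "lin (slant p q d \<phi>)" by (simp add: slant_def lin_lext)
lemmas slant_lin = klinearD[OF lin_slant]

lemma slant_single: "slant p q d \<phi> (Poly_Mapping.single zs a) = scl a (slant_list p q d \<phi> zs)"
  by (simp add: slant_def)

lemma slant_list_cspan:
  "slant_list p q d \<phi> zs \<in> cspan {xs. length xs + d = length zs \<and> xs \<noteq> [] \<and> set xs \<subseteq> p ` set zs}"
proof (induction zs)
  case (Cons z zs)
  have "push_cons (p z) (slant_list p q d \<phi> zs) \<in> cspan {xs. length xs + d = length (z # zs) \<and> xs \<noteq> [] \<and> set xs \<subseteq> p ` set (z # zs)}"
    using Cons.IH by (rule cons_cspan) auto
  then show ?case by (auto intro!: cspan_closed)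
qed auto

lemma slant_list_short: "length zs \<le> d \<Longrightarrow> slant_list p q d \<phi> zs = 0"
  by (induction zs) (auto simp: cons_lin)

lemma slant_short: "c \<in> cspan {zs. length zs \<le> d} \<Longrightarrow> slant p q d \<phi> c = 0"
  by (rule klinear_cspan_zero[OF lin_slant]) (auto simp: slant_single slant_list_short)

lemma slant_push_cons:
  assumes "c \<in> cspan {zs. length zs \<noteq> d}"
  shows "slant p q d \<phi> (push_cons z c) = push_cons (p z) (slant p q d \<phi> c)"
  by (rule klinear_eqI[OF klinear_compose[OF lin_cons lin_slant] klinear_compose[OF lin_slant lin_cons] assms])
    (simp add: slant_single)

lemma slant_push_cons_eq:
  assumes "c \<in> cspan {zs. length zs = d}" "linf \<phi>"
  shows "slant p q d \<phi> (push_cons z c) = Poly_Mapping.single [p z] (\<phi> (push_cons (q z) (push q c)))"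
  by (rule klinear_eqI[OF klinear_compose[OF lin_cons lin_slant]
        lin_single[OF klinear_compose[OF klinear_compose[OF lin_push lin_cons] assms(2)]] assms(1)])
    (simp add: slant_single)

lemma eps_slant_list:
  "length zs \<noteq> Suc d \<Longrightarrow> eps (slant_list p q d \<phi> zs) = 0"
  by (rule eps_cspan_zero[OF slant_list_cspan]) auto

lemma bd_list_length: "(bd_list xs :: 'a list \<Rightarrow>\<^sub>0 'k::field) \<in> cspan {ys. length xs = Suc (length ys)}"
  by (rule cspan_weaken[OF bd_list_cspan]) auto

text \<open>Deleting a vertex before the junction commutes with slanting. At the junction, where
  front and back face share a vertex, the cocycle condition on the last \<open>d + 2\<close>
  vertices supplies the face of the front part that is missing. No sign arises because the retained
  vertices come first and keep their places.\<close>

lemma bdu_slant_list: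
  assumes gr: "graded_functional d \<phi>"
    and "\<And>ys. set ys \<subseteq> set zs \<Longrightarrow> \<phi> (bd_list (map q ys)) = 0"
  shows "bdu (slant_list p q d \<phi> zs) = slant p q d \<phi> (bd_list zs)"
  using assms(2)
proof (induction zs)
  case Nil
  then show ?case by (simp add: bdu_lin slant_lin)
next
  case (Cons z ws)
  have lf: "linf \<phi>" using gr by (simp add: graded_functional_def)
  note bl = bd_list_length[of ws, where 'k = 'b]
  consider "length ws < d" | "length ws = d" | "length ws = Suc d" | "Suc d < length ws" by linarith
  then show ?case
  proof cases
    case 1
    have "bd_list (z # ws) \<in> (cspan {zs. length zs \<le> d} :: ('c list \<Rightarrow>\<^sub>0 'b) set)"
      using bd_list_length[of "z # ws", where 'k = 'b] 1 by (auto simp: cspan_def)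
    then show ?thesis using 1 slant_list_short[of "z # ws" d p q \<phi>] by (simp only: slant_short) (simp add: bdu_lin)
  next
    case 2
    have "bd_list (z # ws) \<in> (cspan {zs. length zs \<le> d} :: ('c list \<Rightarrow>\<^sub>0 'b) set)"
      using bd_list_length[of "z # ws", where 'k = 'b] 2 by (auto simp: cspan_def)
    then show ?thesis using 2 by (simp only: slant_short) (simp add: bdu_vertex)
  next
    \<comment> \<open>The only case that uses the cocycle condition: a tuple of \<open>d + 2\<close>
      vertices slants to an edge, whose boundary has to be matched.\<close>
    case 3
    then obtain w us where ws: "ws = w # us" "length us = d" by (cases ws) auto
    let ?a = "\<phi> (Poly_Mapping.single (map q ws) 1)"
    have "\<phi> (bd_list (map q (z # ws))) = 0" by (rule Cons.prems) simp
    then have coc: "\<phi> (push_cons (q z) (push q (bd_list ws))) = ?a"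
      by (simp add: klinearD[OF lf] bd_list_map)
    have s1: "slant_list p q d \<phi> (z # ws) = Poly_Mapping.single [p z, p w] ?a"
      using ws by simp
    have "bdu (slant_list p q d \<phi> (z # ws)) = Poly_Mapping.single [p w] ?a - Poly_Mapping.single [p z] ?a"
      unfolding s1 by (simp add: bdu_def eps_single bd_single cons_lin scl_distrib)
    moreover have "slant p q d \<phi> (push_cons z (bd_list ws)) = Poly_Mapping.single [p z] ?a"
      unfolding coc[symmetric] by (rule slant_push_cons_eq[OF _ lf]) (use bl 3 in \<open>auto simp: cspan_def\<close>)
    ultimately show ?thesis using ws by (simp add: slant_lin slant_single)
  next
    case 4
    have IH: "bdu (slant_list p q d \<phi> ws) = slant p q d \<phi> (bd_list ws)"
      by (rule Cons.IH) (rule Cons.prems, auto)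
    have "slant p q d \<phi> (push_cons z (bd_list ws)) = push_cons (p z) (slant p q d \<phi> (bd_list ws))"
      by (rule slant_push_cons) (use bl 4 in \<open>auto simp: cspan_def\<close>)
    moreover have "bdu (slant_list p q d \<phi> (z # ws)) = bd (slant_list p q d \<phi> (z # ws))"
      by (rule bdu_eq, rule eps_slant_list) (use 4 in simp)
    moreover have "bdu (slant_list p q d \<phi> ws) = bd (slant_list p q d \<phi> ws)"
      by (rule bdu_eq, rule eps_slant_list) (use 4 in simp)
    ultimately show ?thesis using 4 IH by (simp add: bd_cons slant_lin slant_single)
  qed
qed

lemma slant_bdu: "slant p q d \<phi> (bdu c) = slant p q d \<phi> (bd c)"
  by (simp add: bdu_def slant_lin slant_single)

section \<open>Products of simplicial complexes\<close>

text \<open>\<open>pr x\<close> embeds the second factor as the copy lying over \<open>x\<close>;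
  contracting a product with a simplex means moving all points into such a copy.\<close>

locale product_vertices =
  fixes V :: "'v set" and p :: "'v \<Rightarrow> 'a" and q :: "'v \<Rightarrow> 'b" and A :: "'a set" and B :: "'b set"
    and pr :: "'a \<Rightarrow> 'b \<Rightarrow> 'v"
  assumes pr: "x \<in> A \<Longrightarrow> y \<in> B \<Longrightarrow> pr x y \<in> V" "x \<in> A \<Longrightarrow> y \<in> B \<Longrightarrow> p (pr x y) = x"
    "x \<in> A \<Longrightarrow> y \<in> B \<Longrightarrow> q (pr x y) = y"
begin

definition prod_complex :: "'a set set \<Rightarrow> 'b set set \<Rightarrow> 'v set set" where
  "prod_complex K L = {\<sigma>. \<sigma> \<noteq> {} \<and> finite \<sigma> \<and> \<sigma> \<subseteq> V \<and> p ` \<sigma> \<in> K \<and> q ` \<sigma> \<in> L}"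

lemma prod_complexD:
  assumes "\<sigma> \<in> prod_complex K L"
  shows "\<sigma> \<noteq> {}" "finite \<sigma>" "\<sigma> \<subseteq> V" "p ` \<sigma> \<in> K" "q ` \<sigma> \<in> L"
  using assms by (simp_all add: prod_complex_def)

lemma prod_complexI:
  "\<sigma> \<noteq> {} \<Longrightarrow> finite \<sigma> \<Longrightarrow> \<sigma> \<subseteq> V \<Longrightarrow> p ` \<sigma> \<in> K \<Longrightarrow> q ` \<sigma> \<in> L \<Longrightarrow> \<sigma> \<in> prod_complex K L"
  by (simp add: prod_complex_def)

lemma simplicial_prod_complex:
  assumes "simplicial K" "simplicial L"
  shows "simplicial (prod_complex K L)"
proof (rule simplicialI)
  fix \<sigma> \<tau> assume \<sigma>: "\<sigma> \<in> prod_complex K L" and \<tau>: "\<tau> \<subseteq> \<sigma>" "\<tau> \<noteq> {}"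
  note * = prod_complexD[OF \<sigma>]
  show "\<tau> \<in> prod_complex K L"
  proof (rule prod_complexI)
    show "finite \<tau>" "\<tau> \<subseteq> V" using * \<tau> finite_subset by auto
    show "p ` \<tau> \<in> K" by (rule simplicialD(3)[OF assms(1) *(4)]) (use \<tau> in auto)
    show "q ` \<tau> \<in> L" by (rule simplicialD(3)[OF assms(2) *(5)]) (use \<tau> in auto)
  qed (rule \<tau>(2))
qed (use prod_complexD in blast)

lemma slant_chn:
  assumes K: "simplicial K" and c: "c \<in> chn (prod_complex K L)"
  shows "slant p q d \<psi> c \<in> chn K"
  unfolding chn_def
proof (rule lin_cspan[OF lin_slant])
  show "c \<in> cspan {zs. set zs \<in> prod_complex K L}" using c by (simp add: chn_def)
  fix zs assume "zs \<in> {zs. set zs \<in> prod_complex K L}"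
  then have "p ` set zs \<in> K" using prod_complexD(4) by blast
  then have "slant_list p q d \<psi> zs \<in> cspan {xs. set xs \<in> K}"
    by (intro cspan_weaken[OF slant_list_cspan]) (use simplicialD(3)[OF K] in auto)
  then show "slant p q d \<psi> (Poly_Mapping.single zs 1) \<in> cspan {xs. set xs \<in> K}" by (simp add: slant_single)
qed

section \<open>Comparing a product with copies of its first factor\<close>

context
  fixes L :: "'b set set" and I :: "'i set" and \<phi> :: "'i \<Rightarrow> ('b list \<Rightarrow>\<^sub>0 'k::field) \<Rightarrow> 'k" and deg :: "'i \<Rightarrow> nat"
  assumes L: "simplicial L" "\<And>\<sigma>. \<sigma> \<in> L \<Longrightarrow> \<sigma> \<subseteq> B" and finI: "finite I"
    and gd: "good L I \<phi>" and gr: "\<And>i. i \<in> I \<Longrightarrow> graded_functional (deg i) (\<phi> i)"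
begin

definition slant_by :: "'i \<Rightarrow> ('v list \<Rightarrow>\<^sub>0 'k) \<Rightarrow> ('a list \<Rightarrow>\<^sub>0 'k)" where
  "slant_by i = slant p q (deg i) (\<phi> i)"

lemma lin_slant_by: "lin (slant_by i)" by (simp add: slant_by_def lin_slant)
lemmas slant_by_lin = klinearD[OF lin_slant_by]

lemma lin_\<phi>: "i \<in> I \<Longrightarrow> linf (\<phi> i)" using gr by (simp add: graded_functional_def)

lemma slant_by_chn: "simplicial K \<Longrightarrow> c \<in> chn (prod_complex K L) \<Longrightarrow> slant_by i c \<in> chn K"
  unfolding slant_by_def by (rule slant_chn)

lemma bdu_slant_by:
  assumes i: "i \<in> I" and c: "c \<in> chn (prod_complex K L)"
  shows "bdu (slant_by i c) = slant_by i (bdu c)"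
proof -
  have "bdu (slant_by i c) = slant_by i (bd c)"
  proof (rule klinear_eqI[OF klinear_compose[OF lin_slant_by lin_bdu] klinear_compose[OF lin_bd lin_slant_by] c[unfolded chn_def]])
    fix zs assume "zs \<in> {zs. set zs \<in> prod_complex K L}"
    then have zs: "q ` set zs \<in> L" using prod_complexD(5) by blast
    have "\<phi> i (bd_list (map q ys)) = 0" if "set ys \<subseteq> set zs" for ys
    proof (cases "ys = []")
      case False
      have "q ` set ys \<in> L" by (rule simplicialD(3)[OF L(1) zs]) (use that False in auto)
      then have "Poly_Mapping.single (map q ys) 1 \<in> chn L" by (intro chn_closed) simp
      then have "\<phi> i (bdu (Poly_Mapping.single (map q ys) 1)) = 0" by (rule goodD(1)[OF gd i])
      then show ?thesis
        using graded_functional_lookup_Nil[OF gr[OF i]]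
        by (simp add: bdu_def bd_single klinearD[OF lin_\<phi>[OF i]])
    qed (simp add: klinearD[OF lin_\<phi>[OF i]])
    then show "bdu (slant_by i (Poly_Mapping.single zs 1)) = slant_by i (bd (Poly_Mapping.single zs 1))"
      using bdu_slant_list[OF gr[OF i], of zs q p] by (simp add: slant_by_def slant_single bd_single)
  qed
  then show ?thesis by (simp add: slant_by_def slant_bdu)
qed

text \<open>The augmentation sees only those tuples whose front face is a single vertex, and for
  these the slant product is just the value of the cocycle on the whole tuple.\<close>

lemma \<phi>_push:
  assumes i: "i \<in> I"
  shows "\<phi> i (push q c) = eps (slant_by i c)"
proof (rule klinear_eqI[OF klinear_compose[OF lin_push lin_\<phi>[OF i]] klinear_compose[OF lin_slant_by linf_eps] in_cspan_UNIV])
  fix zs :: "'v list"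
  have lf: "linf (\<phi> i)" by (rule lin_\<phi>[OF i])
  show "\<phi> i (push q (Poly_Mapping.single zs 1)) = eps (slant_by i (Poly_Mapping.single zs 1))"
  proof (cases "length zs = Suc (deg i)")
    case True
    then obtain w ws where "zs = w # ws" "length ws = deg i" by (cases zs) auto
    then show ?thesis by (simp add: slant_by_def slant_single eps_single)
  next
    case False
    then have "\<phi> i (push q (Poly_Mapping.single zs 1)) = 0"
      using gr[OF i] by (simp add: graded_functional_def)
    then show ?thesis using eps_slant_list[OF False] by (simp add: slant_by_def slant_single)
  qed
qed

text \<open>Acyclicity of the mapping cone of \<open>slant_by\<close>, which is a chain map into the direct sum of shifted
  copies of the chains of \<open>K\<close> indexed by \<open>I\<close>.\<close>

definition cone_acyclic :: "'a set set \<Rightarrow> bool" where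
  "cone_acyclic K \<longleftrightarrow> (\<forall>c\<in>chn (prod_complex K L). \<forall>d. (\<forall>i\<in>I. d i \<in> chn K) \<longrightarrow> bdu c = 0 \<longrightarrow> (\<forall>i\<in>I. slant_by i c = bdu (d i)) \<longrightarrow>
     (\<exists>c'\<in>chn (prod_complex K L). \<exists>e. bdu c' = c \<and> (\<forall>i\<in>I. e i \<in> chn K \<and> slant_by i c' - d i = bdu (e i))))"

lemma cone_acyclicD:
  assumes "cone_acyclic K" "c \<in> chn (prod_complex K L)" "\<And>i. i \<in> I \<Longrightarrow> d i \<in> chn K" "bdu c = 0"
    "\<And>i. i \<in> I \<Longrightarrow> slant_by i c = bdu (d i)"
  shows "\<exists>c' e. c' \<in> chn (prod_complex K L) \<and> bdu c' = c \<and> (\<forall>i\<in>I. e i \<in> chn K \<and> slant_by i c' - d i = bdu (e i))"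
proof -
  have "\<exists>c'\<in>chn (prod_complex K L). \<exists>e. bdu c' = c \<and> (\<forall>i\<in>I. e i \<in> chn K \<and> slant_by i c' - d i = bdu (e i))"
    using assms(1)[unfolded cone_acyclic_def, rule_format, OF assms(2), of d] assms(3-) by simp
  then show ?thesis by auto
qed

lemma cone_acyclicI:
  assumes "\<And>c d. c \<in> chn (prod_complex K L) \<Longrightarrow> (\<And>i. i \<in> I \<Longrightarrow> d i \<in> chn K) \<Longrightarrow> bdu c = 0 \<Longrightarrow>
    (\<And>i. i \<in> I \<Longrightarrow> slant_by i c = bdu (d i)) \<Longrightarrow>
    \<exists>c'\<in>chn (prod_complex K L). \<exists>e. bdu c' = c \<and> (\<forall>i\<in>I. e i \<in> chn K \<and> slant_by i c' - d i = bdu (e i))"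
  shows "cone_acyclic K"
  using assms unfolding cone_acyclic_def by blast

lemma prod_complex_Un: "prod_complex (K \<union> M) L = prod_complex K L \<union> prod_complex M L"
  and prod_complex_Int: "prod_complex (K \<inter> M) L = prod_complex K L \<inter> prod_complex M L"
  by (auto simp: prod_complex_def)

text \<open>Mayer-Vietoris for mapping cones. After splitting along \<open>K\<close> and
  \<open>M\<close>, the pair of \<open>w\<close> and \<delta> is the connecting cycle: by either of
  its two descriptions it lies in one of the complexes, hence in both. Filling it over
  \<open>K \<inter> M\<close> turns the two halves into cone cycles over \<open>K\<close> and over
  \<open>M\<close>, which are filled separately.\<close>

lemma cone_acyclic_Un:
  assumes K: "simplicial K" and M: "simplicial M"
    and cK: "cone_acyclic K" and cM: "cone_acyclic M" and cI: "cone_acyclic (K \<inter> M)"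
  shows "cone_acyclic (K \<union> M)"
proof (rule cone_acyclicI)
  fix c :: "'v list \<Rightarrow>\<^sub>0 'k" and d :: "'i \<Rightarrow> ('a list \<Rightarrow>\<^sub>0 'k)"
  assume c: "c \<in> chn (prod_complex (K \<union> M) L)" and d: "\<And>i. i \<in> I \<Longrightarrow> d i \<in> chn (K \<union> M)"
    and bc: "bdu c = 0" and Sc: "\<And>i. i \<in> I \<Longrightarrow> slant_by i c = bdu (d i)"
  obtain a s where as: "a \<in> chn (prod_complex K L)" "s \<in> chn (prod_complex M L)" "c = a + s"
    using c unfolding prod_complex_Un by (rule chn_Un_split)
  have "\<forall>i\<in>I. \<exists>x y. x \<in> chn K \<and> y \<in> chn M \<and> d i = x + y"
    using d by (meson chn_Un_split)
  then obtain da ds where dd: "\<And>i. i \<in> I \<Longrightarrow> da i \<in> chn K \<and> ds i \<in> chn M \<and> d i = da i + ds i" by metis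
  define w where "w = bdu s"
  define \<delta> where "\<delta> = (\<lambda>i. slant_by i s - bdu (ds i))"
  have w': "w = - bdu a" using bc as(3) by (simp add: w_def bdu_lin eq_neg_iff_add_eq_0 add.commute)
  have \<delta>': "\<delta> i = bdu (da i) - slant_by i a" if "i \<in> I" for i
    using Sc[OF that] dd[OF that] as(3) by (simp add: \<delta>_def bdu_lin slant_by_lin algebra_simps)
  have "w \<in> chn (prod_complex M L)" unfolding w_def
    by (rule bdu_chn[OF simplicial_prod_complex[OF M L(1)] as(2)])
  moreover have "w \<in> chn (prod_complex K L)" unfolding w'
    by (intro chn_closed bdu_chn[OF simplicial_prod_complex[OF K L(1)] as(1)])
  ultimately have wI: "w \<in> chn (prod_complex (K \<inter> M) L)" by (simp add: prod_complex_Int chn_Int)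
  have \<delta>I: "\<delta> i \<in> chn (K \<inter> M)" if i: "i \<in> I" for i
  proof -
    have "\<delta> i \<in> chn M" unfolding \<delta>_def
      using slant_by_chn[OF M as(2)] bdu_chn[OF M] dd[OF i] by (intro chn_closed) auto
    moreover have "\<delta> i \<in> chn K" unfolding \<delta>'[OF i]
      using slant_by_chn[OF K as(1)] bdu_chn[OF K] dd[OF i] by (intro chn_closed) auto
    ultimately show ?thesis by (simp add: chn_Int)
  qed
  have Sw: "slant_by i w = bdu (\<delta> i)" if "i \<in> I" for i
    unfolding w_def \<delta>_def using bdu_slant_by[OF that as(2)] by (simp add: bdu_lin)
  have bw: "bdu w = 0" by (simp add: w_def)
  obtain e f where e: "e \<in> chn (prod_complex (K \<inter> M) L)" "bdu e = w"
    "\<forall>i\<in>I. f i \<in> chn (K \<inter> M) \<and> slant_by i e - \<delta> i = bdu (f i)"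
    using cone_acyclicD[OF cI wI, of \<delta>, OF \<delta>I bw Sw] by auto
  have eK: "e \<in> chn (prod_complex K L)" and eM: "e \<in> chn (prod_complex M L)"
    using e(1) by (simp_all add: prod_complex_Int chn_Int)
  have f: "f i \<in> chn K" "f i \<in> chn M" "slant_by i e = \<delta> i + bdu (f i)" if "i \<in> I" for i
    using e(3) that by (auto simp: chn_Int algebra_simps)
  have s1: "s - e \<in> chn (prod_complex M L)" using as eM by blast
  have s2: "ds i - f i \<in> chn M" if "i \<in> I" for i using dd f that by blast
  have s3: "bdu (s - e) = 0" by (simp add: bdu_lin e(2) w_def)
  have s4: "slant_by i (s - e) = bdu (ds i - f i)" if "i \<in> I" for i
    by (simp add: slant_by_lin f(3)[OF that] bdu_lin \<delta>_def)
  obtain s' es where s': "s' \<in> chn (prod_complex M L)" "bdu s' = s - e"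
    "\<forall>i\<in>I. es i \<in> chn M \<and> slant_by i s' - (ds i - f i) = bdu (es i)"
    using cone_acyclicD[OF cM s1, of "\<lambda>i. ds i - f i", OF s2 s3 s4] by auto
  have a1: "a + e \<in> chn (prod_complex K L)" using as eK by blast
  have a2: "da i + f i \<in> chn K" if "i \<in> I" for i using dd f that by blast
  have a3: "bdu (a + e) = 0" by (simp add: bdu_lin e(2) w')
  have a4: "slant_by i (a + e) = bdu (da i + f i)" if "i \<in> I" for i
    by (simp add: slant_by_lin f(3)[OF that] bdu_lin \<delta>'[OF that])
  obtain a' ea where a': "a' \<in> chn (prod_complex K L)" "bdu a' = a + e"
    "\<forall>i\<in>I. ea i \<in> chn K \<and> slant_by i a' - (da i + f i) = bdu (ea i)"
    using cone_acyclicD[OF cK a1, of "\<lambda>i. da i + f i", OF a2 a3 a4] by auto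
  have Kc: "chn K \<subseteq> (chn (K \<union> M) :: ('a list \<Rightarrow>\<^sub>0 'k) set)" "chn M \<subseteq> (chn (K \<union> M) :: ('a list \<Rightarrow>\<^sub>0 'k) set)"
    "chn (prod_complex K L) \<subseteq> (chn (prod_complex (K \<union> M) L) :: ('v list \<Rightarrow>\<^sub>0 'k) set)"
    "chn (prod_complex M L) \<subseteq> (chn (prod_complex (K \<union> M) L) :: ('v list \<Rightarrow>\<^sub>0 'k) set)"
    by (intro chn_mono; simp add: prod_complex_Un)+
  show "\<exists>c'\<in>chn (prod_complex (K \<union> M) L). \<exists>e. bdu c' = c \<and> (\<forall>i\<in>I. e i \<in> chn (K \<union> M) \<and> slant_by i c' - d i = bdu (e i))"
  proof (intro bexI exI conjI ballI)
    show "bdu (a' + s') = c" using a' s' as by (simp add: bdu_lin)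
    show "a' + s' \<in> chn (prod_complex (K \<union> M) L)" using a'(1) s'(1) Kc by blast
    fix i assume i: "i \<in> I"
    show "ea i + es i \<in> chn (K \<union> M)" using a'(3) s'(3) Kc i by blast
    have "slant_by i a' - (da i + f i) = bdu (ea i)" "slant_by i s' - (ds i - f i) = bdu (es i)" using a'(3) s'(3) i by auto
    then show "slant_by i (a' + s') - d i = bdu (ea i + es i)"
      using dd[OF i] by (simp add: slant_by_lin bdu_lin algebra_simps)
  qed
qed

lemma cone_acyclic_empty: "cone_acyclic {}"
proof -
  have "prod_complex {} L = {}" by (auto simp: prod_complex_def)
  then show ?thesis by (intro cone_acyclicI) (auto simp: chn_empty bdu_lin slant_by_lin intro!: exI[of _ "\<lambda>_. 0"])
qed

text \<open>The product with a simplex retracts onto the copy of \<open>L\<close> over one vertex,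
  where homology is detected by the cocycles; on the other side a simplex has homology in degree 0
  only, which the augmentation detects.\<close>

lemma cone_acyclic_simplex:
  assumes \<sigma>: "finite \<sigma>" "\<sigma> \<noteq> {}" "\<sigma> \<subseteq> A"
  shows "cone_acyclic (Pow \<sigma> - {{}})"
proof (rule cone_acyclicI)
  let ?K = "Pow \<sigma> - {{}}"
  fix c :: "'v list \<Rightarrow>\<^sub>0 'k" and d :: "'i \<Rightarrow> ('a list \<Rightarrow>\<^sub>0 'k)"
  assume c: "c \<in> chn (prod_complex ?K L)" and d: "\<And>i. i \<in> I \<Longrightarrow> d i \<in> chn ?K"
    and bc: "bdu c = 0" and Sc: "\<And>i. i \<in> I \<Longrightarrow> slant_by i c = bdu (d i)"
  obtain x0 where x0: "x0 \<in> \<sigma>" using \<sigma> by blast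
  then have x0A: "x0 \<in> A" using \<sigma> by blast
  have K: "simplicial ?K" by (rule simplicialI) (use \<sigma> finite_subset in auto)
  let ?s = "pr x0"
  have push_s: "push ?s y \<in> chn (prod_complex ?K L)" if "y \<in> chn L" for y :: "'b list \<Rightarrow>\<^sub>0 'k"
  proof (rule push_chn[OF that])
    fix \<tau> assume \<tau>: "\<tau> \<in> L"
    then have B: "\<tau> \<subseteq> B" and fin: "finite \<tau>" and ne: "\<tau> \<noteq> {}" using L(2) simplicialD(1,2)[OF L(1)] by auto
    have "q ` ?s ` \<tau> = \<tau>" unfolding image_image using B pr(3)[OF x0A] by force
    moreover have "p ` ?s ` \<tau> = {x0}" unfolding image_image using B ne pr(2)[OF x0A] by force
    moreover have "?s ` \<tau> \<subseteq> V" using B pr(1)[OF x0A] by blast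
    ultimately show "?s ` \<tau> \<in> prod_complex ?K L" using \<tau> fin ne x0 by (intro prod_complexI) auto
  qed
  have qL: "push q c \<in> chn L" by (rule push_chn[OF c]) (rule prod_complexD)
  have "bdu (push q c) = 0" by (simp add: bdu_push bc push_lin)
  moreover have "\<phi> i (push q c) = 0" if "i \<in> I" for i by (simp add: \<phi>_push[OF that] Sc[OF that])
  ultimately obtain b where b: "b \<in> chn L" "push q c = bdu b" using goodD(2)[OF gd qL] by blast
  have q_s: "q (?s (q v)) = q v" "?s (q v) \<in> V" "p (?s (q v)) = x0" if "\<tau> \<in> prod_complex ?K L" "v \<in> \<tau>" for \<tau> v
    using prod_complexD(5)[OF that(1)] L(2) that(2) pr[OF x0A] by blast+
  have pc: "prism (?s \<circ> q) (\<lambda>v. v) c \<in> chn (prod_complex ?K L)"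
  proof (rule prism_chn[OF c])
    fix \<tau> \<rho> assume \<tau>: "\<tau> \<in> prod_complex ?K L" and \<rho>: "\<rho> \<noteq> {}" "\<rho> \<subseteq> (?s \<circ> q) ` \<tau> \<union> (\<lambda>v. v) ` \<tau>"
    note * = prod_complexD[OF \<tau>]
    show "\<rho> \<in> prod_complex ?K L"
    proof (rule prod_complexI[OF \<rho>(1)])
      show "finite \<rho>" using *(2) \<rho>(2) finite_subset by blast
      show "\<rho> \<subseteq> V" using *(3) \<rho>(2) q_s[OF \<tau>] by fastforce
      have "p ` \<rho> \<subseteq> \<sigma>" using *(4) \<rho>(2) q_s[OF \<tau>] x0 by fastforce
      then show "p ` \<rho> \<in> ?K" using \<rho>(1) by blast
      have "q ` \<rho> \<subseteq> q ` \<tau>" using \<rho>(2) q_s[OF \<tau>] by fastforce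
      then show "q ` \<rho> \<in> L" by (rule simplicialD(3)[OF L(1) *(5)]) (use \<rho> in auto)
    qed
  qed
  \<comment> \<open>The prism fills the difference of \<open>c\<close> and its image over
    \<open>x0\<close>; \<open>push ?s b\<close> fills the image.\<close>
  define c1 where "c1 = push ?s b + prism (?s \<circ> q) (\<lambda>v. v) c"
  have c1: "c1 \<in> chn (prod_complex ?K L)" unfolding c1_def using push_s[OF b(1)] pc by blast
  have "push (\<lambda>v. v) c = c" by (rule push_id_on[OF c]) simp
  then have bc1: "bdu c1 = c"
    using prism_cycle[OF bc, of "\<lambda>v. v" "?s \<circ> q"] b(2) push_push[of ?s q c]
    by (simp add: c1_def bdu_lin bdu_push algebra_simps)
  \<comment> \<open>A cycle over \<open>x0\<close> corrects the augmentations of all slant products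
    at once. What remains are cycles of augmentation 0 in the simplex, and coning from
    \<open>x0\<close> fills them.\<close>
  obtain \<zeta> where \<zeta>: "\<zeta> \<in> chn L" "bdu \<zeta> = 0" "\<forall>i\<in>I. \<phi> i \<zeta> = - eps (slant_by i c1 - d i)"
    using goodD(3)[OF gd, of "\<lambda>i. - eps (slant_by i c1 - d i)"] by auto
  define c' where "c' = c1 + push ?s \<zeta>"
  have c': "c' \<in> chn (prod_complex ?K L)" unfolding c'_def using c1 push_s[OF \<zeta>(1)] by blast
  have bc': "bdu c' = c" by (simp add: c'_def bdu_lin bdu_push bc1 \<zeta>(2) push_lin)
  have rest: "push_cons x0 (slant_by i c' - d i) \<in> chn ?K \<and> slant_by i c' - d i = bdu (push_cons x0 (slant_by i c' - d i))" if i: "i \<in> I" for i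
  proof
    let ?e = "slant_by i c' - d i"
    have e: "?e \<in> chn ?K" using slant_by_chn[OF K c'] d[OF i] by blast
    show "push_cons x0 ?e \<in> chn ?K" by (rule cons_chn[OF e]) (use x0 in auto)
    have "push q (push ?s \<zeta>) = \<zeta>"
      unfolding push_push by (rule push_id_on[OF \<zeta>(1)]) (use L(2) pr(3)[OF x0A] in auto)
    then have "eps (slant_by i (push ?s \<zeta>)) = \<phi> i \<zeta>" using \<phi>_push[OF i, of "push ?s \<zeta>"] by simp
    then have "eps ?e = 0" using \<zeta>(3) i by (simp add: c'_def slant_by_lin eps_lin)
    moreover have "bdu ?e = 0" using bdu_slant_by[OF i c'] by (simp add: bdu_lin bc' Sc[OF i])
    ultimately have "bd ?e = 0" by (simp add: bdu_def)
    then have be: "bd (push_cons x0 ?e) = ?e" by (simp only: bd_cons cons_lin(3) diff_zero)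
    moreover have "eps (push_cons x0 ?e) = 0"
      using chn_Nil_free[OF _ e] by (simp add: eps_def be)
    ultimately show "?e = bdu (push_cons x0 ?e)" by (simp add: bdu_def)
  qed
  show "\<exists>c'\<in>chn (prod_complex ?K L). \<exists>e. bdu c' = c \<and> (\<forall>i\<in>I. e i \<in> chn ?K \<and> slant_by i c' - d i = bdu (e i))"
    using c' bc' rest by (intro bexI[of _ c'] exI[of _ "\<lambda>i. push_cons x0 (slant_by i c' - d i)"]) auto
qed

text \<open>Taking away a maximal simplex leaves a complex; this, the full simplex and their
  intersection are the pieces of the Mayer-Vietoris argument, and the first and third have fewer
  simplices than \<open>K\<close>.\<close>

lemma cone_acyclic_finite:
  assumes "simplicial K" "finite K" "\<And>\<sigma>. \<sigma> \<in> K \<Longrightarrow> \<sigma> \<subseteq> A"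
  shows "cone_acyclic K"
  using assms
proof (induction "card K" arbitrary: K rule: less_induct)
  case less
  note K = less.prems(1) and finK = less.prems(2) and KA = less.prems(3)
  show ?case
  proof (cases "K = {}")
    case True
    then show ?thesis by (simp add: cone_acyclic_empty)
  next
    case False
    then obtain \<sigma> where \<sigma>: "\<sigma> \<in> K" "\<And>\<tau>. \<tau> \<in> K \<Longrightarrow> \<sigma> \<subseteq> \<tau> \<Longrightarrow> \<tau> = \<sigma>"
      using finite_has_maximal[OF finK] by metis
    let ?K' = "K - {\<sigma>}" and ?M = "Pow \<sigma> - {{}}"
    have fin: "finite \<sigma>" "\<sigma> \<noteq> {}" using simplicialD(1,2)[OF K] \<sigma> by auto
    have M: "simplicial ?M" by (rule simplicialI) (use fin finite_subset in auto)
    have ne: "\<tau> \<noteq> {} \<and> finite \<tau>" if "\<tau> \<in> K" for \<tau> using simplicialD(1,2)[OF K] that by auto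
    have K': "simplicial ?K'"
    proof (rule simplicialI)
      fix \<tau> \<rho> assume t: "\<tau> \<in> ?K'" "\<rho> \<subseteq> \<tau>" "\<rho> \<noteq> {}"
      then have "\<rho> \<in> K" using simplicialD(3)[OF K] by blast
      moreover have "\<rho> \<noteq> \<sigma>" using \<sigma>(2)[of \<tau>] t by auto
      ultimately show "\<rho> \<in> ?K'" by blast
    qed (use ne in auto)
    have MK: "?M \<subseteq> K" using simplicialD(3)[OF K \<sigma>(1)] by blast
    have I: "simplicial (?K' \<inter> ?M)"
    proof (rule simplicialI)
      fix \<tau> \<rho> assume t: "\<tau> \<in> ?K' \<inter> ?M" "\<rho> \<subseteq> \<tau>" "\<rho> \<noteq> {}"
      then have "\<rho> \<in> ?K'" using simplicialD(3)[OF K'] by blast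
      then show "\<rho> \<in> ?K' \<inter> ?M" using t by blast
    qed (use ne in auto)
    have lt: "card ?K' < card K" using \<sigma>(1) finK by (intro psubset_card_mono) auto
    have "card (?K' \<inter> ?M) \<le> card ?K'" using finK by (intro card_mono) auto
    then have lt2: "card (?K' \<inter> ?M) < card K" using lt by simp
    have c1: "cone_acyclic ?K'" by (rule less.hyps[OF lt K']) (use finK KA in auto)
    have c2: "cone_acyclic (?K' \<inter> ?M)" by (rule less.hyps[OF lt2 I]) (use finK KA in auto)
    have c3: "cone_acyclic ?M" by (rule cone_acyclic_simplex[OF fin KA[OF \<sigma>(1)]])
    have "?K' \<union> ?M = K" using MK \<sigma>(1) fin by auto
    then show ?thesis using cone_acyclic_Un[OF K' M c1 c3 c2] by simp
  qed
qed

text \<open>As \<open>I\<close> is finite, a cone cycle involves finitely many simplices of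
  \<open>K\<close>. It is filled over the finite subcomplex \<open>F\<close> that they
  generate.\<close>

lemma cone_acyclic_all:
  assumes K: "simplicial K" and KA: "\<And>\<sigma>. \<sigma> \<in> K \<Longrightarrow> \<sigma> \<subseteq> A"
  shows "cone_acyclic K"
proof (rule cone_acyclicI)
  fix c :: "'v list \<Rightarrow>\<^sub>0 'k" and d :: "'i \<Rightarrow> ('a list \<Rightarrow>\<^sub>0 'k)"
  assume c: "c \<in> chn (prod_complex K L)" and d: "\<And>i. i \<in> I \<Longrightarrow> d i \<in> chn K"
    and bc: "bdu c = 0" and Sc: "\<And>i. i \<in> I \<Longrightarrow> slant_by i c = bdu (d i)"
  define G where "G = (\<lambda>zs. p ` set zs) ` Poly_Mapping.keys c \<union> (\<Union>i\<in>I. set ` Poly_Mapping.keys (d i))"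
  define F where "F = (\<Union>\<tau>\<in>G. Pow \<tau> - {{}})"
  have GK: "G \<subseteq> K"
  proof
    fix \<tau> assume "\<tau> \<in> G"
    then consider zs where "zs \<in> Poly_Mapping.keys c" "\<tau> = p ` set zs"
      | i xs where "i \<in> I" "xs \<in> Poly_Mapping.keys (d i)" "\<tau> = set xs"
      unfolding G_def by blast
    then show "\<tau> \<in> K"
    proof cases
      case 1
      then have "set zs \<in> prod_complex K L" using c by (auto simp: chn_def cspan_def)
      then show ?thesis using 1 prod_complexD(4) by blast
    next
      case 2
      then show ?thesis using d[of i] by (auto simp: chn_def cspan_def)
    qed
  qed
  have finG: "finite G" using finI by (simp add: G_def)
  have FK: "F \<subseteq> K" unfolding F_def using GK simplicialD(3)[OF K] by blast
  have GF: "\<tau> \<in> F" if "\<tau> \<in> G" for \<tau> using that GK simplicialD(1)[OF K] unfolding F_def by blast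
  have finF: "finite F" unfolding F_def using finG GK simplicialD(2)[OF K] by auto
  have "simplicial F"
  proof (rule simplicialI)
    show "\<tau> \<noteq> {} \<and> finite \<tau>" if "\<tau> \<in> F" for \<tau> using that FK simplicialD(1,2)[OF K] by blast
    show "\<rho> \<in> F" if "\<tau> \<in> F" "\<rho> \<subseteq> \<tau>" "\<rho> \<noteq> {}" for \<tau> \<rho> using that unfolding F_def by blast
  qed
  then have ca: "cone_acyclic F" by (rule cone_acyclic_finite[OF _ finF]) (use FK KA in blast)
  have cF: "c \<in> chn (prod_complex F L)"
    unfolding chn_def cspan_def
  proof (intro CollectI subsetI)
    fix zs assume zs: "zs \<in> Poly_Mapping.keys c"
    then have "set zs \<in> prod_complex K L" using c by (auto simp: chn_def cspan_def)
    note * = prod_complexD[OF this]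
    have "p ` set zs \<in> F" by (rule GF) (use zs in \<open>auto simp: G_def\<close>)
    then show "set zs \<in> prod_complex F L" by (rule prod_complexI[OF *(1-3) _ *(5)])
  qed
  have dF: "d i \<in> chn F" if "i \<in> I" for i
    unfolding chn_def cspan_def
  proof (intro CollectI subsetI)
    fix xs assume "xs \<in> Poly_Mapping.keys (d i)"
    then have "set xs \<in> G" unfolding G_def using that by blast
    then show "set xs \<in> F" by (rule GF)
  qed
  obtain c' e where *: "c' \<in> chn (prod_complex F L)" "bdu c' = c" "\<forall>i\<in>I. e i \<in> chn F \<and> slant_by i c' - d i = bdu (e i)"
    using cone_acyclicD[OF ca cF, of d, OF dF bc Sc] by auto
  have "prod_complex F L \<subseteq> prod_complex K L" using FK by (auto simp: prod_complex_def)
  then have "chn (prod_complex F L) \<subseteq> (chn (prod_complex K L) :: ('v list \<Rightarrow>\<^sub>0 'k) set)" by (rule chn_mono)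
  moreover have "chn F \<subseteq> (chn K :: ('a list \<Rightarrow>\<^sub>0 'k) set)" using FK by (rule chn_mono)
  ultimately show "\<exists>c'\<in>chn (prod_complex K L). \<exists>e. bdu c' = c \<and> (\<forall>i\<in>I. e i \<in> chn K \<and> slant_by i c' - d i = bdu (e i))"
    using * by (intro bexI[of _ c'] exI[of _ e]) auto
qed

text \<open>Injectivity is the cone condition for a cycle whose slant products bound. Surjectivity
  is the cone condition for \<open>c = 0\<close>: prescribed cycles \<open>d i\<close> of
  \<open>K\<close> are, up to boundaries, the slant products of one cycle.\<close>

theorem kuenneth:
  fixes \<psi> :: "'j \<Rightarrow> ('a list \<Rightarrow>\<^sub>0 'k) \<Rightarrow> 'k"
  assumes K: "simplicial K" "\<And>\<sigma>. \<sigma> \<in> K \<Longrightarrow> \<sigma> \<subseteq> A"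
    and gK: "good K J \<psi>" and lf: "\<And>j. j \<in> J \<Longrightarrow> linf (\<psi> j)"
  shows "good (prod_complex K L) (J \<times> I) (\<lambda>(j, i) c. \<psi> j (slant_by i c))"
proof (rule goodI)
  have ca: "cone_acyclic K" by (rule cone_acyclic_all) (fact K)+
  show "(case x of (j, i) \<Rightarrow> \<lambda>c. \<psi> j (slant_by i c)) (bdu c) = 0"
    if x: "x \<in> J \<times> I" and c: "c \<in> chn (prod_complex K L)" for x c
  proof -
    obtain j i where ji: "x = (j, i)" "j \<in> J" "i \<in> I" using x by blast
    have "\<psi> j (bdu (slant_by i c)) = 0" by (rule goodD(1)[OF gK ji(2) slant_by_chn[OF K(1) c]])
    then show ?thesis using bdu_slant_by[OF ji(3) c] ji(1) by simp
  qed
  show "\<exists>b\<in>chn (prod_complex K L). c = bdu b"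
    if c: "c \<in> chn (prod_complex K L)" "bdu c = 0"
      and z: "\<And>x. x \<in> J \<times> I \<Longrightarrow> (case x of (j, i) \<Rightarrow> \<lambda>c. \<psi> j (slant_by i c)) c = 0" for c
  proof -
    have "\<exists>d\<in>chn K. slant_by i c = bdu d" if i: "i \<in> I" for i
    proof (rule goodD(2)[OF gK slant_by_chn[OF K(1) c(1)]])
      show "bdu (slant_by i c) = 0" using bdu_slant_by[OF i c(1)] c(2) by (simp add: slant_by_lin)
      show "\<psi> j (slant_by i c) = 0" if "j \<in> J" for j using z[of "(j, i)"] i that by simp
    qed
    then obtain d where d: "\<And>i. i \<in> I \<Longrightarrow> d i \<in> chn K" "\<And>i. i \<in> I \<Longrightarrow> slant_by i c = bdu (d i)" by metis
    obtain c' where "c' \<in> chn (prod_complex K L)" "bdu c' = c"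
      using cone_acyclicD[OF ca c(1), of d, OF d(1) c(2) d(2)] by auto
    then show ?thesis by auto
  qed
  show "\<exists>c\<in>chn (prod_complex K L). bdu c = 0 \<and> (\<forall>x\<in>J \<times> I. (case x of (j, i) \<Rightarrow> \<lambda>c. \<psi> j (slant_by i c)) c = v x)" for v
  proof -
    have "\<forall>i. \<exists>d\<in>chn K. bdu d = 0 \<and> (\<forall>j\<in>J. \<psi> j d = v (j, i))"
      using goodD(3)[OF gK, of "\<lambda>j. v (j, _)"] by blast
    then obtain d where d: "\<And>i. d i \<in> chn K" "\<And>i. bdu (d i) = 0" "\<And>i j. j \<in> J \<Longrightarrow> \<psi> j (d i) = v (j, i)" by metis
    have "(0 :: 'v list \<Rightarrow>\<^sub>0 'k) \<in> chn (prod_complex K L)" by blast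
    then obtain c' e where c': "c' \<in> chn (prod_complex K L)" "bdu c' = 0"
      "\<forall>i\<in>I. e i \<in> chn K \<and> slant_by i c' - d i = bdu (e i)"
      using cone_acyclicD[OF ca, of 0 d] d by (auto simp: bdu_lin slant_by_lin)
    have "\<psi> j (slant_by i c') = v (j, i)" if ji: "j \<in> J" "i \<in> I" for j i
    proof -
      have "slant_by i c' = d i + bdu (e i)" "e i \<in> chn K" using c'(3) ji(2) by (auto simp: algebra_simps)
      then show ?thesis using d(3)[OF ji(1)] goodD(1)[OF gK ji(1)] by (simp add: klinearD[OF lf[OF ji(1)]])
    qed
    then show ?thesis using c' by (intro bexI[of _ c']) auto
  qed
qed

lemmas kuenneth_slant = kuenneth[unfolded slant_by_def]

end

end

section \<open>Reindexing and products of bases\<close>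

lemma barcode_basisD:
  assumes "barcode_basis K I J deg \<phi>"
  shows "i \<in> I \<Longrightarrow> graded_functional (deg i) (\<phi> i)" "i \<in> I \<Longrightarrow> linf (\<phi> i)"
    "simplicial (K \<epsilon>)" "finite {i \<in> I. \<epsilon> \<in> J i}" "good (K \<epsilon>) {i \<in> I. \<epsilon> \<in> J i} \<phi>"
    "i \<in> I \<Longrightarrow> s \<le> t \<Longrightarrow> s \<notin> J i \<Longrightarrow> t \<in> J i \<Longrightarrow> c \<in> chn (K s) \<Longrightarrow> \<phi> i c = 0"
  using assms by (simp_all add: barcode_basis_def graded_functional_def)

lemma barcode_basisI:
  assumes "\<And>i. i \<in> I \<Longrightarrow> graded_functional (deg i) (\<phi> i)" "\<And>\<epsilon>. simplicial (K \<epsilon>)"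
    "\<And>\<epsilon>. finite {i \<in> I. \<epsilon> \<in> J i}" "\<And>\<epsilon>. good (K \<epsilon>) {i \<in> I. \<epsilon> \<in> J i} \<phi>"
    "\<And>i s t c. i \<in> I \<Longrightarrow> s \<le> t \<Longrightarrow> s \<notin> J i \<Longrightarrow> t \<in> J i \<Longrightarrow> c \<in> chn (K s) \<Longrightarrow> \<phi> i c = 0"
  shows "barcode_basis K I J deg \<phi>"
  using assms by (simp add: barcode_basis_def)

lemma good_reindex:
  assumes g: "good K I \<phi>" and h: "bij_betw h I' I"
  shows "good K I' (\<lambda>i. \<phi> (h i))"
proof (rule goodI)
  have hI: "h i \<in> I" if "i \<in> I'" for i using h that by (auto simp: bij_betw_def)
  show "\<phi> (h i) (bdu c) = 0" if "i \<in> I'" "c \<in> chn K" for i c by (rule goodD(1)[OF g hI[OF that(1)] that(2)])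
  show "\<exists>b\<in>chn K. c = bdu b" if "c \<in> chn K" "bdu c = 0" "\<And>i. i \<in> I' \<Longrightarrow> \<phi> (h i) c = 0" for c
  proof (rule goodD(2)[OF g that(1,2)])
    fix i assume "i \<in> I"
    then obtain i' where "i' \<in> I'" "i = h i'" using h by (auto simp: bij_betw_def)
    then show "\<phi> i c = 0" using that(3) by simp
  qed
  fix v
  obtain c where c: "c \<in> chn K" "bdu c = 0" "\<forall>i\<in>I. \<phi> i c = v (inv_into I' h i)"
    using goodD(3)[OF g, of "\<lambda>i. v (inv_into I' h i)"] by auto
  have "\<phi> (h i) c = v i" if "i \<in> I'" for i
    using c(3) hI[OF that] h that by (simp add: bij_betw_def)
  then show "\<exists>c\<in>chn K. bdu c = 0 \<and> (\<forall>i\<in>I'. \<phi> (h i) c = v i)" using c(1,2) by auto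
qed

lemma barcode_basis_reindex:
  assumes b: "barcode_basis K I J deg \<phi>" and h: "bij_betw h I' I"
    and J: "\<And>i. i \<in> I' \<Longrightarrow> J' i = J (h i)" and deg: "\<And>i. i \<in> I' \<Longrightarrow> deg' i = deg (h i)"
  shows "barcode_basis K I' J' deg' (\<lambda>i. \<phi> (h i))"
proof (rule barcode_basisI)
  have hI: "h i \<in> I" if "i \<in> I'" for i using h that by (auto simp: bij_betw_def)
  show "graded_functional (deg' i) (\<phi> (h i))" if "i \<in> I'" for i
    using barcode_basisD(1)[OF b hI[OF that]] deg[OF that] by simp
  show "simplicial (K \<epsilon>)" for \<epsilon> by (rule barcode_basisD(3)[OF b])
  have bij: "bij_betw h {i \<in> I'. \<epsilon> \<in> J' i} {i \<in> I. \<epsilon> \<in> J i}" for \<epsilon>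
    unfolding bij_betw_def
  proof
    show "inj_on h {i \<in> I'. \<epsilon> \<in> J' i}" using h by (auto simp: bij_betw_def intro: inj_on_subset)
    have "h ` I' = I" using h by (simp add: bij_betw_def)
    then show "h ` {i \<in> I'. \<epsilon> \<in> J' i} = {i \<in> I. \<epsilon> \<in> J i}" using J by auto
  qed
  show "finite {i \<in> I'. \<epsilon> \<in> J' i}" for \<epsilon> using bij_betw_finite[OF bij] barcode_basisD(4)[OF b] by simp
  show "good (K \<epsilon>) {i \<in> I'. \<epsilon> \<in> J' i} (\<lambda>i. \<phi> (h i))" for \<epsilon>
    by (rule good_reindex[OF barcode_basisD(5)[OF b] bij])
  show "\<phi> (h i) c = 0" if "i \<in> I'" "s \<le> t" "s \<notin> J' i" "t \<in> J' i" "c \<in> chn (K s)" for i s t c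
    by (rule barcode_basisD(6)[OF b hI[OF that(1)] that(2) _ _ that(5)]) (use that J in auto)
qed

context product_vertices
begin

text \<open>Only values of \<open>\<psi>\<close> on tuples spanning simplices of \<open>L\<close>
  enter the slant product.\<close>

lemma slant_vanishes:
  assumes L: "simplicial L" and \<psi>: "\<And>c. c \<in> chn L \<Longrightarrow> \<psi> c = 0" and c: "c \<in> chn (prod_complex K L)"
  shows "slant p q d \<psi> c = 0"
proof (rule klinear_cspan_zero[OF lin_slant _ _ c[unfolded chn_def]])
  have *: "slant_list p q d \<psi> ys = 0" if "q ` set zs \<in> L" "set ys \<subseteq> set zs" for ys zs
    using that(2)
  proof (induction ys)
    case (Cons y ys)
    have "q ` set (y # ys) \<in> L" by (rule simplicialD(3)[OF L that(1)]) (use Cons.prems in auto)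
    then have "\<psi> (Poly_Mapping.single (map q (y # ys)) 1) = 0" by (intro \<psi> chn_closed) simp
    then show ?case using Cons by (simp add: cons_lin)
  qed simp
  show "slant p q d \<psi> (Poly_Mapping.single zs 1) = 0" if "zs \<in> {zs. set zs \<in> prod_complex K L}" for zs
    using *[of zs zs] prod_complexD(5)[of "set zs"] that by (simp add: slant_single)
qed simp

lemma graded_slant:
  assumes "graded_functional d1 \<phi>"
  shows "graded_functional (d1 + d2) (\<lambda>c. \<phi> (slant p q d2 \<psi> c))"
proof -
  have lf: "linf \<phi>" using assms by (simp add: graded_functional_def)
  have "\<phi> (slant_list p q d2 \<psi> xs) = 0" if "length xs \<noteq> Suc (d1 + d2)" for xs
    by (rule klinear_cspan_zero[OF lf _ _ slant_list_cspan])
      (use that assms in \<open>auto simp: graded_functional_def\<close>)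
  then show ?thesis
    using klinear_compose[OF lin_slant lf] by (simp add: graded_functional_def slant_single klinearD[OF lf])
qed

text \<open>A pair is active at a scale when both members are, so bars intersect. If the
  intersection has not opened at \<open>s\<close>, one of the two bars has not: when it is the
  second, slanting already gives 0; when it is the first, the slant product is a chain of
  \<open>K s\<close>, on which \<open>\<phi> i\<close> vanishes.\<close>

lemma barcode_basis_prod:
  fixes \<phi> :: "'i \<Rightarrow> ('a list \<Rightarrow>\<^sub>0 'k::field) \<Rightarrow> 'k" and \<psi> :: "'j \<Rightarrow> ('b list \<Rightarrow>\<^sub>0 'k) \<Rightarrow> 'k"
  assumes b1: "barcode_basis K I1 J1 deg1 \<phi>" and b2: "barcode_basis L I2 J2 deg2 \<psi>"
    and KA: "\<And>\<epsilon> \<sigma>. \<sigma> \<in> K \<epsilon> \<Longrightarrow> \<sigma> \<subseteq> A" and LB: "\<And>\<epsilon> \<sigma>. \<sigma> \<in> L \<epsilon> \<Longrightarrow> \<sigma> \<subseteq> B"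
  shows "barcode_basis (\<lambda>\<epsilon>. prod_complex (K \<epsilon>) (L \<epsilon>)) (I1 \<times> I2) (\<lambda>(i, j). J1 i \<inter> J2 j) (\<lambda>(i, j). deg1 i + deg2 j)
    (\<lambda>(i, j) c. \<phi> i (slant p q (deg2 j) (\<psi> j) c))"
proof (rule barcode_basisI)
  note K = barcode_basisD(3)[OF b1] and L = barcode_basisD(3)[OF b2]
  show "graded_functional (case x of (i, j) \<Rightarrow> deg1 i + deg2 j) (case x of (i, j) \<Rightarrow> \<lambda>c. \<phi> i (slant p q (deg2 j) (\<psi> j) c))"
    if "x \<in> I1 \<times> I2" for x
    using that graded_slant[OF barcode_basisD(1)[OF b1]] by (cases x) auto
  show "simplicial (prod_complex (K \<epsilon>) (L \<epsilon>))" for \<epsilon> by (rule simplicial_prod_complex[OF K L])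
  have I: "{x \<in> I1 \<times> I2. \<epsilon> \<in> (case x of (i, j) \<Rightarrow> J1 i \<inter> J2 j)} = {i \<in> I1. \<epsilon> \<in> J1 i} \<times> {j \<in> I2. \<epsilon> \<in> J2 j}" for \<epsilon>
    by auto
  show "finite {x \<in> I1 \<times> I2. \<epsilon> \<in> (case x of (i, j) \<Rightarrow> J1 i \<inter> J2 j)}" for \<epsilon>
    unfolding I using barcode_basisD(4)[OF b1] barcode_basisD(4)[OF b2] by blast
  show "good (prod_complex (K \<epsilon>) (L \<epsilon>)) {x \<in> I1 \<times> I2. \<epsilon> \<in> (case x of (i, j) \<Rightarrow> J1 i \<inter> J2 j)}
    (\<lambda>(i, j) c. \<phi> i (slant p q (deg2 j) (\<psi> j) c))" for \<epsilon>
    unfolding I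
    by (rule kuenneth_slant[OF L LB barcode_basisD(4)[OF b2] barcode_basisD(5)[OF b2] _ K KA barcode_basisD(5)[OF b1]])
      (use barcode_basisD(1)[OF b2] barcode_basisD(2)[OF b1] in auto)
  show "(case x of (i, j) \<Rightarrow> \<lambda>c. \<phi> i (slant p q (deg2 j) (\<psi> j) c)) c = 0"
    if x: "x \<in> I1 \<times> I2" and st: "s \<le> t" "s \<notin> (case x of (i, j) \<Rightarrow> J1 i \<inter> J2 j)" "t \<in> (case x of (i, j) \<Rightarrow> J1 i \<inter> J2 j)"
      and c: "c \<in> chn (prod_complex (K s) (L s))" for x s t c
  proof -
    obtain i j where ij: "x = (i, j)" "i \<in> I1" "j \<in> I2" using x by blast
    have "\<phi> i (slant p q (deg2 j) (\<psi> j) c) = 0"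
    proof (cases "s \<in> J1 i")
      case True
      have "slant p q (deg2 j) (\<psi> j) c = 0"
        by (rule slant_vanishes[OF L _ c], rule barcode_basisD(6)[OF b2 ij(3) st(1)]) (use True st ij in auto)
      then show ?thesis using barcode_basisD(2)[OF b1 ij(2)] by (simp add: klinearD)
    next
      case False
      show ?thesis
        by (rule barcode_basisD(6)[OF b1 ij(2) st(1) False _ slant_chn[OF K c]]) (use st ij in auto)
    qed
    then show ?thesis using ij by simp
  qed
qed

end

section \<open>The torus\<close>

definition torus :: "nat \<Rightarrow> (nat \<Rightarrow> real) \<Rightarrow> phase_point set" where
  "torus N r = {(a, b) \<in> phase_space N. \<forall>L\<in>{1..N}. (a L)\<^sup>2 + (b L)\<^sup>2 = (r L)\<^sup>2}"

text \<open>Formulated through the projections instead of the maximum metric, so that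
  \<open>N = 0\<close>, where the maximum would range over the empty set, can start the
  induction.\<close>

definition torus_complex :: "nat \<Rightarrow> (nat \<Rightarrow> real) \<Rightarrow> real \<Rightarrow> phase_point set set" where
  "torus_complex N r \<epsilon> = {\<sigma>. \<sigma> \<noteq> {} \<and> finite \<sigma> \<and> \<sigma> \<subseteq> torus N r \<and>
     (\<forall>L\<in>{1..N}. plane_proj L ` \<sigma> \<in> vietoris_rips dist (circle_points (r L)) \<epsilon>)}"

text \<open>Without factors there is one point at every scale, and its bar, an empty intersection,
  is the whole line.\<close>

lemma torus_basis_0:
  "barcode_basis (torus_complex 0 r) ({1..0::nat} \<rightarrow>\<^sub>E (UNIV :: nat set)) (\<lambda>m. \<Inter>L\<in>{1..0}. arc_bar (r L) (m L)) (\<lambda>m. \<Sum>L=1..0. m L)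
     (\<lambda>_. eps :: _ \<Rightarrow> 'k::field)"
proof (rule barcode_basisI)
  let ?x = "(\<lambda>_. undefined, \<lambda>_. undefined) :: phase_point" and ?i = "(\<lambda>_. undefined) :: nat \<Rightarrow> nat"
  have T: "torus 0 r = {?x}" by (auto simp: torus_def phase_space_def)
  have K: "torus_complex 0 r \<epsilon> = vietoris_rips (\<lambda>_ _. 0) {?x} 1" for \<epsilon>
    unfolding torus_complex_def vietoris_rips_def T by (rule Collect_cong) auto
  show "simplicial (torus_complex 0 r \<epsilon>)" for \<epsilon> unfolding K by (rule simplicial_vietoris_rips)
  have "good (vietoris_rips (\<lambda>_ _. 0) {?x} 1) {?i} (\<lambda>_. eps :: _ \<Rightarrow> 'k)"
    by (rule good_full[of ?x]) auto
  then show "good (torus_complex 0 r \<epsilon>) {m \<in> {1..0::nat} \<rightarrow>\<^sub>E (UNIV :: nat set). \<epsilon> \<in> (\<Inter>L\<in>{1..0}. arc_bar (r L) (m L))}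
    (\<lambda>_. eps :: _ \<Rightarrow> 'k)" for \<epsilon>
    unfolding K by simp
qed (auto simp: graded_functional_def linf_eps eps_single)

lemma torus_Suc:
  assumes "x \<in> torus (Suc N) r"
  shows "(restrict (fst x) {1..N}, restrict (snd x) {1..N}) \<in> torus N r"
  using assms by (auto simp: torus_def phase_space_def)

lemma torus_complex_Suc:
  fixes N :: nat and r :: "nat \<Rightarrow> real"
  defines "p \<equiv> \<lambda>x :: phase_point. (restrict (fst x) {1..N}, restrict (snd x) {1..N})"
  shows "torus_complex (Suc N) r \<epsilon> =
    {\<sigma>. \<sigma> \<noteq> {} \<and> finite \<sigma> \<and> \<sigma> \<subseteq> torus (Suc N) r \<and> p ` \<sigma> \<in> torus_complex N r \<epsilon> \<and>
       plane_proj (Suc N) ` \<sigma> \<in> vietoris_rips dist (circle_points (r (Suc N))) \<epsilon>}"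
proof (rule Set.set_eqI)
  fix \<sigma> :: "phase_point set"
  have p: "plane_proj L (p x) = plane_proj L x" if "L \<in> {1..N}" for L x
    using that by (simp add: p_def plane_proj_def)
  have im: "plane_proj L ` p ` \<sigma> = plane_proj L ` \<sigma>" if "L \<in> {1..N}" for L
    using p[OF that] by (simp add: image_image)
  have T: "p ` \<sigma> \<subseteq> torus N r" if "\<sigma> \<subseteq> torus (Suc N) r"
    unfolding p_def using torus_Suc that by blast
  have S: "{1..Suc N} = insert (Suc N) {1..N}" by auto
  show "\<sigma> \<in> torus_complex (Suc N) r \<epsilon> \<longleftrightarrow> \<sigma> \<in> {\<sigma>. \<sigma> \<noteq> {} \<and> finite \<sigma> \<and> \<sigma> \<subseteq> torus (Suc N) r \<and> p ` \<sigma> \<in> torus_complex N r \<epsilon> \<and>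
       plane_proj (Suc N) ` \<sigma> \<in> vietoris_rips dist (circle_points (r (Suc N))) \<epsilon>}"
    unfolding torus_complex_def mem_Collect_eq S ball_simps(7) using im T by auto
qed

lemma bij_restrict_last:
  "bij_betw (\<lambda>m. (restrict m {1..N}, m (Suc N))) ({1..Suc N} \<rightarrow>\<^sub>E (UNIV :: nat set)) (({1..N} \<rightarrow>\<^sub>E UNIV) \<times> UNIV)"
proof (rule bij_betw_byWitness[where f' = "\<lambda>(m, k). m(Suc N := k)"])
  show "\<forall>m\<in>{1..Suc N} \<rightarrow>\<^sub>E (UNIV :: nat set). (case (restrict m {1..N}, m (Suc N)) of (m, k) \<Rightarrow> m(Suc N := k)) = m"
  proof
    fix m assume m: "m \<in> {1..Suc N} \<rightarrow>\<^sub>E (UNIV :: nat set)"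
    have "((restrict m {1..N})(Suc N := m (Suc N))) x = m x" for x
      using m by (cases "x \<in> {1..Suc N}") (auto simp: PiE_def extensional_def)
    then show "(case (restrict m {1..N}, m (Suc N)) of (m, k) \<Rightarrow> m(Suc N := k)) = m" by auto
  qed
  show "\<forall>x\<in>({1..N} \<rightarrow>\<^sub>E UNIV) \<times> UNIV. (\<lambda>m. (restrict m {1..N}, m (Suc N))) (case x of (m, k) \<Rightarrow> m(Suc N := k)) = x"
    by (auto simp: PiE_def extensional_def fun_eq_iff restrict_def)
  show "(\<lambda>m. (restrict m {1..N}, m (Suc N))) ` ({1..Suc N} \<rightarrow>\<^sub>E (UNIV :: nat set)) \<subseteq> ({1..N} \<rightarrow>\<^sub>E UNIV) \<times> UNIV"
    by auto
  show "(\<lambda>(m, k). m(Suc N := k)) ` (({1..N} \<rightarrow>\<^sub>E UNIV) \<times> UNIV) \<subseteq> {1..Suc N} \<rightarrow>\<^sub>E (UNIV :: nat set)"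
    by (auto simp: PiE_def extensional_def)
qed

lemma torus_basis:
  assumes r: "\<And>L. 0 \<le> r L"
  shows "\<exists>\<phi> :: (nat \<Rightarrow> nat) \<Rightarrow> (phase_point list \<Rightarrow>\<^sub>0 'k::field) \<Rightarrow> 'k.
    barcode_basis (torus_complex N r) ({1..N} \<rightarrow>\<^sub>E UNIV) (\<lambda>m. \<Inter>L\<in>{1..N}. arc_bar (r L) (m L)) (\<lambda>m. \<Sum>L=1..N. m L) \<phi>"
proof (induction N)
  case 0
  show ?case using torus_basis_0 by blast
next
  case (Suc N)
  define p where "p = (\<lambda>x :: phase_point. (restrict (fst x) {1..N}, restrict (snd x) {1..N}))"
  define pr where "pr = (\<lambda>(x :: phase_point) (y :: real \<times> real). ((fst x)(Suc N := fst y), (snd x)(Suc N := snd y)))"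
  interpret product_vertices "torus (Suc N) r" p "plane_proj (Suc N)" "torus N r" "circle_points (r (Suc N))" pr
  proof
    fix x y assume x: "x \<in> torus N r" and y: "y \<in> circle_points (r (Suc N))"
    obtain a b where ab: "x = (a, b)" by (cases x)
    obtain u v where uv: "y = (u, v)" by (cases y)
    have a: "a \<in> extensional {1..N}" and b: "b \<in> extensional {1..N}"
      and eq: "\<And>L. L \<in> {1..N} \<Longrightarrow> (a L)\<^sup>2 + (b L)\<^sup>2 = (r L)\<^sup>2"
      using x by (auto simp: ab torus_def phase_space_def PiE_def)
    have uv2: "u\<^sup>2 + v\<^sup>2 = (r (Suc N))\<^sup>2" using y by (simp add: uv circle_points_def)
    have S: "{1..Suc N} = insert (Suc N) {1..N}" by auto
    have "a(Suc N := u) \<in> {1..Suc N} \<rightarrow>\<^sub>E UNIV" "b(Suc N := v) \<in> {1..Suc N} \<rightarrow>\<^sub>E UNIV"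
      using a b by (auto simp: PiE_def extensional_def)
    then show "pr x y \<in> torus (Suc N) r"
      using eq uv2 unfolding torus_def phase_space_def S by (auto simp: pr_def ab uv)
    have "restrict (a(Suc N := u)) {1..N} = a" "restrict (b(Suc N := v)) {1..N} = b"
      using a b by (auto simp: fun_eq_iff extensional_def restrict_def)
    then show "p (pr x y) = x" by (simp add: p_def pr_def ab uv)
    show "plane_proj (Suc N) (pr x y) = y" by (simp add: plane_proj_def pr_def uv)
  qed
  obtain \<phi> :: "(nat \<Rightarrow> nat) \<Rightarrow> (phase_point list \<Rightarrow>\<^sub>0 'k) \<Rightarrow> 'k" where
    \<phi>: "barcode_basis (torus_complex N r) ({1..N} \<rightarrow>\<^sub>E UNIV) (\<lambda>m. \<Inter>L\<in>{1..N}. arc_bar (r L) (m L)) (\<lambda>m. \<Sum>L=1..N. m L) \<phi>"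
    using Suc.IH by blast
  obtain \<psi> :: "nat \<Rightarrow> ((real \<times> real) list \<Rightarrow>\<^sub>0 'k) \<Rightarrow> 'k" where
    \<psi>: "barcode_basis (vietoris_rips dist (circle_points (r (Suc N)))) UNIV (arc_bar (r (Suc N))) id \<psi>"
    using circle_basis[OF r] by blast
  have KA: "\<sigma> \<subseteq> torus N r" if "\<sigma> \<in> torus_complex N r \<epsilon>" for \<sigma> \<epsilon> using that by (simp add: torus_complex_def)
  have LB: "\<sigma> \<subseteq> V" if "\<sigma> \<in> vietoris_rips dist V \<epsilon>" for \<sigma> :: "(real \<times> real) set" and V \<epsilon> using that by (simp add: vietoris_rips_def)
  have K: "prod_complex (torus_complex N r \<epsilon>) (vietoris_rips dist (circle_points (r (Suc N))) \<epsilon>) = torus_complex (Suc N) r \<epsilon>" for \<epsilon>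
    unfolding prod_complex_def by (simp only: torus_complex_Suc p_def)
  note b = barcode_basis_prod[OF \<phi> \<psi> KA LB, unfolded K]
  have "barcode_basis (torus_complex (Suc N) r) ({1..Suc N} \<rightarrow>\<^sub>E UNIV)
      (\<lambda>m. \<Inter>L\<in>{1..Suc N}. arc_bar (r L) (m L)) (\<lambda>m. \<Sum>L=1..Suc N. m L)
      (\<lambda>m. (\<lambda>(i, j) c. \<phi> i (slant p (plane_proj (Suc N)) (id j) (\<psi> j) c)) (restrict m {1..N}, m (Suc N)))"
  proof (rule barcode_basis_reindex[OF b bij_restrict_last])
    fix m :: "nat \<Rightarrow> nat"
    have S: "{1..Suc N} = insert (Suc N) {1..N}" by auto
    show "(\<Inter>L\<in>{1..Suc N}. arc_bar (r L) (m L)) = (case (restrict m {1..N}, m (Suc N)) of (i, j) \<Rightarrow> (\<Inter>L\<in>{1..N}. arc_bar (r L) (i L)) \<inter> arc_bar (r (Suc N)) j)"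
      unfolding S by auto
    show "(\<Sum>L=1..Suc N. m L) = (case (restrict m {1..N}, m (Suc N)) of (i, j) \<Rightarrow> (\<Sum>L=1..N. i L) + id j)"
      by simp
  qed
  then show ?case by blast
qed

lemma plane_proj_torus:
  assumes L: "L \<in> {1..N}"
  shows "plane_proj L ` torus N r = circle_points (r L)"
proof (intro antisym subsetI)
  fix y assume "y \<in> plane_proj L ` torus N r"
  then show "y \<in> circle_points (r L)" using L by (auto simp: torus_def circle_points_def plane_proj_def)
next
  fix y assume y: "y \<in> circle_points (r L)"
  obtain u v where uv: "y = (u, v)" by (cases y)
  \<comment> \<open>In every other plane the point \<open>(r M, 0)\<close> of the circle is
    chosen.\<close>
  define a where "a = (\<lambda>M\<in>{1..N}. if M = L then u else r M)"
  define b where "b = (\<lambda>M\<in>{1..N}. if M = L then v else 0)"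
  have "(a, b) \<in> torus N r" using y by (auto simp: uv torus_def phase_space_def a_def b_def circle_points_def)
  moreover have "plane_proj L (a, b) = y" using L by (simp add: plane_proj_def a_def b_def uv)
  ultimately show "y \<in> plane_proj L ` torus N r" by (metis imageI)
qed

lemma vietoris_rips_torus:
  assumes N: "N \<ge> 1"
  shows "vietoris_rips (max_dist N) (torus N r) \<epsilon> = torus_complex N r \<epsilon>"
proof (rule Set.set_eqI)
  fix \<sigma> :: "phase_point set"
  have m: "max_dist N x y < \<epsilon> \<longleftrightarrow> (\<forall>L\<in>{1..N}. dist (plane_proj L x) (plane_proj L y) < \<epsilon>)" for x y
    unfolding max_dist_def using N by (subst Max_less_iff) auto
  have V: "plane_proj L ` \<sigma> \<in> vietoris_rips dist (circle_points (r L)) \<epsilon> \<longleftrightarrow>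
      (\<forall>x\<in>\<sigma>. \<forall>y\<in>\<sigma>. dist (plane_proj L x) (plane_proj L y) < \<epsilon>)"
    if "\<sigma> \<noteq> {}" "finite \<sigma>" "\<sigma> \<subseteq> torus N r" "L \<in> {1..N}" for L
  proof -
    have "plane_proj L ` \<sigma> \<subseteq> circle_points (r L)" using plane_proj_torus[OF that(4), of r] that(3) by blast
    then show ?thesis using that by (simp add: vietoris_rips_def)
  qed
  show "\<sigma> \<in> vietoris_rips (max_dist N) (torus N r) \<epsilon> \<longleftrightarrow> \<sigma> \<in> torus_complex N r \<epsilon>"
    unfolding vietoris_rips_def[of "max_dist N"] torus_complex_def mem_Collect_eq m using V by blast
qed

lemma liouville_torus_eq: "liouville_torus f N = torus N (radius f)"
  by (simp add: liouville_torus_def torus_def)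

lemma circle_bar_eq: "circle_bar f L m = arc_bar (radius f L) m"
  by (simp add: circle_bar_def arc_bar_def)

lemma radius_nonneg: "0 \<le> radius f L"
  by (simp add: radius_def)

section \<open>Ranks of persistence modules\<close>

definition coset :: "('b \<Rightarrow>\<^sub>0 'k::field) set \<Rightarrow> ('b \<Rightarrow>\<^sub>0 'k) \<Rightarrow> ('b \<Rightarrow>\<^sub>0 'k) set" where
  "coset B z = {z + b | b. b \<in> B}"

definition ksubspace :: "('b \<Rightarrow>\<^sub>0 'k::field) set \<Rightarrow> bool" where
  "ksubspace B \<longleftrightarrow> 0 \<in> B \<and> (\<forall>x\<in>B. \<forall>y\<in>B. x + y \<in> B) \<and> (\<forall>a. \<forall>x\<in>B. scl a x \<in> B)"

lemma ksubspaceD: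
  assumes "ksubspace B"
  shows "0 \<in> B" "x \<in> B \<Longrightarrow> y \<in> B \<Longrightarrow> x + y \<in> B" "x \<in> B \<Longrightarrow> scl a x \<in> B" "x \<in> B \<Longrightarrow> - x \<in> B"
    "x \<in> B \<Longrightarrow> y \<in> B \<Longrightarrow> x - y \<in> B"
proof -
  show 1: "x \<in> B \<Longrightarrow> y \<in> B \<Longrightarrow> x + y \<in> B" for x y using assms by (simp add: ksubspace_def)
  show 2: "x \<in> B \<Longrightarrow> scl a x \<in> B" for a x using assms by (simp add: ksubspace_def)
  show 3: "x \<in> B \<Longrightarrow> - x \<in> B" for x using 2[of x "- 1"] by (simp add: scl_minus1)
  show "x \<in> B \<Longrightarrow> y \<in> B \<Longrightarrow> x - y \<in> B" for x y using 1[of x "- y"] 3[of y] by simp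
qed (use assms in \<open>simp add: ksubspace_def\<close>)

lemma ksubspace_sum: "ksubspace B \<Longrightarrow> (\<And>x. x \<in> S \<Longrightarrow> f x \<in> B) \<Longrightarrow> sum f S \<in> B"
  by (induction S rule: infinite_finite_induct) (auto intro: ksubspaceD)

lemma coset_eq:
  assumes "ksubspace B"
  shows "coset B x = coset B y \<longleftrightarrow> x - y \<in> B"
proof
  assume "coset B x = coset B y"
  moreover have "x \<in> coset B x" unfolding coset_def using ksubspaceD(1)[OF assms] by force
  ultimately obtain b where "b \<in> B" "x = y + b" by (auto simp: coset_def)
  then show "x - y \<in> B" by simp
next
  have sub: "coset B x \<subseteq> coset B y" if xy: "x - y \<in> B" for x y
  proof
    fix w assume "w \<in> coset B x"
    then obtain b where "b \<in> B" "w = x + b" by (auto simp: coset_def)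
    then have "w = y + ((x - y) + b)" "(x - y) + b \<in> B" using xy by (auto intro: ksubspaceD(2)[OF assms])
    then show "w \<in> coset B y" unfolding coset_def by blast
  qed
  assume xy: "x - y \<in> B"
  then have "y - x \<in> B" using ksubspaceD(4)[OF assms xy] by simp
  then show "coset B x = coset B y" using sub xy by blast
qed

lemma coset_add:
  assumes "ksubspace B"
  shows "{x + y | x y. x \<in> coset B u \<and> y \<in> coset B v} = coset B (u + v)"
proof (intro antisym subsetI)
  fix w assume "w \<in> {x + y | x y. x \<in> coset B u \<and> y \<in> coset B v}"
  then obtain b c where "b \<in> B" "c \<in> B" "w = (u + b) + (v + c)" by (auto simp: coset_def)
  then have "w = (u + v) + (b + c)" "b + c \<in> B" by (auto simp: algebra_simps intro: ksubspaceD(2)[OF assms])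
  then show "w \<in> coset B (u + v)" unfolding coset_def by blast
next
  fix w assume "w \<in> coset B (u + v)"
  then obtain b where "b \<in> B" "w = (u + 0) + (v + b)" by (auto simp: coset_def algebra_simps)
  then show "w \<in> {x + y | x y. x \<in> coset B u \<and> y \<in> coset B v}"
    unfolding coset_def using ksubspaceD(1)[OF assms] by blast
qed

lemma coset_smult:
  assumes "ksubspace B"
  shows "{scl a x + b | x b. x \<in> coset B u \<and> b \<in> B} = coset B (scl a u)"
proof (intro antisym subsetI)
  fix w assume "w \<in> {scl a x + b | x b. x \<in> coset B u \<and> b \<in> B}"
  then obtain b c where "b \<in> B" "c \<in> B" "w = scl a (u + b) + c" by (auto simp: coset_def)
  then have "w = scl a u + (scl a b + c)" "scl a b + c \<in> B"
    by (auto simp: scl_distrib algebra_simps intro: ksubspaceD(2,3)[OF assms])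
  then show "w \<in> coset B (scl a u)" unfolding coset_def by blast
next
  fix w assume "w \<in> coset B (scl a u)"
  then obtain b where b: "b \<in> B" "w = scl a (u + 0) + b" by (auto simp: coset_def)
  moreover have "u + 0 \<in> coset B u" unfolding coset_def using ksubspaceD(1)[OF assms] by blast
  ultimately show "w \<in> {scl a x + b | x b. x \<in> coset B u \<and> b \<in> B}" by blast
qed

lemma coset_zero: "coset B 0 = B" by (auto simp: coset_def)

text \<open>The functionals are coordinates on \<open>Z\<close> modulo \<open>B\<close>. Elements of
  \<open>Z\<close> dual to them define the map \<open>T\<close> from coordinate vectors to cosets;
  \<open>van\<close> makes it injective and \<open>inj\<close> surjective.\<close>

lemma quotient_dim:
  fixes Z B :: "('b \<Rightarrow>\<^sub>0 'k::field) set" and W :: "('k, ('b \<Rightarrow>\<^sub>0 'k) set, 'z) module_scheme"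
  assumes Z: "ksubspace Z" and B: "ksubspace B" and S: "finite S"
    and lf: "\<And>i. i \<in> S \<Longrightarrow> linf (\<phi> i)" and van: "\<And>i b. i \<in> S \<Longrightarrow> b \<in> B \<Longrightarrow> \<phi> i b = 0"
    and inj: "\<And>z. z \<in> Z \<Longrightarrow> (\<And>i. i \<in> S \<Longrightarrow> \<phi> i z = 0) \<Longrightarrow> z \<in> B"
    and surj: "\<And>v. \<exists>z\<in>Z. \<forall>i\<in>S. \<phi> i z = v i"
    and carrier: "carrier W = coset B ` Z" and zero: "\<zero>\<^bsub>W\<^esub> = B"
    and add: "\<And>x y. x \<oplus>\<^bsub>W\<^esub> y = {a + b | a b. a \<in> x \<and> b \<in> y}"
    and smult: "\<And>s x. s \<odot>\<^bsub>W\<^esub> x = {scl s a + b | a b. a \<in> x \<and> b \<in> B}"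
  shows "vectorspace.dim class_ring W = card S"
proof -
  note Z' = ksubspaceD[OF Z]
  have W_add: "coset B u \<oplus>\<^bsub>W\<^esub> coset B v = coset B (u + v)" for u v by (simp only: add coset_add[OF B])
  have W_smult: "s \<odot>\<^bsub>W\<^esub> coset B u = coset B (scl s u)" for s u by (simp only: smult coset_smult[OF B])
  have W_zero: "\<zero>\<^bsub>W\<^esub> = coset B 0" by (simp add: zero coset_zero)
  have all: "(\<forall>x. x \<in> carrier W \<longrightarrow> P x) \<longleftrightarrow> (\<forall>z\<in>Z. P (coset B z))" for P by (auto simp: carrier)
  have ball: "(\<forall>x\<in>carrier W. P x) \<longleftrightarrow> (\<forall>z\<in>Z. P (coset B z))" for P by (auto simp: carrier)
  have car: "coset B z \<in> carrier W" if "z \<in> Z" for z using that by (simp add: carrier)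
  have vs: "vectorspace class_ring W"
  proof (rule vs_criteria)
    show "field (class_ring :: 'k ring)" by (rule class_field)
    show "\<zero>\<^bsub>W\<^esub> \<in> carrier W" unfolding W_zero by (rule car[OF Z'(1)])
    show "\<forall>v\<in>carrier W. \<exists>neg_v\<in>carrier W. v \<oplus>\<^bsub>W\<^esub> neg_v = \<zero>\<^bsub>W\<^esub>"
      unfolding ball
    proof
      fix z assume "z \<in> Z"
      then have "coset B (- z) \<in> carrier W" by (intro car Z'(4))
      moreover have "coset B z \<oplus>\<^bsub>W\<^esub> coset B (- z) = \<zero>\<^bsub>W\<^esub>" by (simp add: W_add W_zero)
      ultimately show "\<exists>neg_v\<in>carrier W. coset B z \<oplus>\<^bsub>W\<^esub> neg_v = \<zero>\<^bsub>W\<^esub>" by blast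
    qed
  qed (auto simp: carrier W_add W_smult W_zero scl_distrib Z' algebra_simps)
  obtain e where e: "bij_betw e {0..<card S} S" using ex_bij_betw_nat_finite[OF S] by blast
  let ?n = "card S"
  have eS: "e j \<in> S" if "j < ?n" for j using e that by (auto simp: bij_betw_def)
  have "\<forall>i. \<exists>z\<in>Z. \<forall>j\<in>S. \<phi> j z = (if i = j then 1 else 0)"
    by (intro allI surj)
  then obtain \<zeta> where \<zeta>: "\<And>i. \<zeta> i \<in> Z" "\<And>i j. j \<in> S \<Longrightarrow> \<phi> j (\<zeta> i) = (if i = j then 1 else 0)" by metis
  define comb where "comb = (\<lambda>v :: 'k vec. \<Sum>j<?n. scl (v $ j) (\<zeta> (e j)))"
  have combZ: "comb v \<in> Z" for v unfolding comb_def by (intro ksubspace_sum[OF Z] Z'(3) \<zeta>)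
  have \<phi>comb: "\<phi> (e k) (comb v) = v $ k" if k: "k < ?n" for k v
  proof -
    have "\<phi> (e k) (comb v) = (\<Sum>j<?n. v $ j * (if e j = e k then 1 else 0))"
      unfolding comb_def by (simp add: klinearD[OF lf[OF eS[OF k]]] \<zeta>(2)[OF eS[OF k]])
    also have "\<dots> = (\<Sum>j<?n. if j = k then v $ j else 0)"
      by (rule sum.cong) (use e k in \<open>auto simp: bij_betw_def inj_on_def\<close>)
    also have "\<dots> = v $ k" using k by simp
    finally show ?thesis .
  qed
  define T where "T = (\<lambda>v. coset B (comb v))"
  interpret V: vec_space "TYPE('k)" ?n .
  have lm: "linear_map class_ring (module_vec TYPE('k) ?n) W T"
  proof (intro linear_map.intro mod_hom.intro mod_hom_axioms.intro)
    show vsV: "vectorspace class_ring (module_vec TYPE('k) ?n)" by (rule V.vectorspace_axioms)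
    show "vectorspace class_ring W" by (rule vs)
    show "Module.module class_ring (module_vec TYPE('k) ?n)" using vsV by (simp add: vectorspace_def)
    show "Module.module class_ring W" using vs by (simp add: vectorspace_def)
    have "comb (v + w) = comb v + comb w" if "v \<in> carrier_vec ?n" "w \<in> carrier_vec ?n" for v w
      unfolding comb_def sum.distrib[symmetric] by (rule sum.cong) (use that in \<open>auto simp: scl_distrib\<close>)
    moreover have "comb (s \<cdot>\<^sub>v v) = scl s (comb v)" if "v \<in> carrier_vec ?n" for s v
      unfolding comb_def scl_sum by (rule sum.cong) (use that in auto)
    ultimately show "T \<in> module_hom class_ring (module_vec TYPE('k) ?n) W"
      unfolding module_hom_def by (auto simp: module_vec_simps T_def W_add W_smult car combZ)
  qed
  interpret lm: linear_map class_ring "module_vec TYPE('k) ?n" W T by (rule lm)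
  have "inj_on T (carrier_vec ?n)"
  proof (rule inj_onI)
    fix v w assume vw: "v \<in> carrier_vec ?n" "w \<in> carrier_vec ?n" "T v = T w"
    then have b: "comb v - comb w \<in> B" by (simp add: T_def coset_eq[OF B])
    show "v = w"
    proof (rule eq_vecI)
      show "dim_vec v = dim_vec w" using vw by auto
      fix k assume "k < dim_vec w"
      then have k: "k < ?n" using vw by auto
      have "\<phi> (e k) (comb v - comb w) = 0" by (rule van[OF eS[OF k] b])
      then show "v $ k = w $ k" using \<phi>comb[OF k] by (simp add: klinearD[OF lf[OF eS[OF k]]])
    qed
  qed
  moreover have "T ` carrier_vec ?n = carrier W"
  proof (intro antisym subsetI)
    fix x assume "x \<in> carrier W"
    then obtain z where z: "z \<in> Z" "x = coset B z" by (auto simp: carrier)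
    define v where "v = vec ?n (\<lambda>j. \<phi> (e j) z)"
    have "\<phi> i (comb v - z) = 0" if i: "i \<in> S" for i
    proof -
      have "i \<in> e ` {0..<?n}" using i e by (simp add: bij_betw_def)
      then obtain k where "k < ?n" "i = e k" by auto
      then have "\<phi> i (comb v) = \<phi> i z" using \<phi>comb[of k v] by (simp add: v_def)
      then show ?thesis by (simp add: klinearD(5)[OF lf[OF i]])
    qed
    then have "comb v - z \<in> B" by (intro inj Z'(5) combZ z)
    then have "T v = x" by (simp add: T_def z coset_eq[OF B])
    then show "x \<in> T ` carrier_vec ?n" by (auto simp: v_def)
  qed (auto simp: T_def car combZ)
  ultimately have "vectorspace.dim class_ring (module_vec TYPE('k) ?n) = vectorspace.dim class_ring W"
    by (intro lm.dim_eq) (auto simp: module_vec_simps)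
  then show ?thesis using V.dim_is_n by simp
qed

section \<open>Agreement with the graded chain complex\<close>

lemma bd_list_faces:
  "bd_list xs = (\<Sum>i<length xs. Poly_Mapping.single (face i xs) ((-1) ^ i :: 'k::field))"
proof (induction xs)
  case (Cons x xs)
  have "push_cons x (bd_list xs) = (\<Sum>i<length xs. Poly_Mapping.single (x # face i xs) ((-1) ^ i :: 'k))"
    unfolding Cons.IH by (simp add: cons_lin)
  moreover have "(\<Sum>i<length (x # xs). Poly_Mapping.single (face i (x # xs)) ((-1) ^ i :: 'k)) =
      Poly_Mapping.single xs 1 + (\<Sum>i<length xs. Poly_Mapping.single (x # face i xs) (- ((-1) ^ i)))"
    unfolding length_Cons sum.lessThan_Suc_shift by (simp add: face_def)
  moreover have "(\<Sum>i<length xs. Poly_Mapping.single (x # face i xs) (- ((-1) ^ i :: 'k))) =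
      - (\<Sum>i<length xs. Poly_Mapping.single (x # face i xs) ((-1) ^ i))"
    unfolding sum_negf[symmetric] by (simp add: single_uminus)
  ultimately show ?case by simp
qed simp

lemma chains_cspan: "chains K n = cspan {xs. length xs = Suc n \<and> set xs \<in> K}"
  by (auto simp: chains_def cspan_def)

lemma chains_chn: "c \<in> chains K n \<Longrightarrow> c \<in> chn K"
  by (auto simp: chains_def chn_def cspan_def)

text \<open>On vertices \<open>bdu\<close> vanishes, matching the unreduced convention at
  \<open>n = 0\<close>. In higher degrees the augmentation is 0 and both sides are the alternating
  sum of faces.\<close>

lemma boundary_bdu:
  assumes "c \<in> chains K n"
  shows "boundary n c = bdu c"
proof (cases n)
  case 0
  have "bdu c = 0"
  proof (rule klinear_cspan_zero[OF lin_bdu _ _ assms[unfolded chains_cspan]])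
    fix xs :: "'a list" assume "xs \<in> {xs. length xs = Suc n \<and> set xs \<in> K}"
    then obtain x where "xs = [x]" using 0 by (auto simp: length_Suc_conv)
    then show "bdu (Poly_Mapping.single xs (1 :: 'b)) = 0" by (simp add: bdu_vertex)
  qed simp
  then show ?thesis using 0 by (simp add: boundary_def)
next
  case (Suc m)
  have "eps c = 0" by (rule eps_cspan_zero[OF assms[unfolded chains_cspan]]) (use Suc in auto)
  then have "bdu c = bd c" by (rule bdu_eq)
  also have "\<dots> = (\<Sum>xs\<in>Poly_Mapping.keys c. scl (Poly_Mapping.lookup c xs) (bd_list xs))"
    by (simp add: bd_def lext_def)
  also have "\<dots> = (\<Sum>xs\<in>Poly_Mapping.keys c. \<Sum>i\<le>n. Poly_Mapping.single (face i xs) ((-1) ^ i * Poly_Mapping.lookup c xs))"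
  proof (rule sum.cong[OF refl])
    fix xs assume "xs \<in> Poly_Mapping.keys c"
    then have "{..<length xs} = {..n}" using assms by (auto simp: chains_def)
    then show "scl (Poly_Mapping.lookup c xs) (bd_list xs) =
        (\<Sum>i\<le>n. Poly_Mapping.single (face i xs) ((-1) ^ i * Poly_Mapping.lookup c xs))"
      unfolding bd_list_faces scl_sum by (simp add: mult.commute)
  qed
  finally show ?thesis using Suc by (simp add: boundary_def)
qed

lemma cycles_eq: "cycles K n = {c \<in> chains K n. bdu c = 0}"
  using boundary_bdu unfolding cycles_def by (metis (lifting))

lemma boundaries_eq: "boundaries K n = bdu ` chains K (Suc n)"
  unfolding boundaries_def by (rule image_cong[OF refl boundary_bdu])

lemma ksubspace_cycles: "ksubspace (cycles K n)"
  unfolding ksubspace_def cycles_eq chains_cspan by (auto simp: bdu_lin intro: cspan_closed)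

lemma ksubspace_boundaries: "ksubspace (boundaries K n)"
  unfolding ksubspace_def
proof (intro conjI ballI allI)
  show "0 \<in> boundaries K n" unfolding boundaries_eq chains_cspan by (rule image_eqI[of _ _ 0]) (auto simp: bdu_lin)
  fix x :: "'a list \<Rightarrow>\<^sub>0 'b" assume "x \<in> boundaries K n"
  then obtain c where c: "c \<in> chains K (Suc n)" "x = bdu c" unfolding boundaries_eq by blast
  then show "scl a x \<in> boundaries K n" for a
    unfolding boundaries_eq by (intro image_eqI[of _ _ "scl a c"]) (auto simp: bdu_lin chains_cspan)
  fix y :: "'a list \<Rightarrow>\<^sub>0 'b" assume "y \<in> boundaries K n"
  then obtain d where "d \<in> chains K (Suc n)" "y = bdu d" unfolding boundaries_eq by blast
  then show "x + y \<in> boundaries K n" using c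
    unfolding boundaries_eq by (intro image_eqI[of _ _ "c + d"]) (auto simp: bdu_lin chains_cspan)
qed

lemma chains_mono: "K \<subseteq> L \<Longrightarrow> chains K n \<subseteq> chains L n"
  by (auto simp: chains_def)

lemma lpart_chains: "c \<in> chn K \<Longrightarrow> lpart (Suc n) c \<in> chains K n"
  unfolding chn_def lpart_def chains_cspan by (rule cspan_weaken[OF restr_cspan]) auto

lemma lpart_id: "c \<in> chains K n \<Longrightarrow> lpart (Suc n) c = c"
  unfolding lpart_def by (rule restr_id) (auto simp: chains_def cspan_def)

lemma bdu_lpart: "bdu (lpart (Suc (Suc n)) c) = lpart (Suc n) (bdu c)"
proof -
  have "eps (lpart (Suc (Suc n)) c) = 0"
    by (rule eps_cspan_zero[of _ "{xs. length xs = Suc (Suc n)}"]) (auto simp: lpart_def cspan_iff)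
  then show ?thesis by (simp add: bdu_def bd_lpart klinearD[OF lin_lpart] lpart_single)
qed

lemma bdu_lpart_cycle: "bdu c = 0 \<Longrightarrow> bdu (lpart (Suc n) c) = 0"
proof (cases n)
  case 0
  have "bdu (lpart (Suc n) c) = 0"
  proof (rule klinear_cspan_zero[OF lin_bdu])
    show "lpart (Suc n) c \<in> cspan {xs. length xs = 1}" using 0 by (auto simp: lpart_def cspan_iff)
    show "bdu (Poly_Mapping.single xs 1) = 0" if "xs \<in> {xs. length xs = 1}" for xs :: "'a list"
      using that by (auto simp: length_Suc_conv bdu_vertex)
  qed simp
  then show ?thesis .
qed (simp add: bdu_lpart klinearD[OF lin_lpart])

lemma graded_lpart:
  assumes "graded_functional d \<phi>"
  shows "\<phi> (lpart (Suc n) c) = (if n = d then \<phi> c else 0)"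
proof -
  have lf: "linf \<phi>" using assms by (simp add: graded_functional_def)
  show ?thesis
  proof (cases "n = d")
    case True
    have "\<phi> (c - lpart (Suc n) c) = 0"
      by (rule klinear_cspan_zero[OF lf, of "{xs. length xs \<noteq> Suc n}"])
        (use assms True in \<open>auto simp: graded_functional_def lpart_def cspan_iff lookup_minus\<close>)
    then show ?thesis using True by (simp add: klinearD[OF lf])
  next
    case False
    have "\<phi> (lpart (Suc n) c) = 0"
      by (rule klinear_cspan_zero[OF lf, of "{xs. length xs = Suc n}"])
        (use assms False in \<open>auto simp: graded_functional_def lpart_def cspan_iff\<close>)
    then show ?thesis using False by simp
  qed
qed

lemma inclusion_image:
  assumes "K \<subseteq> L"
  shows "inclusion_map L n ` carrier (homology K n :: ('k::field, _) module) = coset (boundaries L n) ` cycles K n"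
proof -
  let ?B = "boundaries L n :: ('a list \<Rightarrow>\<^sub>0 'k) set"
  have sub: "boundaries K n \<subseteq> ?B" unfolding boundaries_eq using chains_mono[OF assms] by blast
  have "inclusion_map L n (coset (boundaries K n) z) = coset ?B z" for z
  proof (intro antisym subsetI)
    fix w assume "w \<in> inclusion_map L n (coset (boundaries K n) z)"
    then obtain b c where "b \<in> ?B" "c \<in> ?B" "w = (z + b) + c" using sub by (auto simp: inclusion_map_def coset_def)
    then have "w = z + (b + c)" "b + c \<in> ?B" by (auto simp: add.assoc intro: ksubspaceD(2)[OF ksubspace_boundaries])
    then show "w \<in> coset ?B z" unfolding coset_def by blast
  next
    fix w assume "w \<in> coset ?B z"
    then obtain b where "b \<in> ?B" "w = (z + 0) + b" by (auto simp: coset_def)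
    moreover have "z + 0 \<in> coset (boundaries K n) z"
      unfolding coset_def using ksubspaceD(1)[OF ksubspace_boundaries] by blast
    ultimately show "w \<in> inclusion_map L n (coset (boundaries K n) z)" unfolding inclusion_map_def by blast
  qed
  moreover have "carrier (homology K n :: ('k, _) module) = coset (boundaries K n) ` cycles K n"
    by (simp add: homology_def coset_def)
  ultimately show ?thesis by (simp add: image_image)
qed

text \<open>A cycle from \<open>s\<close> bounds at \<open>t\<close> once all functionals active at
  \<open>t\<close> vanish on it. Those of another degree vanish by grading and those not active at
  \<open>s\<close> by the last clause of \<open>barcode_basis\<close>; the others take arbitrary
  values on cycles at \<open>s\<close>, so they are coordinates on the image.\<close>

lemma pm_rank_barcode_basis:
  fixes \<phi> :: "'i \<Rightarrow> ('a list \<Rightarrow>\<^sub>0 'k::field) \<Rightarrow> 'k"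
  assumes b: "barcode_basis K I J deg \<phi>" and mono: "\<And>s t. s \<le> t \<Longrightarrow> K s \<subseteq> K t" and st: "s \<le> t"
  shows "pm_rank (\<lambda>\<epsilon>. homology (K \<epsilon>) n :: ('k, ('a list \<Rightarrow>\<^sub>0 'k) set) module) (\<lambda>s t. inclusion_map (K t) n) s t
    = card {i \<in> I. deg i = n \<and> s \<in> J i \<and> t \<in> J i}"
  unfolding pm_rank_def
proof (rule quotient_dim[where Z = "cycles (K s) n" and B = "boundaries (K t) n" and \<phi> = \<phi>])
  let ?S = "{i \<in> I. deg i = n \<and> s \<in> J i \<and> t \<in> J i}"
  have Kst: "K s \<subseteq> K t" using mono st by blast
  show "finite ?S" by (rule finite_subset[OF _ barcode_basisD(4)[OF b, of s]]) auto
  show "\<phi> i x = 0" if i: "i \<in> ?S" and x: "x \<in> boundaries (K t) n" for i x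
  proof -
    obtain c where c: "c \<in> chains (K t) (Suc n)" "x = bdu c" using x unfolding boundaries_eq by blast
    then show ?thesis using goodD(1)[OF barcode_basisD(5)[OF b, of t], of i c] i chains_chn by auto
  qed
  show "z \<in> boundaries (K t) n" if z: "z \<in> cycles (K s) n" and 0: "\<And>i. i \<in> ?S \<Longrightarrow> \<phi> i z = 0" for z
  proof -
    have zs: "z \<in> chains (K s) n" "bdu z = 0" using z by (auto simp: cycles_eq)
    then have zt: "z \<in> chn (K t)" using chains_mono[OF Kst] chains_chn by blast
    have "\<phi> i z = 0" if i: "i \<in> {i \<in> I. t \<in> J i}" for i
    proof (cases "deg i = n")
      case True
      show ?thesis
      proof (cases "s \<in> J i")
        case False
        show ?thesis by (rule barcode_basisD(6)[OF b _ st False]) (use i zs chains_chn in auto)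
      qed (use 0 i True in auto)
    next
      case False
      then show ?thesis using graded_lpart[OF barcode_basisD(1)[OF b], of i n z] lpart_id[OF zs(1)] i by auto
    qed
    then obtain c where c: "c \<in> chn (K t)" "z = bdu c" using goodD(2)[OF barcode_basisD(5)[OF b, of t] zt zs(2)] by blast
    have "z = bdu (lpart (Suc (Suc n)) c)" using lpart_id[OF zs(1)] c(2) by (simp add: bdu_lpart)
    then show ?thesis unfolding boundaries_eq using lpart_chains[OF c(1)] by blast
  qed
  show "\<exists>z\<in>cycles (K s) n. \<forall>i\<in>?S. \<phi> i z = v i" for v
  proof -
    obtain c where c: "c \<in> chn (K s)" "bdu c = 0" "\<forall>i\<in>{i \<in> I. s \<in> J i}. \<phi> i c = v i"
      using goodD(3)[OF barcode_basisD(5)[OF b, of s], of v] by blast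
    have "lpart (Suc n) c \<in> cycles (K s) n" using lpart_chains[OF c(1)] bdu_lpart_cycle[OF c(2)] by (simp add: cycles_eq)
    moreover have "\<phi> i (lpart (Suc n) c) = v i" if "i \<in> ?S" for i
      using graded_lpart[OF barcode_basisD(1)[OF b], of i n c] c(3) that by auto
    ultimately show ?thesis by blast
  qed
  show "carrier (homology (K t) n\<lparr>carrier := inclusion_map (K t) n ` carrier (homology (K s) n :: ('k, _) module)\<rparr>)
      = coset (boundaries (K t) n) ` cycles (K s) n"
    using inclusion_image[OF Kst] by simp
qed (use barcode_basisD(2)[OF b] ksubspace_cycles ksubspace_boundaries in \<open>auto simp: homology_def scl_def\<close>)

section \<open>Barcodes\<close>

lemma Inf_bar: "p < q \<Longrightarrow> Inf (ereal ` bar p q) = p"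
proof (rule antisym)
  assume pq: "p < q"
  show "p \<le> Inf (ereal ` bar p q)" by (rule Inf_greatest) (auto simp: bar_def)
  show "Inf (ereal ` bar p q) \<le> p"
  proof (rule dense_ge)
    fix y assume "p < y"
    then have "p < min y q" using pq by simp
    then obtain x where "p < ereal x" "ereal x < min y q" using ereal_dense2 by blast
    then show "Inf (ereal ` bar p q) \<le> y"
      by (intro Inf_lower2[of "ereal x"]) (auto simp: bar_def)
  qed
qed

lemma Sup_bar: "p < q \<Longrightarrow> Sup (ereal ` bar p q) = q"
proof (rule antisym)
  assume pq: "p < q"
  show "Sup (ereal ` bar p q) \<le> q" by (rule Sup_least) (auto simp: bar_def)
  show "q \<le> Sup (ereal ` bar p q)"
  proof (rule dense_le)
    fix y assume "y < q"
    then have "max y p < q" using pq by simp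
    then obtain x where "max y p < ereal x" "ereal x < q" using ereal_dense2 by blast
    then show "y \<le> Sup (ereal ` bar p q)"
      by (intro Sup_upper2[of "ereal x"]) (auto simp: bar_def)
  qed
qed

lemma bar_eq_iff: "p < q \<Longrightarrow> p' < q' \<Longrightarrow> bar p q = bar p' q' \<longleftrightarrow> p = p' \<and> q = q'"
  using Inf_bar Sup_bar by metis

lemma bar_nonempty_iff: "bar p q \<noteq> {} \<longleftrightarrow> p < q"
proof
  assume "p < q"
  then obtain x where "p < ereal x" "ereal x < q" using ereal_dense2 by blast
  then show "bar p q \<noteq> {}" by (auto simp: bar_def)
qed (auto simp: bar_def)

text \<open>By inclusion-exclusion the measure of a rectangle counts the bars with endpoints in it.
  Every admissible rectangle counts the bars from \<open>x\<close> to \<open>y\<close>, and as there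
  are finitely many bars, a small one counts nothing else.\<close>

lemma pm_multiplicity_bars:
  assumes rank: "\<And>s t. s < t \<Longrightarrow> pm_rank V \<phi> s t = card {i \<in> M. s \<in> bar (p i) (q i) \<and> t \<in> bar (p i) (q i)}"
    and M: "finite M" and pq: "x < y"
  shows "pm_multiplicity V \<phi> x y = card {i \<in> M. p i = x \<and> q i = y}"
proof -
  \<comment> \<open>Bars are open on the left and closed on the right, which makes the counting
    rectangle half-open. For \<open>d = \<infinity>\<close> there is no upper bound on
    \<open>q i\<close>, because ranks into \<infinity> are 0.\<close>
  define N where "N = (\<lambda>a b c d. {i \<in> M. a \<le> p i \<and> p i < b \<and> c \<le> q i \<and> \<not> (d \<noteq> \<infinity> \<and> d \<le> q i)})"
  have measure: "nat (pm_measure V \<phi> a b c d) = card (N a b c d)"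
    if ab: "a < b" and bc: "b < c" and cd: "c < d" for a b c d
  proof -
    have "b \<noteq> \<infinity>" "b \<noteq> - \<infinity>" "c \<noteq> \<infinity>" "c \<noteq> - \<infinity>" using ab bc cd by auto
    then obtain b' c' where b': "b = ereal b'" and c': "c = ereal c'" by (cases b; cases c) auto
    have bc': "b' < c'" using bc b' c' by simp
    define R where "R = (\<lambda>u w. {i \<in> M. p i < u \<and> w \<noteq> \<infinity> \<and> w \<le> q i})"
    have finR: "finite (R u w)" for u w using M by (simp add: R_def)
    have r: "pm_rank_ext V \<phi> s t = card (R s t)" if st: "s < t" "s \<noteq> \<infinity>" "t \<noteq> - \<infinity>" for s t
    proof (cases "s = - \<infinity> \<or> t = \<infinity>")
      case True
      then show ?thesis by (auto simp: pm_rank_ext_def R_def)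
    next
      case False
      then obtain s' t' where s': "s = ereal s'" "t = ereal t'" using st by (cases s; cases t) auto
      have "pm_rank V \<phi> s' t' = card {i \<in> M. s' \<in> bar (p i) (q i) \<and> t' \<in> bar (p i) (q i)}"
        by (rule rank) (use st s' in simp)
      also have "{i \<in> M. s' \<in> bar (p i) (q i) \<and> t' \<in> bar (p i) (q i)} = R s t"
      proof -
        have "p i < t" "s \<le> q i" if "p i < s" "t \<le> q i" for i using that st(1) by auto
        then show ?thesis using s' by (auto simp: bar_def R_def)
      qed
      finally show ?thesis using False s' by (simp add: pm_rank_ext_def)
    qed
    have a: "a \<noteq> \<infinity>" and d: "d \<noteq> - \<infinity>" using ab cd by auto
    have R1: "R a c \<subseteq> R b c" "R b d \<subseteq> R b c" "R a c \<inter> R b d = R a d" "R a d \<subseteq> R b d"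
      using ab cd c' by (auto simp: R_def intro: less_trans order_trans[OF less_imp_le])
    have "card (R a c \<union> R b d) + card (R a d) = card (R a c) + card (R b d)"
      using card_Un_Int[OF finR finR, of a c b d] R1(3) by simp
    moreover have "card (R b c - (R a c \<union> R b d)) + card (R a c \<union> R b d) = card (R b c)"
      using R1 finR card_Diff_subset[of "R a c \<union> R b d" "R b c"] card_mono[of "R b c" "R a c \<union> R b d"] by auto
    moreover have "card (R b c - (R a c \<union> R b d)) = card (N a b c d)"
      using c' ab by (intro arg_cong[where f = card]) (auto simp: R_def N_def not_less)
    moreover have "pm_measure V \<phi> a b c d = int (card (R b c)) - int (card (R a c)) - int (card (R b d)) + int (card (R a d))"
    proof -
      have "a < c" "b < d" "a < d" using ab bc cd by auto
      then show ?thesis using r[of b c] r[of a c] r[of b d] r[of a d] bc a d b' c'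
        by (simp add: pm_measure_def)
    qed
    ultimately show ?thesis by linarith
  qed
  let ?C = "\<lambda>a b c d. (a < x \<or> a = - \<infinity> \<and> x = - \<infinity>) \<and> x < b \<and> b < c \<and> c < y \<and> (y < d \<or> y = \<infinity> \<and> d = \<infinity>)"
  let ?S = "{nat (pm_measure V \<phi> a b c d) | a b c d. ?C a b c d}"
  let ?P = "{i \<in> M. p i = x \<and> q i = y}"
  have meas: "nat (pm_measure V \<phi> a b c d) = card (N a b c d)" if "?C a b c d" for a b c d
  proof (rule measure)
    show "a < b" "b < c" "c < d" using that by auto
  qed
  have lower: "card ?P \<le> nat (pm_measure V \<phi> a b c d)" if C: "?C a b c d" for a b c d
    unfolding meas[OF C] using M C by (intro card_mono) (auto simp: N_def)
  have "\<exists>a b c d. ?C a b c d \<and> N a b c d = ?P"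
  proof -
    have fin: "finite (insert z (f ` {i \<in> M. Q i}))" for z :: ereal and f Q using M by simp
    \<comment> \<open>The endpoints nearest to \<open>x\<close> and \<open>y\<close> bound the
      rectangle. Admitting \<open>y\<close> as a candidate for \<open>m2\<close>, and later
      \<open>b\<close> for \<open>m3\<close>, secures \<open>b < c\<close> and
      \<open>c < y\<close>.\<close>
    define m1 where "m1 = Max (insert (- \<infinity>) (p ` {i \<in> M. p i < x}))"
    define m2 where "m2 = Min (insert y (p ` {i \<in> M. x < p i}))"
    have m1: "p i \<le> m1" if "i \<in> M" "p i < x" for i unfolding m1_def using fin that by (intro Max_ge) auto
    have m1x: "m1 < x" if "x \<noteq> - \<infinity>" unfolding m1_def using fin that by (subst Max_less_iff) auto
    have m2: "m2 \<le> p i" if "i \<in> M" "x < p i" for i unfolding m2_def using fin that by (intro Min_le) auto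
    have m2x: "x < m2" "m2 \<le> y" unfolding m2_def using fin pq by (auto simp: Min_gr_iff intro!: Min_le)
    have "\<exists>a. (a < x \<or> a = - \<infinity> \<and> x = - \<infinity>) \<and> (\<forall>i\<in>M. p i < x \<longrightarrow> p i < a)"
    proof (cases "x = - \<infinity>")
      case False
      then obtain a where "m1 < a" "a < x" using dense[OF m1x] by blast
      then show ?thesis using m1 by (intro exI[of _ a]) (auto intro: le_less_trans)
    qed auto
    then obtain a where a: "a < x \<or> a = - \<infinity> \<and> x = - \<infinity>" "\<forall>i\<in>M. p i < x \<longrightarrow> p i < a" by blast
    obtain b where b: "x < b" "b < m2" using dense[OF m2x(1)] by blast
    have by': "b < y" using b m2x by simp
    define m3 where "m3 = Max (insert b (q ` {i \<in> M. q i < y}))"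
    have m3: "q i \<le> m3" if "i \<in> M" "q i < y" for i unfolding m3_def using fin that by (intro Max_ge) auto
    have m3b: "b \<le> m3" "m3 < y" unfolding m3_def using fin by' by (auto intro: Max_ge simp: Max_less_iff)
    obtain c where c: "m3 < c" "c < y" using dense[OF m3b(2)] by blast
    define m4 where "m4 = Min (insert \<infinity> (q ` {i \<in> M. y < q i}))"
    have m4: "m4 \<le> q i" if "i \<in> M" "y < q i" for i unfolding m4_def using fin that by (intro Min_le) auto
    have m4y: "y < m4" if "y \<noteq> \<infinity>" unfolding m4_def using fin that by (subst Min_gr_iff) auto
    have "\<exists>d. (y < d \<or> y = \<infinity> \<and> d = \<infinity>) \<and> (\<forall>i\<in>M. y < q i \<longrightarrow> d \<noteq> \<infinity> \<and> d \<le> q i)"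
    proof (cases "y = \<infinity>")
      case False
      then obtain d where "y < d" "d < m4" using dense[OF m4y] by blast
      then show ?thesis using m4 by (intro exI[of _ d]) (auto intro: less_imp_le less_le_trans)
    qed auto
    then obtain d where d: "y < d \<or> y = \<infinity> \<and> d = \<infinity>" "\<forall>i\<in>M. y < q i \<longrightarrow> d \<noteq> \<infinity> \<and> d \<le> q i" by blast
    have bc: "b < c" using m3b c by simp
    have "N a b c d = ?P"
    proof (intro antisym subsetI)
      fix i assume i: "i \<in> N a b c d"
      then have iM: "i \<in> M" by (simp add: N_def)
      have "\<not> p i < x" using a(2) i iM by (auto simp: N_def)
      moreover have "\<not> x < p i" using m2[OF iM] b i by (force simp: N_def)
      moreover have "\<not> q i < y" using m3[OF iM] c i by (force simp: N_def)
      moreover have "\<not> y < q i" using d(2) iM i by (auto simp: N_def)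
      ultimately show "i \<in> ?P" using iM by auto
    next
      fix i assume "i \<in> ?P"
      then show "i \<in> N a b c d" using a b c d by (auto simp: N_def)
    qed
    then show ?thesis using a(1) b(1) bc c(2) d(1) by blast
  qed
  then obtain a b c d where C: "?C a b c d" "N a b c d = ?P" by blast
  have mem: "card ?P \<in> ?S" unfolding mem_Collect_eq
    by (intro exI[of _ a] exI[of _ b] exI[of _ c] exI[of _ d] conjI[OF _ C(1)]) (use C(2) meas[OF C(1)] in simp)
  have "Inf ?S = card ?P"
  proof (rule antisym)
    show "Inf ?S \<le> card ?P" using mem by (rule cInf_lower) simp
    show "card ?P \<le> Inf ?S" by (rule cInf_greatest) (use mem lower in blast)+
  qed
  then show ?thesis by (simp add: pm_multiplicity_def)
qed

text \<open>Some of the \<open>J i\<close> may be empty. They have no endpoints with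
  \<open>p < q\<close> and leave no point in the diagram, hence the filter.\<close>

lemma barcode_bars:
  assumes rank: "\<And>s t. s < t \<Longrightarrow> pm_rank V \<phi> s t = card {i \<in> M. s \<in> J i \<and> t \<in> J i}"
    and M: "finite M" and J: "\<And>i. i \<in> M \<Longrightarrow> \<exists>p q. J i = bar p q"
  shows "barcode V \<phi> = count (filter_mset (\<lambda>I. I \<noteq> {}) (image_mset J (mset_set M)))"
proof
  fix I
  have cnt: "count (filter_mset (\<lambda>I. I \<noteq> {}) (image_mset J (mset_set M))) I = (if I = {} then 0 else card {i \<in> M. J i = I})"
  proof -
    have "count (image_mset J (mset_set M)) I = card {i \<in> M. J i = I}"
    proof -
      have "count (image_mset J (mset_set M)) I = (\<Sum>i\<in>J -` {I} \<inter> M. 1)"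
        using M by (simp add: count_image_mset count_mset_set)
      also have "J -` {I} \<inter> M = {i \<in> M. J i = I}" by auto
      finally show ?thesis by simp
    qed
    then show ?thesis by simp
  qed
  obtain p q where pq: "\<And>i. i \<in> M \<Longrightarrow> J i = bar (p i) (q i)" using J by metis
  show "barcode V \<phi> I = count (filter_mset (\<lambda>I. I \<noteq> {}) (image_mset J (mset_set M))) I"
  proof (cases "\<exists>x y. x < y \<and> I = bar x y")
    case True
    then obtain x y where xy: "x < y" "I = bar x y" by blast
    have "pm_multiplicity V \<phi> x y = card {i \<in> M. p i = x \<and> q i = y}"
    proof (rule pm_multiplicity_bars[OF _ M xy(1)])
      fix s t :: real assume "s < t"
      then show "pm_rank V \<phi> s t = card {i \<in> M. s \<in> bar (p i) (q i) \<and> t \<in> bar (p i) (q i)}"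
        unfolding rank[OF \<open>s < t\<close>] using pq by (intro arg_cong[where f = card] Collect_cong) auto
    qed
    also have "{i \<in> M. p i = x \<and> q i = y} = {i \<in> M. J i = I}"
    proof (rule Collect_cong, rule conj_cong[OF refl])
      fix i assume i: "i \<in> M"
      show "(p i = x \<and> q i = y) = (J i = I)"
      proof (cases "p i < q i")
        case True
        then show ?thesis using bar_eq_iff[OF True xy(1)] pq[OF i] xy(2) by simp
      next
        case False
        then have "J i = {}" using bar_nonempty_iff[of "p i" "q i"] pq[OF i] by simp
        then show ?thesis using False xy bar_nonempty_iff[of x y] by auto
      qed
    qed
    finally have "pm_multiplicity V \<phi> x y = card {i \<in> M. J i = I}" .
    moreover have "I \<noteq> {}" using xy bar_nonempty_iff by simp
    moreover have "barcode V \<phi> I = pm_multiplicity V \<phi> x y"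
      unfolding barcode_def using True xy Inf_bar Sup_bar by simp
    ultimately show ?thesis using cnt by simp
  next
    case False
    have "{i \<in> M. J i = I} = {}" if "I \<noteq> {}"
    proof -
      have "J i \<noteq> I" if "i \<in> M" for i using pq[OF that] False \<open>I \<noteq> {}\<close> bar_nonempty_iff by metis
      then show ?thesis by blast
    qed
    then have "count (filter_mset (\<lambda>I. I \<noteq> {}) (image_mset J (mset_set M))) I = 0"
      unfolding cnt by (metis card.empty)
    then show ?thesis using False by (simp only: barcode_def if_False)
  qed
qed

lemma bcd_barcode_basis:
  assumes b: "barcode_basis (vietoris_rips d X) I J deg (\<phi> :: 'i \<Rightarrow> ('a list \<Rightarrow>\<^sub>0 'k::field) \<Rightarrow> 'k)"
    and fin: "finite {i \<in> I. deg i = n}" and J: "\<And>i. i \<in> I \<Longrightarrow> \<exists>p q. J i = bar p q"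
  shows "bcd TYPE('k) n d X = count (filter_mset (\<lambda>I. I \<noteq> {}) (image_mset J (mset_set {i \<in> I. deg i = n})))"
  unfolding bcd_def
proof (rule barcode_bars[OF _ fin])
  fix s t :: real assume "s < t"
  then have "pm_rank (\<lambda>\<epsilon>. homology (vietoris_rips d X \<epsilon>) n :: ('k, ('a list \<Rightarrow>\<^sub>0 'k) set) module)
      (\<lambda>s t. inclusion_map (vietoris_rips d X t) n) s t = card {i \<in> I. deg i = n \<and> s \<in> J i \<and> t \<in> J i}"
    by (intro pm_rank_barcode_basis[OF b vietoris_rips_mono]) auto
  also have "{i \<in> I. deg i = n \<and> s \<in> J i \<and> t \<in> J i} = {i \<in> {i \<in> I. deg i = n}. s \<in> J i \<and> t \<in> J i}" by auto
  finally show "pm_rank (\<lambda>\<epsilon>. homology (vietoris_rips d X \<epsilon>) n :: ('k, ('a list \<Rightarrow>\<^sub>0 'k) set) module)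
      (\<lambda>s t. inclusion_map (vietoris_rips d X t) n) s t = card {i \<in> {i \<in> I. deg i = n}. s \<in> J i \<and> t \<in> J i}" .
qed (use J in auto)

section \<open>Barcodes of circles and tori\<close>

lemma arc_bar_bar: "\<exists>p q. arc_bar r n = bar p q"
proof (cases n rule: nat_cases_parity)
  case 1
  then have "arc_bar r n = bar 0 \<infinity>" by (auto simp: arc_bar_0 bar_def)
  then show ?thesis by blast
next
  case (2 l)
  have "arc_bar r n = bar (ereal (2 * r * sin (pi * crit l))) (ereal (2 * r * sin (pi * crit (Suc l))))"
    unfolding 2 arc_bar_odd by (auto simp: bar_def)
  then show ?thesis by blast
next
  case 3
  then have "arc_bar r n = bar 0 0" by (auto simp: arc_bar_even bar_def)
  then show ?thesis by blast
qed

lemma bar_Int: "bar p q \<inter> bar p' q' = bar (max p p') (min q q')"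
  by (auto simp: bar_def)

lemma Inter_bar:
  assumes "finite S" "\<And>L. L \<in> S \<Longrightarrow> \<exists>p q. F L = bar p q"
  shows "\<exists>p q. (\<Inter>L\<in>S. F L) = bar p q"
  using assms
proof (induction S)
  case empty
  have "(UNIV :: real set) = bar (- \<infinity>) \<infinity>" by (auto simp: bar_def)
  then show ?case by auto
next
  case (insert L S)
  then obtain p q p' q' where "F L = bar p q" "(\<Inter>L\<in>S. F L) = bar p' q'" by (metis insertCI)
  then have "(\<Inter>L\<in>insert L S. F L) = bar (max p p') (min q q')" by (simp add: bar_Int)
  then show ?case by blast
qed

lemma finite_PiE_sum: "finite {m \<in> {1..N::nat} \<rightarrow>\<^sub>E (UNIV :: nat set). (\<Sum>L=1..N. m L) = n}"
proof (rule finite_subset)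
  show "{m \<in> {1..N} \<rightarrow>\<^sub>E UNIV. (\<Sum>L=1..N. m L) = n} \<subseteq> {1..N} \<rightarrow>\<^sub>E {..n}"
  proof
    fix m assume m: "m \<in> {m \<in> {1..N} \<rightarrow>\<^sub>E (UNIV :: nat set). (\<Sum>L=1..N. m L) = n}"
    have "m L \<le> n" if "L \<in> {1..N}" for L
      using member_le_sum[of L "{1..N}" m] m that by simp
    then show "m \<in> {1..N} \<rightarrow>\<^sub>E {..n}" using m by (auto simp: PiE_def)
  qed
qed (auto intro: finite_PiE)

lemma bcd_circle:
  assumes "0 \<le> r"
  shows "bcd TYPE('k::field) m dist (circle_points r) = count (if arc_bar r m = {} then {#} else {#arc_bar r m#})"
proof -
  obtain \<phi> :: "nat \<Rightarrow> ((real \<times> real) list \<Rightarrow>\<^sub>0 'k) \<Rightarrow> 'k" where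
    b: "barcode_basis (vietoris_rips dist (circle_points r)) UNIV (arc_bar r) id \<phi>"
    using circle_basis[OF assms] by blast
  have "{i \<in> UNIV. id i = m} = {m}" by auto
  then show ?thesis using bcd_barcode_basis[OF b, of m] arc_bar_bar by simp
qed

lemma bcd_torus:
  assumes N: "N \<ge> 1" and r: "\<And>L. 0 \<le> r L"
  shows "bcd TYPE('k::field) n (max_dist N) (torus N r) =
    count (filter_mset (\<lambda>I. I \<noteq> {}) (image_mset (\<lambda>m. \<Inter>L\<in>{1..N}. arc_bar (r L) (m L))
      (mset_set {m \<in> {1..N} \<rightarrow>\<^sub>E UNIV. (\<Sum>L=1..N. m L) = n})))"
proof -
  obtain \<phi> :: "(nat \<Rightarrow> nat) \<Rightarrow> (phase_point list \<Rightarrow>\<^sub>0 'k) \<Rightarrow> 'k" where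
    b: "barcode_basis (torus_complex N r) ({1..N} \<rightarrow>\<^sub>E UNIV) (\<lambda>m. \<Inter>L\<in>{1..N}. arc_bar (r L) (m L)) (\<lambda>m. \<Sum>L=1..N. m L) \<phi>"
    using torus_basis[where r = r and N = N, OF r] by blast
  have "vietoris_rips (max_dist N) (torus N r) = torus_complex N r"
    by (rule ext) (rule vietoris_rips_torus[OF N])
  then have "barcode_basis (vietoris_rips (max_dist N) (torus N r)) ({1..N} \<rightarrow>\<^sub>E UNIV)
      (\<lambda>m. \<Inter>L\<in>{1..N}. arc_bar (r L) (m L)) (\<lambda>m. \<Sum>L=1..N. m L) \<phi>" using b by simp
  then show ?thesis
    by (rule bcd_barcode_basis) (auto intro!: finite_PiE_sum[simplified] Inter_bar arc_bar_bar)
qed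

theorem theorem3p18:
  fixes f :: "real \<Rightarrow> real" and N n :: nat
  assumes periodic: "\<And>t. f (t + 2*pi) = f t"
    and N: "N \<ge> 1"
  shows "(\<forall>L\<in>{1..N}. \<forall>m.
            bcd TYPE('k::field) m dist (plane_proj L ` liouville_torus f N)
              = count (if circle_bar f L m = {} then {#} else {#circle_bar f L m#}))
       \<and> bcd TYPE('k) n (max_dist N) (liouville_torus f N)
           = count (filter_mset (\<lambda>I. I \<noteq> {})
               (image_mset (\<lambda>m. \<Inter>L\<in>{1..N}. circle_bar f L (m L))
                 (mset_set {m \<in> {1..N} \<rightarrow>\<^sub>E UNIV. (\<Sum>L=1..N. m L) = n \<and>
                    (\<forall>L\<in>{1..N}. bcd TYPE('k) (m L) dist (plane_proj L ` liouville_torus f N)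
                       (circle_bar f L (m L)) > 0)})))"
proof
  show circles: "\<forall>L\<in>{1..N}. \<forall>m. bcd TYPE('k) m dist (plane_proj L ` liouville_torus f N)
      = count (if circle_bar f L m = {} then {#} else {#circle_bar f L m#})"
    by (simp add: liouville_torus_eq plane_proj_torus circle_bar_eq bcd_circle[OF radius_nonneg])
  let ?J = "\<lambda>m. \<Inter>L\<in>{1..N}. circle_bar f L (m L)"
  let ?M = "{m \<in> {1..N} \<rightarrow>\<^sub>E (UNIV :: nat set). (\<Sum>L=1..N. m L) = n}"
  let ?M' = "{m \<in> {1..N} \<rightarrow>\<^sub>E UNIV. (\<Sum>L=1..N. m L) = n \<and>
      (\<forall>L\<in>{1..N}. bcd TYPE('k) (m L) dist (plane_proj L ` liouville_torus f N) (circle_bar f L (m L)) > 0)}"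
  \<comment> \<open>An index tuple is excluded exactly when one of its factors is empty; its
    intersection is then empty and is discarded by the filter on the other side.\<close>
  have M': "?M' = {m \<in> ?M. \<forall>L\<in>{1..N}. circle_bar f L (m L) \<noteq> {}}"
    using circles by auto
  have sub: "?M' \<subseteq> ?M" and emp: "\<And>m. m \<in> ?M - ?M' \<Longrightarrow> ?J m = {}" unfolding M' by blast+
  have fin: "finite ?M" by (rule finite_PiE_sum)
  have "filter_mset (\<lambda>I. I \<noteq> {}) (image_mset ?J (mset_set ?M)) =
      filter_mset (\<lambda>I. I \<noteq> {}) (image_mset ?J (mset_set ?M'))"
  proof -
    have "mset_set ?M = mset_set ?M' + mset_set (?M - ?M')"
      using mset_set_Union[of ?M' "?M - ?M'"] sub fin finite_subset[OF sub fin] by (simp add: Un_absorb1)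
    moreover have "filter_mset (\<lambda>I. I \<noteq> {}) (image_mset ?J (mset_set (?M - ?M'))) = {#}"
      using emp fin by (auto simp: filter_mset_eq_conv)
    ultimately show ?thesis by simp
  qed
  moreover have "bcd TYPE('k) n (max_dist N) (liouville_torus f N) =
      count (filter_mset (\<lambda>I. I \<noteq> {}) (image_mset ?J (mset_set ?M)))"
    unfolding liouville_torus_eq circle_bar_eq by (rule bcd_torus[OF N radius_nonneg])
  ultimately show "bcd TYPE('k) n (max_dist N) (liouville_torus f N)
      = count (filter_mset (\<lambda>I. I \<noteq> {}) (image_mset ?J (mset_set ?M')))" by simp
qed

end
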